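(* Let $\varepsilon>0$. Let $(X(k))_{k\geqslant 1}$ be a sequence of independent standard complex Gaussian random variables and let $(A(n))_{n\geqslant 0}$ be the random variables defined by the formal power series identity $$\exp\Big(\sum_{k=1}^{+\infty}\frac{X(k)}{\sqrt k}z^k\Big)=\sum_{n=0}^{+\infty}A(n)z^n .$$ Then almost surely, as $n$ tends to infinity, $A(n)\ll(\log n)^{\frac34+\varepsilon}$; that is, almost surely there exist finite (possibly random) $C$ and $N$ such that $|A(n)|\leqslant C(\log n)^{\frac34+\varepsilon}$ for all $n\geqslant N$.
   Context: A standard complex Gaussian $X(k)$ has independent real and imaginary parts, each a real Gaussian with mean $0$ and variance $\frac12$. *)

theory Defs
  imports "HOL-Probability.Probability" "HOL-Computational_Algebra.Formal_Power_Series"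
begin

text \<open>
  The second parameter of \<^const>\<open>normal_density\<close> is the standard deviation, so variance $1/2$
  corresponds to \<^term>\<open>sqrt (1 / 2)\<close>.
\<close>

definition std_complex_gaussian :: "'a measure \<Rightarrow> ('a \<Rightarrow> complex) \<Rightarrow> bool" where
  "std_complex_gaussian M Z \<longleftrightarrow>
     prob_space.indep_var M borel (\<lambda>\<omega>. Re (Z \<omega>)) borel (\<lambda>\<omega>. Im (Z \<omega>)) \<and>
     distributed M lborel (\<lambda>\<omega>. Re (Z \<omega>)) (normal_density 0 (sqrt (1 / 2))) \<and>
     distributed M lborel (\<lambda>\<omega>. Im (Z \<omega>)) (normal_density 0 (sqrt (1 / 2)))"

text \<open>
  The formal power series $\sum_{k \ge 1} x(k) z^k / \sqrt{k}$. Its constant term is $0$, as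
  \<^const>\<open>fps_compose\<close> requires of the inner series in order to be genuine composition.
\<close>

definition sqrt_weighted_fps :: "(nat \<Rightarrow> complex) \<Rightarrow> complex fps" where
  "sqrt_weighted_fps x =
     Abs_fps (\<lambda>k. if k = 0 then 0 else x k / complex_of_real (sqrt (real k)))"

end

theory Submission
  imports Defs "HOL-Real_Asymp.Real_Asymp"
begin

text \<open>
Reveal the variables $X(k)$ in dyadic blocks $2^i \le k < 2^{i+1}$, and let
$F_i = \sum_n a_i(n) z^n$ be the exponential of the part of the series revealed before block $i$, so
that $A(n) = a_i(n)$ as soon as $n < 2^i$. Two facts are at work.

First, the mass $\sum_n |a_i(n)|^2$ has conditional mean growing exactly by
$\exp(\sum_k 1/k) \approx 2$ per block. Divided by $2^i$ it is therefore essentially a nonnegative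
martingale started at $1$, and it stays below $L$ for all time with probability at least $1 - O(1/L)$.

Second, the contribution of one block to $A(n)$ is, to first order, the Gaussian sum
$\sum_k k^{-1/2} X(k)\, a(n-k)$, whose variance $\sum_k |a(n-k)|^2/k$ is at most $2^{-i}$ times the
mass, hence $O(L)$ uniformly in $n$. So polynomially many (in $2^i$) events are controlled by
Gaussian tails, at the cost of $\log n$ in the square of the deviation. Only the
$O(\log\log n)$ blocks with $2^i \ge n/(C \log n)$ matter: by Rankin's trick the coefficient
$a_i(n)$ has a tiny second moment for smaller $i$ (lemma \<open>smooth_coefficient_le\<close>).
With $L$ a small power of $\log n$, constant over $16^p \le \log_2 n < 16^{p+1}$, the failure
probabilities $O(1/L)$ are summable over $p$; the deviation is about
$(L \log n \log\log n)^{1/2}$, which is below $(\log n)^{3/4}$.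

The first-order approximation is made exact by refining time inside a block. A Gaussian vector $y$ is
split into $T$ independent pieces of variance $1/T$, all indices $k$ of the block advancing together.
At each small step the increment is its linear part, which has a Gaussian exponential moment, plus a
nonlinear remainder orthogonal to the past and of variance $O(T^{-2})$; the $T$ remainders together
have variance $O(1/T)$ and vanish as $T \to \infty$. Because all $k$ advance together, the variance of
the linear step is controlled by the mass at that very moment, for every $n$ at once.

No path space is needed for the refined process. The failure probability, seen as a function of the
current state, is the solution $V$ of a backward recursion (\<open>bellman\<close>), and it is dominated by an
explicit superharmonic function (\<open>potential\<close>): mass over $L$, plus exponentials of the linear
parts, plus squares of the remainders. Stopping when the mass is too large is automatic, since the
potential then exceeds $1 \ge V$. The lemmas \<open>potential_step\<close> (one small step), \<open>block_step\<close> (one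
block, by $T \to \infty$) and \<open>bellman_bound\<close> (all blocks) carry the argument.
\<close>

unbundle no vec_syntax
unbundle fps_syntax

section \<open>Exponentials of formal power series\<close>

text \<open>
Both sides solve the linear differential equation $u' = u\,(g+h)'$ with $u(0)=1$, and its coefficients
are determined recursively.
\<close>

lemma fps_exp_compose_add:
  fixes g h :: "'a::field_char_0 fps"
  assumes "g $ 0 = 0" "h $ 0 = 0"
  shows "fps_exp 1 oo (g + h) = (fps_exp 1 oo g) * (fps_exp 1 oo h)"
proof -
  have deriv: "fps_deriv (fps_exp 1 oo f) = (fps_exp 1 oo f) * fps_deriv f" if "f $ 0 = 0" for f :: "'a fps"
    using that by (simp add: fps_compose_deriv)
  have uniq: "u = v" if "fps_deriv u = u * f" "fps_deriv v = v * f" "u $ 0 = v $ 0" for u v f :: "'a fps"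
  proof (rule fps_ext)
    fix n show "u $ n = v $ n"
    proof (induction n rule: less_induct)
      case (less n)
      show ?case
      proof (cases n)
        case 0 then show ?thesis using that by simp
      next
        case (Suc m)
        have "of_nat (Suc m) * u $ Suc m = (u * f) $ m" using arg_cong[OF that(1), of "\<lambda>x. x $ m"] by simp
        also have "\<dots> = (v * f) $ m"
          unfolding fps_mult_nth using less Suc by (intro sum.cong) auto
        also have "\<dots> = of_nat (Suc m) * v $ Suc m" using arg_cong[OF that(2), of "\<lambda>x. x $ m"] by simp
        finally show ?thesis using Suc by (simp del: of_nat_Suc)
      qed
    qed
  qed
  show ?thesis
  proof (rule uniq[where f = "fps_deriv (g + h)"])
    show "fps_deriv ((fps_exp 1 oo g) * (fps_exp 1 oo h)) = (fps_exp 1 oo g) * (fps_exp 1 oo h) * fps_deriv (g + h)"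
      using assms by (simp add: deriv algebra_simps)
  qed (use assms in \<open>simp_all add: deriv\<close>)
qed

definition zexp :: "nat set \<Rightarrow> (nat \<Rightarrow> 'a) \<Rightarrow> 'a::field_char_0 fps" where
  "zexp B b = fps_exp 1 oo Abs_fps (\<lambda>k. if k \<in> B then b k else 0)"

lemma zexp_empty [simp]: "zexp {} b = 1"
proof -
  have "Abs_fps (\<lambda>k. if k \<in> {} then b k else 0) = 0" by (simp add: fps_eq_iff)
  then show ?thesis by (simp add: zexp_def)
qed

lemma zexp_nth_0 [simp]: "zexp B b $ 0 = 1"
  by (simp add: zexp_def)

lemma zexp_cong: "(\<And>k. k \<in> B \<Longrightarrow> b k = b' k) \<Longrightarrow> zexp B b = zexp B b'"
  unfolding zexp_def by (intro arg_cong[where f = "\<lambda>g. fps_exp 1 oo Abs_fps g"]) auto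

lemma zexp_add:
  assumes "0 \<notin> B"
  shows "zexp B (\<lambda>k. b k + b' k) = zexp B b * zexp B b'"
proof -
  have "Abs_fps (\<lambda>k. if k \<in> B then b k + b' k else 0) =
      Abs_fps (\<lambda>k. if k \<in> B then b k else 0) + Abs_fps (\<lambda>k. if k \<in> B then b' k else 0)"
    by (simp add: fps_eq_iff)
  then show ?thesis using assms by (simp add: zexp_def fps_exp_compose_add)
qed

lemma zexp_Un:
  assumes "0 \<notin> B \<union> C" "B \<inter> C = {}"
  shows "zexp (B \<union> C) b = zexp B b * zexp C b"
proof -
  have "Abs_fps (\<lambda>k. if k \<in> B \<union> C then b k else 0) =
      Abs_fps (\<lambda>k. if k \<in> B then b k else 0) + Abs_fps (\<lambda>k. if k \<in> C then b k else 0)"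
    using assms(2) by (auto simp: fps_eq_iff)
  then show ?thesis using assms(1) by (simp add: zexp_def fps_exp_compose_add)
qed

lemma zexp_nth_cong_le:
  assumes "0 \<notin> B" "0 \<notin> C" "\<And>k. k \<le> n \<Longrightarrow> k \<in> B \<longleftrightarrow> k \<in> C"
  shows "zexp B b $ n = zexp C b $ n"
proof -
  let ?f = "\<lambda>B. Abs_fps (\<lambda>k. if k \<in> B then b k else 0)"
  have "(?f B ^ j) $ m = (?f C ^ j) $ m" if "m \<le> n" for j m
    using that
  proof (induction j arbitrary: m)
    case (Suc j)
    then show ?case using assms(3) by (auto simp: fps_mult_nth intro!: sum.cong)
  qed simp
  then show ?thesis by (simp add: zexp_def fps_compose_nth)
qed

lemma zexp_singleton_nth:
  assumes "k > 0"
  shows "zexp {k} b $ m = (\<Sum>j\<le>m. if k * j = m then b k ^ j / fact j else 0)"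
proof -
  have "Abs_fps (\<lambda>i. if i \<in> {k} then b i else 0) = fps_const (b k) * fps_X ^ k"
    by (auto simp: fps_eq_iff)
  then show ?thesis
    by (auto simp: zexp_def fps_compose_nth power_mult_distrib power_mult[symmetric] fps_const_power
        atMost_atLeast0 intro!: sum.cong)
qed

text \<open>
Peeling off the index $k$: the factor $\exp(b_k z^k)$ is expanded in powers of $b_k$. The weights
$\alpha$ vanish beyond $n$, so that shifting them by $k j$ needs no case distinction; the shape
"polynomial in $b_k$ with coefficients in the remaining variables" is what integrating out a single
Gaussian variable requires.
\<close>

lemma sum_zexp_insert:
  fixes \<alpha> :: "nat \<Rightarrow> 'a::field_char_0"
  assumes "k \<notin> B" "k > 0" "0 \<notin> B" and \<alpha>: "\<And>l. l > n \<Longrightarrow> \<alpha> l = 0"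
  shows "(\<Sum>l\<le>n. \<alpha> l * zexp (insert k B) b $ l) =
    (\<Sum>j\<le>Suc n. b k ^ j / fact j * (\<Sum>l\<le>n. \<alpha> (l + k * j) * zexp B b $ l))"
proof -
  have nth: "zexp (insert k B) b $ l = (\<Sum>i\<le>l. zexp B b $ i * zexp {k} b $ (l - i))" for l
    using zexp_Un[of B "{k}" b] assms by (simp add: fps_mult_nth atMost_atLeast0)
  have "(\<Sum>l\<le>n. \<alpha> l * zexp (insert k B) b $ l) = (\<Sum>l\<le>n. \<Sum>i\<le>l. zexp B b $ i * (\<alpha> l * zexp {k} b $ (l - i)))"
    unfolding nth by (simp add: sum_distrib_left mult_ac)
  also have "\<dots> = (\<Sum>(l,i)\<in>(SIGMA l:{..n}. {..l}). zexp B b $ i * (\<alpha> l * zexp {k} b $ (l - i)))"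
    by (simp add: sum.Sigma)
  also have "\<dots> = (\<Sum>(i,m)\<in>(SIGMA i:{..n}. {..n-i}). zexp B b $ i * (\<alpha> (i + m) * zexp {k} b $ m))"
    by (rule sum.reindex_bij_witness[of _ "\<lambda>(i,m). (i+m,i)" "\<lambda>(l,i). (i,l-i)"]) auto
  also have "\<dots> = (\<Sum>i\<le>n. zexp B b $ i * (\<Sum>m\<le>n-i. \<alpha> (i + m) * zexp {k} b $ m))"
    by (simp add: sum.Sigma sum_distrib_left)
  also have "\<dots> = (\<Sum>i\<le>n. zexp B b $ i * (\<Sum>j\<le>Suc n. \<alpha> (i + k * j) * (b k ^ j / fact j)))"
  proof (rule sum.cong[OF refl], rule arg_cong2[where f="(*)", OF refl])
    fix i assume i: "i \<in> {..n}"
    have "(\<Sum>m\<le>n-i. \<alpha> (i + m) * zexp {k} b $ m) =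
        (\<Sum>m\<le>n-i. \<Sum>j\<le>Suc n. if k * j = m then \<alpha> (i + k * j) * (b k ^ j / fact j) else 0)"
    proof (intro sum.cong refl)
      fix m assume m: "m \<in> {..n - i}"
      have zk: "zexp {k} b $ m = (\<Sum>j\<le>Suc n. if k * j = m then b k ^ j / fact j else 0)"
        unfolding zexp_singleton_nth[OF assms(2)]
        by (rule sum.mono_neutral_left) (use m assms(2) in \<open>auto\<close>)
      show "\<alpha> (i + m) * zexp {k} b $ m = (\<Sum>j\<le>Suc n. if k * j = m then \<alpha> (i + k * j) * (b k ^ j / fact j) else 0)"
        unfolding zk sum_distrib_left by (intro sum.cong) auto
    qed
    also have "\<dots> = (\<Sum>j\<le>Suc n. \<Sum>m\<le>n-i. if k * j = m then \<alpha> (i + k * j) * (b k ^ j / fact j) else 0)"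
      by (rule sum.swap)
    also have "\<dots> = (\<Sum>j\<le>Suc n. \<alpha> (i + k * j) * (b k ^ j / fact j))"
    proof (intro sum.cong refl)
      fix j assume "j \<in> {..Suc n}"
      show "(\<Sum>m\<le>n-i. if k * j = m then \<alpha> (i + k * j) * (b k ^ j / fact j) else 0) = \<alpha> (i + k * j) * (b k ^ j / fact j)"
        using \<alpha>[of "i + k * j"] i by (cases "k * j \<le> n - i") auto
    qed
    finally show "(\<Sum>m\<le>n-i. \<alpha> (i + m) * zexp {k} b $ m) = (\<Sum>j\<le>Suc n. \<alpha> (i + k * j) * (b k ^ j / fact j))" .
  qed
  also have "\<dots> = (\<Sum>j\<le>Suc n. b k ^ j / fact j * (\<Sum>l\<le>n. \<alpha> (l + k * j) * zexp B b $ l))"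
    unfolding sum_distrib_left by (subst sum.swap) (simp add: mult_ac)
  finally show ?thesis .
qed

lemma zexp_nonneg:
  fixes b :: "nat \<Rightarrow> real"
  assumes "\<And>k. k \<in> B \<Longrightarrow> b k \<ge> 0"
  shows "zexp B b $ n \<ge> 0"
proof -
  let ?f = "Abs_fps (\<lambda>k. if k \<in> B then b k else 0)"
  have "(?f ^ j) $ m \<ge> 0" for j m
    by (induction j arbitrary: m) (use assms in \<open>auto simp: fps_mult_nth intro!: sum_nonneg\<close>)
  then show ?thesis by (auto simp: zexp_def fps_compose_nth intro!: sum_nonneg)
qed

lemma sum_exp_series_le:
  assumes "(x::real) \<ge> 0" shows "(\<Sum>j\<le>n. x ^ j / fact j) \<le> exp x"
proof -
  have "(\<Sum>j\<in>{..n}. inverse (fact j) *\<^sub>R x ^ j) \<le> (\<Sum>j. inverse (fact j) *\<^sub>R x ^ j)"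
    using assms by (intro sum_le_suminf summable_exp_generic) auto
  then show ?thesis by (simp add: exp_def divide_inverse mult_ac)
qed

text \<open>
The right side is the value of the series at $r$; all its terms are nonnegative.
\<close>

lemma sum_zexp_le_exp:
  fixes b :: "nat \<Rightarrow> real"
  assumes "finite B" "0 \<notin> B" "\<And>k. k \<in> B \<Longrightarrow> b k \<ge> 0" "r \<ge> 0"
  shows "(\<Sum>l\<le>n. r ^ l * zexp B b $ l) \<le> exp (\<Sum>k\<in>B. b k * r ^ k)"
  using assms
proof (induction B rule: finite_induct)
  case empty
  have "(\<Sum>l\<le>n. r ^ l * (1::real fps) $ l) = (\<Sum>l\<in>{0}. r ^ l * (1::real fps) $ l)"
    by (rule sum.mono_neutral_right) auto
  then show ?case by simp
next
  case (insert k B)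
  have k: "k > 0" using insert.prems by (cases k) auto
  have nn: "zexp B b $ l \<ge> 0" for l using insert.prems by (intro zexp_nonneg) auto
  define \<alpha> where "\<alpha> l = (if l \<le> n then r ^ l else 0)" for l
  have "(\<Sum>l\<le>n. r ^ l * zexp (insert k B) b $ l) = (\<Sum>l\<le>n. \<alpha> l * zexp (insert k B) b $ l)"
    by (simp add: \<alpha>_def)
  also have "\<dots> = (\<Sum>j\<le>Suc n. b k ^ j / fact j * (\<Sum>l\<le>n. \<alpha> (l + k * j) * zexp B b $ l))"
    by (rule sum_zexp_insert) (use insert k in \<open>auto simp: \<alpha>_def\<close>)
  also have "\<dots> \<le> (\<Sum>j\<le>Suc n. b k ^ j / fact j * (\<Sum>l\<le>n. r ^ (l + k * j) * zexp B b $ l))"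
    using insert.prems nn
    by (intro sum_mono mult_left_mono mult_right_mono divide_nonneg_nonneg zero_le_power)
       (auto simp: \<alpha>_def)
  also have "\<dots> = (\<Sum>j\<le>Suc n. (b k * r ^ k) ^ j / fact j) * (\<Sum>l\<le>n. r ^ l * zexp B b $ l)"
    unfolding sum_distrib_right
    by (intro sum.cong refl, simp only: sum_distrib_left power_add power_mult_distrib power_mult)
       (simp add: mult_ac)
  also have "\<dots> \<le> exp (b k * r ^ k) * exp (\<Sum>k\<in>B. b k * r ^ k)"
    using insert.prems nn insert.IH
    by (intro mult_mono sum_exp_series_le sum_nonneg) auto
  finally show ?case using insert.hyps by (simp add: exp_add)
qed

text \<open>
Scaling the exponent by $x \le 1$: terms of degree at least two in the exponent gain a factor
$x^2$. With $x = 1/T$ this is the smallness of the nonlinear part of a small step.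
\<close>

lemma zexp_scale_remainder:
  fixes b :: "nat \<Rightarrow> real"
  assumes "finite B" "0 \<notin> B" "\<And>k. k \<in> B \<Longrightarrow> b k \<ge> 0" "0 \<le> x" "x \<le> 1"
  shows "zexp B (\<lambda>k. x * b k) $ l \<le> (if l = 0 then 1 else 0) + (if l \<in> B then x * b l else 0) + x\<^sup>2 * zexp B b $ l"
proof -
  define g where "g = Abs_fps (\<lambda>k. if k \<in> B then b k else 0)"
  have g0: "(g ^ j) $ m \<ge> 0" for j m
    by (induction j arbitrary: m) (use assms in \<open>auto simp: fps_mult_nth g_def intro!: sum_nonneg\<close>)
  have eq: "Abs_fps (\<lambda>k. if k \<in> B then x * b k else 0) = fps_const x * g"
    by (auto simp: fps_eq_iff g_def)
  have "zexp B (\<lambda>k. x * b k) $ l = (\<Sum>j\<in>{0..l}. x ^ j / fact j * (g ^ j) $ l)"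
    by (simp add: zexp_def eq fps_compose_nth power_mult_distrib fps_const_power)
  also have "\<dots> \<le> (\<Sum>j\<in>{0..l}. (if j = 0 then (g^0) $ l else 0) + (if j = 1 then x * g $ l else 0) + x\<^sup>2 * (1 / fact j * (g ^ j) $ l))"
  proof (intro sum_mono)
    fix j assume "j \<in> {0..l}"
    show "x ^ j / fact j * (g ^ j) $ l \<le> (if j = 0 then (g^0) $ l else 0) + (if j = 1 then x * g $ l else 0) + x\<^sup>2 * (1 / fact j * (g ^ j) $ l)"
    proof (cases "j \<ge> 2")
      case True
      have "x ^ j \<le> x ^ 2" using assms True by (intro power_decreasing) auto
      then show ?thesis using True g0[of j l]
        by (auto simp: divide_simps intro!: mult_right_mono)
    next
      case False
      then have "j = 0 \<or> j = 1" by auto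
      then show ?thesis using g0[of j l] by auto
    qed
  qed
  also have "\<dots> \<le> (if l = 0 then 1 else 0) + (if l \<in> B then x * b l else 0) + x\<^sup>2 * zexp B b $ l"
    using assms
    by (auto simp: sum.distrib sum_distrib_left zexp_def fps_compose_nth sum.delta g_def)
  finally show ?thesis .
qed

section \<open>The standard complex Gaussian measure\<close>

definition rgauss :: "real measure" where
  "rgauss = density lborel (normal_density 0 (sqrt (1 / 2)))"

definition cgauss :: "complex measure" where
  "cgauss = distr (rgauss \<Otimes>\<^sub>M rgauss) borel (\<lambda>(x, y). Complex x y)"

lemma sets_rgauss [measurable_cong, simp]: "sets rgauss = sets borel"
  by (simp add: rgauss_def)

lemma space_rgauss [simp]: "space rgauss = UNIV"
  by (simp add: rgauss_def)

lemma sets_cgauss [measurable_cong, simp]: "sets cgauss = sets borel"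
  by (simp add: cgauss_def)

lemma space_cgauss [simp]: "space cgauss = UNIV"
  by (simp add: cgauss_def)

lemma measurable_Complex [measurable]: "(\<lambda>(x, y). Complex x y) \<in> borel_measurable (borel \<Otimes>\<^sub>M borel)"
proof -
  have "(\<lambda>p. complex_of_real (fst p) + \<i> * complex_of_real (snd p)) \<in> borel_measurable (borel \<Otimes>\<^sub>M borel)"
    by measurable
  then show ?thesis by (simp add: Complex_eq case_prod_unfold)
qed

lemma measurable_cnj [measurable]: "cnj \<in> borel_measurable borel"
  by (intro borel_measurable_continuous_onI continuous_intros)

interpretation rg: prob_space rgauss
  unfolding rgauss_def by (rule prob_space_normal_density) simp

interpretation rg2: pair_prob_space rgauss rgauss ..

interpretation cg: prob_space cgauss
  unfolding cgauss_def by (rule rg2.prob_space_distr) measurable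

lemma nn_integral_cgauss:
  assumes [measurable]: "f \<in> borel_measurable borel"
  shows "(\<integral>\<^sup>+z. f z \<partial>cgauss) = (\<integral>\<^sup>+x. \<integral>\<^sup>+y. f (Complex x y) \<partial>rgauss \<partial>rgauss)"
  unfolding cgauss_def
  by (subst nn_integral_distr) (simp_all add: rg.nn_integral_fst[symmetric] case_prod_unfold)

lemma distr_std_complex_gaussian:
  assumes "prob_space M" "std_complex_gaussian M Z"
  shows "Z \<in> borel_measurable M" "distr M borel Z = cgauss"
proof -
  interpret prob_space M by fact
  have ind: "indep_var borel (\<lambda>\<omega>. Re (Z \<omega>)) borel (\<lambda>\<omega>. Im (Z \<omega>))"
    and re: "distributed M lborel (\<lambda>\<omega>. Re (Z \<omega>)) (normal_density 0 (sqrt (1 / 2)))"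
    and im: "distributed M lborel (\<lambda>\<omega>. Im (Z \<omega>)) (normal_density 0 (sqrt (1 / 2)))"
    using assms(2) by (auto simp: std_complex_gaussian_def)
  have [measurable]: "(\<lambda>\<omega>. Re (Z \<omega>)) \<in> borel_measurable M" "(\<lambda>\<omega>. Im (Z \<omega>)) \<in> borel_measurable M"
    using distributed_measurable[OF re] distributed_measurable[OF im] by auto
  have Zeq: "Z = (\<lambda>\<omega>. Complex (Re (Z \<omega>)) (Im (Z \<omega>)))" by simp
  show Zm: "Z \<in> borel_measurable M"
    by (subst Zeq) measurable
  have rg: "distr M borel (\<lambda>\<omega>. Re (Z \<omega>)) = rgauss" "distr M borel (\<lambda>\<omega>. Im (Z \<omega>)) = rgauss"
    using distributed_distr_eq_density[OF re] distributed_distr_eq_density[OF im]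
    by (simp_all add: rgauss_def cong: distr_cong)
  have "rgauss \<Otimes>\<^sub>M rgauss = distr M (borel \<Otimes>\<^sub>M borel) (\<lambda>\<omega>. (Re (Z \<omega>), Im (Z \<omega>)))"
    using ind unfolding indep_var_distribution_eq rg by simp
  then have "cgauss = distr M borel (\<lambda>\<omega>. Complex (Re (Z \<omega>)) (Im (Z \<omega>)))"
    unfolding cgauss_def by (simp add: distr_distr comp_def)
  then show "distr M borel Z = cgauss" by simp
qed



lemma rgauss_integrable_power: "integrable rgauss (\<lambda>x. x ^ n)"
  using integrable_normal_moment[of "sqrt (1/2)" 0 n]
  unfolding rgauss_def by (subst integrable_density) auto

lemma rgauss_moment_Suc: "(LINT x|rgauss. x ^ Suc n) = n / 2 * (LINT x|rgauss. x ^ (n - 1))"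
proof -
  have ev: "(LINT x|rgauss. x ^ (2 * k)) = fact (2 * k) / (4 ^ k * fact k)" for k
    unfolding rgauss_def using integral_normal_moment_even[of "sqrt (1/2)" 0 k]
    by (subst integral_density) (auto simp: real_sqrt_divide power_divide)
  have od: "(LINT x|rgauss. x ^ (2 * k + 1)) = 0" for k
    unfolding rgauss_def using integral_normal_moment_odd[of "sqrt (1/2)" 0 k]
    by (subst integral_density) auto
  show ?thesis
  proof (cases "even n")
    case True
    then obtain k where k: "n = 2 * k" by (elim evenE)
    show ?thesis
    proof (cases k)
      case 0 then show ?thesis using od[of 0] k by simp
    next
      case (Suc j)
      have "n - 1 = 2 * j + 1" "Suc n = 2 * k + 1" using k Suc by auto
      then show ?thesis using od[of j] od[of k] by (simp del: power_Suc)
    qed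
  next
    case False
    then obtain k where k: "n = 2 * k + 1" by (elim oddE)
    have e: "n - 1 = 2 * k" "Suc n = 2 * Suc k" using k by auto
    have "fact (2 * Suc k) / (4 ^ Suc k * fact (Suc k)) = (2 * real k + 1) / 2 * (fact (2 * k) / (4 ^ k * fact k))"
    proof -
      have "fact (2 * Suc k) = 2 * (real k + 1) * ((2 * real k + 1) * fact (2 * k))"
        by (simp add: algebra_simps)
      moreover have "(4::real) ^ Suc k * fact (Suc k) = 4 * (real k + 1) * (4 ^ k * fact k)"
        by (simp add: algebra_simps)
      ultimately show ?thesis by (simp add: divide_simps) (simp add: algebra_simps)
    qed
    then show ?thesis unfolding e ev using k by simp
  qed
qed

lemma rgauss_integrable_poly:
  fixes p :: "complex poly"
  shows "integrable rgauss (\<lambda>x. poly p (of_real x))"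
proof -
  have "integrable rgauss (\<lambda>x. \<Sum>i\<le>degree p. coeff p i * complex_of_real (x ^ i))"
    by (intro Bochner_Integration.integrable_sum integrable_mult_right integrable_of_real rgauss_integrable_power)
  then show ?thesis by (simp add: poly_altdef)
qed

text \<open>
Integration by parts against the Gaussian weight, read off from the moments.
\<close>

lemma rgauss_stein:
  fixes p :: "complex poly"
  shows "(LINT x|rgauss. of_real x * poly p (of_real x)) = 1 / 2 * (LINT x|rgauss. poly (pderiv p) (of_real x))"
proof -
  have mono: "(LINT x|rgauss. of_real x * poly (monom a i) (of_real x)) = 1 / 2 * (LINT x|rgauss. poly (pderiv (monom a i)) (of_real x))" for a :: complex and i
  proof -
    have "(LINT x|rgauss. of_real x * poly (monom a i) (of_real x)) = a * of_real (LINT x|rgauss. x ^ Suc i)"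
      by (simp add: poly_monom mult_ac flip: of_real_power of_real_mult)
    also have "\<dots> = 1 / 2 * (LINT x|rgauss. poly (pderiv (monom a i)) (of_real x))"
      unfolding rgauss_moment_Suc by (simp add: pderiv_monom poly_monom flip: of_real_power)
    finally show ?thesis .
  qed
  have int1: "integrable rgauss (\<lambda>x. of_real x * poly q (of_real x))" for q :: "complex poly"
    using rgauss_integrable_poly[of "[:0, 1:] * q"] by simp
  have "(LINT x|rgauss. of_real x * poly (\<Sum>i\<in>I. monom (c i) i) (of_real x)) = 1 / 2 * (LINT x|rgauss. poly (pderiv (\<Sum>i\<in>I. monom (c i) i)) (of_real x))"
    if "finite I" for c :: "nat \<Rightarrow> complex" and I
    using that
  proof induction
    case (insert i I)
    then show ?case
      by (simp add: distrib_left pderiv_add Bochner_Integration.integral_add[OF int1 int1] mono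
          Bochner_Integration.integral_add[OF rgauss_integrable_poly rgauss_integrable_poly])
  qed simp
  from this[of "{..degree p}" "coeff p"] show ?thesis by (simp add: poly_as_sum_of_monoms)
qed

lemma rgauss2_integrable_moment:
  "integrable (rgauss \<Otimes>\<^sub>M rgauss) (\<lambda>(x, y). Complex x y ^ i * cnj (Complex x y) ^ j)"
proof (rule Bochner_Integration.integrable_bound)
  let ?n = "i + j"
  have abs: "integrable rgauss (\<lambda>x. \<bar>x\<bar> ^ ?n)"
    using integrable_norm[OF rgauss_integrable_power[of ?n]] by (simp add: power_abs)
  have 1: "integrable (rgauss \<Otimes>\<^sub>M rgauss) (\<lambda>(x, y). \<bar>x\<bar> ^ ?n)"
    by (rule rg2.Fubini_integrable) (use abs in \<open>auto simp: rg.prob_space case_prod_unfold power_abs\<close>)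
  have 2: "integrable (rgauss \<Otimes>\<^sub>M rgauss) (\<lambda>(x, y). \<bar>y\<bar> ^ ?n)"
    by (rule rg2.Fubini_integrable) (use abs in \<open>auto simp: rg.prob_space case_prod_unfold power_abs\<close>)
  show "integrable (rgauss \<Otimes>\<^sub>M rgauss) (\<lambda>p. 2 ^ ?n * ((case p of (x, y) \<Rightarrow> \<bar>x\<bar> ^ ?n) + (case p of (x, y) \<Rightarrow> \<bar>y\<bar> ^ ?n)))"
    by (intro integrable_mult_right Bochner_Integration.integrable_add 1 2)
  show "AE p in rgauss \<Otimes>\<^sub>M rgauss. norm (case p of (x, y) \<Rightarrow> Complex x y ^ i * cnj (Complex x y) ^ j)
      \<le> norm (2 ^ ?n * ((case p of (x, y) \<Rightarrow> \<bar>x\<bar> ^ ?n) + (case p of (x, y) \<Rightarrow> \<bar>y\<bar> ^ ?n)))"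
  proof (rule AE_I2)
    fix p :: "real \<times> real"
    obtain x y where p: "p = (x, y)" by (cases p)
    have "cmod (Complex x y) \<le> \<bar>x\<bar> + \<bar>y\<bar>" using cmod_le[of "Complex x y"] by simp
    also have "\<dots> \<le> 2 * max \<bar>x\<bar> \<bar>y\<bar>" by simp
    finally have "cmod (Complex x y) ^ ?n \<le> (2 * max \<bar>x\<bar> \<bar>y\<bar>) ^ ?n" by (intro power_mono) auto
    also have "\<dots> = 2 ^ ?n * (max \<bar>x\<bar> \<bar>y\<bar>) ^ ?n" by (simp add: power_mult_distrib)
    also have "\<dots> \<le> 2 ^ ?n * (\<bar>x\<bar> ^ ?n + \<bar>y\<bar> ^ ?n)" by (intro mult_left_mono) (auto simp: max_def)
    finally show "norm (case p of (x, y) \<Rightarrow> Complex x y ^ i * cnj (Complex x y) ^ j)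
      \<le> norm (2 ^ ?n * ((case p of (x, y) \<Rightarrow> \<bar>x\<bar> ^ ?n) + (case p of (x, y) \<Rightarrow> \<bar>y\<bar> ^ ?n)))"
      by (simp add: p norm_mult norm_power power_add[symmetric])
  qed
qed measurable

lemma cgauss_integrable_moment: "integrable cgauss (\<lambda>z. z ^ i * cnj z ^ j)"
  unfolding cgauss_def using rgauss2_integrable_moment[of i j]
  by (subst integrable_distr_eq) (auto simp: case_prod_unfold)

text \<open>
Gaussian integration by parts in both coordinates: the operator $\partial_x + i\,\partial_y$ is
$2\,\partial_{\bar z}$, which annihilates $z^i$ and leaves $2 j\, z^i \bar z^{\,j-1}$.
\<close>

lemma cgauss_moment_rec:
  "(LINT z|cgauss. z ^ Suc i * cnj z ^ j) = of_nat j * (LINT z|cgauss. z ^ i * cnj z ^ (j - 1))"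
proof -
  let ?P = "rgauss \<Otimes>\<^sub>M rgauss"
  let ?m = "\<lambda>i j x y. Complex x y ^ i * cnj (Complex x y) ^ j"
  have tr: "(LINT z|cgauss. z ^ i * cnj z ^ j) = (LINT p|?P. ?m i j (fst p) (snd p))" for i j
    unfolding cgauss_def by (subst integral_distr) (auto simp: case_prod_unfold)
  have int: "integrable ?P (\<lambda>p. ?m i j (fst p) (snd p))" for i j
    using rgauss2_integrable_moment[of i j] by (simp add: case_prod_unfold)
  have bd: "integrable ?P (\<lambda>p. g (fst p) (snd p) * ?m i j (fst p) (snd p))"
    if [measurable]: "(\<lambda>p. g (fst p) (snd p)) \<in> borel_measurable ?P"
      and "\<And>x y. cmod (g x y) \<le> cmod (Complex x y)" for i j g
  proof (rule Bochner_Integration.integrable_bound[OF int[of "Suc i" j]])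
    show "AE p in ?P. norm (g (fst p) (snd p) * ?m i j (fst p) (snd p)) \<le> norm (?m (Suc i) j (fst p) (snd p))"
      using that(2) by (auto simp: norm_mult mult_ac intro!: mult_right_mono)
  qed (auto simp: case_prod_unfold[symmetric])
  have intx: "integrable ?P (\<lambda>p. of_real (fst p) * ?m i j (fst p) (snd p))" for i j
    by (rule bd) (auto simp: cmod_def)
  have inty: "integrable ?P (\<lambda>p. of_real (snd p) * ?m i j (fst p) (snd p))" for i j
    by (rule bd) (auto simp: cmod_def)
  let ?D = "\<lambda>i j x y. of_nat i * ?m (i - 1) j x y"
  let ?E = "\<lambda>i j x y. of_nat j * ?m i (j - 1) x y"
  have sx: "(LINT x|rgauss. of_real x * ?m i j x y) = 1/2 * (LINT x|rgauss. ?D i j x y + ?E i j x y)" for y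
  proof -
    \<comment> \<open>For fixed $y$ the integrand is a polynomial in $x$.\<close>
    let ?p = "[:\<i> * of_real y, 1:] ^ i * [:- \<i> * of_real y, 1:] ^ j"
    have "poly ?p (of_real x) = ?m i j x y" for x by (simp add: Complex_eq add.commute complex_cnj)
    moreover have "poly (pderiv ?p) (of_real x) = ?D i j x y + ?E i j x y" for x
      by (simp add: pderiv_mult pderiv_power pderiv_pCons Complex_eq) (simp add: algebra_simps)
    ultimately show ?thesis using rgauss_stein[of ?p] by simp
  qed
  have sy: "(LINT y|rgauss. of_real y * ?m i j x y) = 1/2 * (LINT y|rgauss. \<i> * ?D i j x y - \<i> * ?E i j x y)" for x
  proof -
    let ?p = "[:of_real x, \<i>:] ^ i * [:of_real x, - \<i>:] ^ j"
    have "poly ?p (of_real y) = ?m i j x y" for y by (simp add: Complex_eq mult.commute)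
    moreover have "poly (pderiv ?p) (of_real y) = \<i> * ?D i j x y - \<i> * ?E i j x y" for y
      by (simp add: pderiv_mult pderiv_power pderiv_pCons Complex_eq) (simp add: algebra_simps)
    ultimately show ?thesis using rgauss_stein[of ?p] by simp
  qed
  have X: "(LINT p|?P. of_real (fst p) * ?m i j (fst p) (snd p)) = 1/2 * (LINT p|?P. ?D i j (fst p) (snd p) + ?E i j (fst p) (snd p))"
  proof -
    have "(LINT p|?P. of_real (fst p) * ?m i j (fst p) (snd p)) = (LINT y|rgauss. LINT x|rgauss. of_real x * ?m i j x y)"
      using rg2.integral_snd[of "\<lambda>x y. of_real x * ?m i j x y"] intx by (simp add: case_prod_unfold)
    also have "\<dots> = 1/2 * (LINT y|rgauss. LINT x|rgauss. ?D i j x y + ?E i j x y)"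
      unfolding sx by simp
    also have "(LINT y|rgauss. LINT x|rgauss. ?D i j x y + ?E i j x y) = (LINT p|?P. ?D i j (fst p) (snd p) + ?E i j (fst p) (snd p))"
      using rg2.integral_snd[of "\<lambda>x y. ?D i j x y + ?E i j x y"] int by (simp add: case_prod_unfold)
    finally show ?thesis .
  qed
  have Y: "(LINT p|?P. of_real (snd p) * ?m i j (fst p) (snd p)) = 1/2 * (LINT p|?P. \<i> * ?D i j (fst p) (snd p) - \<i> * ?E i j (fst p) (snd p))"
  proof -
    have "(LINT p|?P. of_real (snd p) * ?m i j (fst p) (snd p)) = (LINT x|rgauss. LINT y|rgauss. of_real y * ?m i j x y)"
      using rg2.integral_fst[of "\<lambda>x y. of_real y * ?m i j x y"] inty by (simp add: case_prod_unfold)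
    also have "\<dots> = 1/2 * (LINT x|rgauss. LINT y|rgauss. \<i> * ?D i j x y - \<i> * ?E i j x y)"
      unfolding sy by simp
    also have "(LINT x|rgauss. LINT y|rgauss. \<i> * ?D i j x y - \<i> * ?E i j x y) = (LINT p|?P. \<i> * ?D i j (fst p) (snd p) - \<i> * ?E i j (fst p) (snd p))"
      using rg2.integral_fst[of "\<lambda>x y. \<i> * ?D i j x y - \<i> * ?E i j x y"] int by (simp add: case_prod_unfold)
    finally show ?thesis .
  qed
  have "(LINT z|cgauss. z ^ Suc i * cnj z ^ j) = (LINT p|?P. of_real (fst p) * ?m i j (fst p) (snd p) + \<i> * (of_real (snd p) * ?m i j (fst p) (snd p)))"
    unfolding tr by (intro Bochner_Integration.integral_cong) (auto simp: Complex_eq algebra_simps)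
  also have "\<dots> = (LINT p|?P. of_real (fst p) * ?m i j (fst p) (snd p)) + \<i> * (LINT p|?P. of_real (snd p) * ?m i j (fst p) (snd p))"
    by (subst Bochner_Integration.integral_add[OF intx integrable_mult_right[OF inty]]) simp
  also have "\<dots> = (LINT p|?P. ?E i j (fst p) (snd p))"
    unfolding X Y
    by (simp add: Bochner_Integration.integral_add[OF integrable_mult_right[OF int] integrable_mult_right[OF int]]
      Bochner_Integration.integral_diff[OF integrable_mult_right[OF integrable_mult_right[OF int]] integrable_mult_right[OF integrable_mult_right[OF int]]] del: integral_mult_right_zero)
      (simp add: field_simps)
  also have "\<dots> = of_nat j * (LINT z|cgauss. z ^ i * cnj z ^ (j - 1))"
    unfolding tr by simp
  finally show ?thesis .
qed

lemma cgauss_moment: "(LINT z|cgauss. z ^ i * cnj z ^ j) = (if i = j then fact i else 0)"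
proof (induction i arbitrary: j)
  case (Suc i)
  show ?case unfolding cgauss_moment_rec Suc by (cases j) auto
next
  case 0
  show ?case
  proof (cases j)
    case 0 then show ?thesis using cg.prob_space by simp
  next
    case (Suc k)
    have "(LINT z|cgauss. cnj z ^ j) = cnj (LINT z|cgauss. z ^ j * cnj z ^ 0)"
      using Bochner_Integration.integral_cnj[of cgauss "\<lambda>z. z ^ j"] by simp
    also have "\<dots> = 0" unfolding Suc cgauss_moment_rec by simp
    finally show ?thesis using Suc by simp
  qed
qed

text \<open>
Expanding the square, only the diagonal survives integration, by \<open>cgauss_moment\<close>.
\<close>

lemma cgauss_L2:
  "(\<integral>\<^sup>+z. ennreal ((cmod (\<Sum>j\<le>n. \<beta> j * z ^ j))\<^sup>2) \<partial>cgauss) = ennreal (\<Sum>j\<le>n. fact j * (cmod (\<beta> j))\<^sup>2)"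
proof -
  have eq: "complex_of_real ((cmod (\<Sum>j\<le>n. \<beta> j * z ^ j))\<^sup>2) =
      (\<Sum>i\<le>n. \<Sum>j\<le>n. (\<beta> i * cnj (\<beta> j)) * (z ^ i * cnj z ^ j))" for z
    unfolding complex_norm_square cnj_sum sum_product by (simp add: mult_ac)
  have int: "integrable cgauss (\<lambda>z. complex_of_real ((cmod (\<Sum>j\<le>n. \<beta> j * z ^ j))\<^sup>2))"
    unfolding eq by (intro Bochner_Integration.integrable_sum integrable_mult_right cgauss_integrable_moment)
  have "(LINT z|cgauss. complex_of_real ((cmod (\<Sum>j\<le>n. \<beta> j * z ^ j))\<^sup>2)) =
      (\<Sum>i\<le>n. \<Sum>j\<le>n. (\<beta> i * cnj (\<beta> j)) * (LINT z|cgauss. z ^ i * cnj z ^ j))"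
    unfolding eq
    by (subst Bochner_Integration.integral_sum
        | intro Bochner_Integration.integrable_sum integrable_mult_right cgauss_integrable_moment sum.cong refl
        | simp)+
  also have "\<dots> = (\<Sum>i\<le>n. of_real (fact i * (cmod (\<beta> i))\<^sup>2))"
    unfolding cgauss_moment by (simp add: if_distrib sum.delta mult_ac flip: complex_norm_square cong: if_cong)
  finally have "(LINT z|cgauss. (cmod (\<Sum>j\<le>n. \<beta> j * z ^ j))\<^sup>2) = (\<Sum>j\<le>n. fact j * (cmod (\<beta> j))\<^sup>2)"
    unfolding integral_complex_of_real of_real_sum[symmetric] of_real_eq_iff .
  then show ?thesis
    using int unfolding complex_of_real_integrable_eq by (subst nn_integral_eq_integral) auto
qed



text \<open>
Completing the square.
\<close>

lemma rgauss_exp: "(\<integral>\<^sup>+x. ennreal (exp (a * x)) \<partial>rgauss) = ennreal (exp (a\<^sup>2 / 4))"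
proof -
  have "(\<integral>\<^sup>+x. ennreal (exp (a * x)) \<partial>rgauss) = (\<integral>\<^sup>+x. ennreal (normal_density 0 (sqrt (1/2)) x) * ennreal (exp (a * x)) \<partial>lborel)"
    unfolding rgauss_def by (subst nn_integral_density) auto
  also have "\<dots> = (\<integral>\<^sup>+x. ennreal (exp (a\<^sup>2 / 4)) * ennreal (normal_density (a / 2) (sqrt (1/2)) x) \<partial>lborel)"
  proof (intro nn_integral_cong)
    fix x :: real
    have "normal_density 0 (sqrt (1/2)) x * exp (a * x) = exp (a\<^sup>2 / 4) * normal_density (a / 2) (sqrt (1/2)) x"
      by (simp add: normal_density_def real_sqrt_divide exp_add[symmetric] power2_eq_square)
         (simp add: algebra_simps)
    then show "ennreal (normal_density 0 (sqrt (1/2)) x) * ennreal (exp (a * x)) =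
        ennreal (exp (a\<^sup>2 / 4)) * ennreal (normal_density (a / 2) (sqrt (1/2)) x)"
      by (simp flip: ennreal_mult)
  qed
  also have "\<dots> = ennreal (exp (a\<^sup>2 / 4))"
    by (subst nn_integral_cmult) (simp_all add: nn_integral_eq_integral)
  finally show ?thesis .
qed

lemma cgauss_exp: "(\<integral>\<^sup>+z. ennreal (exp (Re (c * z))) \<partial>cgauss) = ennreal (exp ((cmod c)\<^sup>2 / 4))"
proof -
  have "(\<integral>\<^sup>+z. ennreal (exp (Re (c * z))) \<partial>cgauss) =
      (\<integral>\<^sup>+x. \<integral>\<^sup>+y. ennreal (exp (Re c * x)) * ennreal (exp ((- Im c) * y)) \<partial>rgauss \<partial>rgauss)"
    by (subst nn_integral_cgauss) (auto simp: exp_add[symmetric] ennreal_mult[symmetric])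
  also have "\<dots> = ennreal (exp ((Re c)\<^sup>2 / 4)) * ennreal (exp ((Im c)\<^sup>2 / 4))"
    by (subst nn_integral_cmult, simp, subst rgauss_exp, subst nn_integral_multc, simp, subst rgauss_exp) simp
  also have "\<dots> = ennreal (exp ((cmod c)\<^sup>2 / 4))"
    by (simp add: cmod_power2 add_divide_distrib exp_add ennreal_mult)
  finally show ?thesis .
qed

lemma rgauss_convolution:
  assumes [measurable]: "f \<in> borel_measurable borel" and c: "c > 0" "c' > 0"
  shows "(\<integral>\<^sup>+x. \<integral>\<^sup>+x'. f (c * x + c' * x') \<partial>rgauss \<partial>rgauss) = (\<integral>\<^sup>+x. f (sqrt (c\<^sup>2 + c'\<^sup>2) * x) \<partial>rgauss)"
proof -
  let ?s = "sqrt (1/2)" and ?n = "normal_density 0"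
  have id: "distributed rgauss lborel (\<lambda>x. x) (?n ?s)"
    by (auto simp: distributed_def rgauss_def intro!: measure_eqI simp: emeasure_distr)
  have sc: "(\<integral>\<^sup>+x. g (a * x) \<partial>rgauss) = (\<integral>\<^sup>+x. ennreal (?n (a * ?s) x) * g x \<partial>lborel)"
    if "a > 0" "g \<in> borel_measurable borel" for a and g :: "real \<Rightarrow> ennreal"
    using distributed_nn_integral[OF rg.normal_density_affine[OF id, of a 0], of g] that by simp
  have "(\<integral>\<^sup>+x. \<integral>\<^sup>+x'. f (c * x + c' * x') \<partial>rgauss \<partial>rgauss) =
      (\<integral>\<^sup>+u. ennreal (?n (c * ?s) u) * (\<integral>\<^sup>+v. ennreal (?n (c' * ?s) v) * f (u + v) \<partial>lborel) \<partial>lborel)"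
    using c by (subst sc[symmetric]) (auto simp: sc[symmetric, of c' "\<lambda>v. f (_ + v)"])
  also have "\<dots> = (\<integral>\<^sup>+u. \<integral>\<^sup>+v. ennreal (?n (c * ?s) u) * (ennreal (?n (c' * ?s) v) * f (u + v)) \<partial>lborel \<partial>lborel)"
    by (subst nn_integral_cmult) auto
  also have "\<dots> = (\<integral>\<^sup>+v. \<integral>\<^sup>+u. ennreal (?n (c * ?s) u) * (ennreal (?n (c' * ?s) v) * f (u + v)) \<partial>lborel \<partial>lborel)"
    by (rule lborel_pair.Fubini') auto
  also have "\<dots> = (\<integral>\<^sup>+v. \<integral>\<^sup>+w. ennreal (?n (c * ?s) (w - v)) * (ennreal (?n (c' * ?s) v) * f w) \<partial>lborel \<partial>lborel)"
  proof (rule nn_integral_cong)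
    fix v :: real
    show "(\<integral>\<^sup>+u. ennreal (?n (c * ?s) u) * (ennreal (?n (c' * ?s) v) * f (u + v)) \<partial>lborel) =
        (\<integral>\<^sup>+w. ennreal (?n (c * ?s) (w - v)) * (ennreal (?n (c' * ?s) v) * f w) \<partial>lborel)"
      by (subst nn_integral_real_affine[where c = 1 and t = "- v"]) (auto simp: add.commute)
  qed
  also have "\<dots> = (\<integral>\<^sup>+w. \<integral>\<^sup>+v. ennreal (?n (c * ?s) (w - v)) * (ennreal (?n (c' * ?s) v) * f w) \<partial>lborel \<partial>lborel)"
    by (rule lborel_pair.Fubini') auto
  also have "\<dots> = (\<integral>\<^sup>+w. (\<integral>\<^sup>+v. ennreal (?n (c * ?s) (w - v) * ?n (c' * ?s) v) \<partial>lborel) * f w \<partial>lborel)"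
    by (subst nn_integral_multc[symmetric]) (auto simp: ennreal_mult mult_ac)
  also have "\<dots> = (\<integral>\<^sup>+w. ennreal (?n (sqrt ((c * ?s)\<^sup>2 + (c' * ?s)\<^sup>2)) w) * f w \<partial>lborel)"
    using c by (intro nn_integral_cong arg_cong2[where f = "(*)"] refl)
       (rule fun_cong[OF conv_normal_density_zero_mean], auto)
  also have "sqrt ((c * ?s)\<^sup>2 + (c' * ?s)\<^sup>2) = sqrt (c\<^sup>2 + c'\<^sup>2) * ?s"
    by (simp only: power_mult_distrib distrib_right[symmetric] real_sqrt_mult) simp
  also have "(\<integral>\<^sup>+w. ennreal (?n (sqrt (c\<^sup>2 + c'\<^sup>2) * ?s) w) * f w \<partial>lborel) = (\<integral>\<^sup>+x. f (sqrt (c\<^sup>2 + c'\<^sup>2) * x) \<partial>rgauss)"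
    by (rule sc[symmetric]) (use c in \<open>auto simp: add_pos_pos\<close>)
  finally show ?thesis .
qed

lemma cgauss_convolution:
  assumes [measurable]: "f \<in> borel_measurable borel" and c: "c > 0" "c' \<ge> 0"
  shows "(\<integral>\<^sup>+z. \<integral>\<^sup>+z'. f (of_real c * z + of_real c' * z') \<partial>cgauss \<partial>cgauss) = (\<integral>\<^sup>+z. f (of_real (sqrt (c\<^sup>2 + c'\<^sup>2)) * z) \<partial>cgauss)"
proof (cases "c' = 0")
  case True
  then show ?thesis using c by (simp add: cg.emeasure_space_1[simplified])
next
  case False
  then have c': "c' > 0" using c by simp
  let ?s = "sqrt (c\<^sup>2 + c'\<^sup>2)"
  have eq: "of_real c * Complex x y + of_real c' * Complex x' y' = Complex (c * x + c' * x') (c * y + c' * y')" for x y x' y'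
    by (simp add: complex_eq_iff)
  have "(\<integral>\<^sup>+z. \<integral>\<^sup>+z'. f (of_real c * z + of_real c' * z') \<partial>cgauss \<partial>cgauss) =
     (\<integral>\<^sup>+x. \<integral>\<^sup>+y. \<integral>\<^sup>+x'. \<integral>\<^sup>+y'. f (Complex (c * x + c' * x') (c * y + c' * y')) \<partial>rgauss \<partial>rgauss \<partial>rgauss \<partial>rgauss)"
    by (subst nn_integral_cgauss, measurable, subst nn_integral_cgauss, measurable, simp add: eq)
  also have "\<dots> = (\<integral>\<^sup>+x. \<integral>\<^sup>+x'. \<integral>\<^sup>+y. \<integral>\<^sup>+y'. f (Complex (c * x + c' * x') (c * y + c' * y')) \<partial>rgauss \<partial>rgauss \<partial>rgauss \<partial>rgauss)"
    by (intro nn_integral_cong rg2.Fubini') measurable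
  also have "\<dots> = (\<integral>\<^sup>+x. \<integral>\<^sup>+x'. \<integral>\<^sup>+y. f (Complex (c * x + c' * x') (?s * y)) \<partial>rgauss \<partial>rgauss \<partial>rgauss)"
    by (intro nn_integral_cong rgauss_convolution[OF _ c(1) c']) measurable
  also have "\<dots> = (\<integral>\<^sup>+x. \<integral>\<^sup>+y. f (Complex (?s * x) (?s * y)) \<partial>rgauss \<partial>rgauss)"
    by (rule rgauss_convolution[OF _ c(1) c']) measurable
  also have "\<dots> = (\<integral>\<^sup>+z. f (of_real ?s * z) \<partial>cgauss)"
    by (subst nn_integral_cgauss) (measurable, simp add: complex_eq_iff complex_of_real_mult_Complex)
  finally show ?thesis .
qed

section \<open>Second moments of Gaussian exponentials\<close>

abbreviation gprod :: "nat set \<Rightarrow> (nat \<Rightarrow> complex) measure" where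
  "gprod B \<equiv> PiM B (\<lambda>_. cgauss)"

interpretation gp: product_prob_space "\<lambda>_::nat. cgauss" UNIV ..

lemma prob_space_gprod: "prob_space (gprod B)"
  by (rule prob_space_PiM) (rule cg.prob_space_axioms)

lemma measurable_zexp_nth:
  fixes b :: "'x \<Rightarrow> nat \<Rightarrow> complex"
  assumes "\<And>k. k \<in> B \<Longrightarrow> (\<lambda>x. b x k) \<in> borel_measurable M"
  shows "(\<lambda>x. zexp B (b x) $ n) \<in> borel_measurable M"
proof -
  let ?f = "\<lambda>x. Abs_fps (\<lambda>k. if k \<in> B then b x k else 0)"
  have "(\<lambda>x. (?f x ^ j) $ m) \<in> borel_measurable M" for j m
  proof (induction j arbitrary: m)
    case (Suc j)
    have "(\<lambda>x. ?f x $ i) \<in> borel_measurable M" for i using assms by (cases "i \<in> B") auto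
    then show ?case unfolding power_Suc fps_mult_nth using Suc
      by (intro borel_measurable_sum borel_measurable_times)
  qed simp
  then show ?thesis unfolding zexp_def fps_compose_nth
    by (intro borel_measurable_sum borel_measurable_times) auto
qed

lemma fps_mult_nth_rev: "(a * b) $ m = (\<Sum>l\<le>m. a $ (m - l) * b $ l)" for a b :: "'b::comm_ring_1 fps"
proof -
  have "(a * b) $ m = (b * a) $ m" by (simp add: mult.commute)
  also have "\<dots> = (\<Sum>l\<le>m. a $ (m - l) * b $ l)"
    unfolding fps_mult_nth atMost_atLeast0 by (intro sum.cong) auto
  finally show ?thesis .
qed

lemma sum_mult_one_nth: "(\<Sum>l\<le>n. f l * (1 :: 'b::comm_ring_1 fps) $ l) = f 0"
proof -
  have "(\<Sum>l\<le>n. f l * (1 :: 'b fps) $ l) = (\<Sum>l\<in>{0}. f l * (1 :: 'b fps) $ l)"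
    by (rule sum.mono_neutral_right) auto
  then show ?thesis by simp
qed

text \<open>
The second moment of $\rho + \sum_l \alpha_l q_l + \sum_{k \in B} \gamma_k y_k$, where $q_l$ are the
coefficients of $\exp(\sum_{k\in B} s_k y_k z^k)$. The $q_l$ are orthogonal with squared norms the
coefficients of $\exp(\sum_{k\in B} s_k^2 z^k)$; the constant $\rho$ interferes with $q_0 = 1$ only,
and $\gamma_k y_k$ only with the linear part $s_k y_k$ of $q_k$. The constant and the linear terms are
included so that the same induction also covers the remainder after subtracting them. Their terms are
written as differences because the last sum already contains $|\alpha_0|^2$ and $|s_k \alpha_k|^2$.
\<close>

definition chaos_energy :: "nat \<Rightarrow> nat set \<Rightarrow> (nat \<Rightarrow> real) \<Rightarrow> complex \<Rightarrow> (nat \<Rightarrow> complex) \<Rightarrow> (nat \<Rightarrow> complex) \<Rightarrow> real" where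
  "chaos_energy n B s \<rho> \<alpha> \<gamma> = (cmod (\<rho> + \<alpha> 0))\<^sup>2 - (cmod (\<alpha> 0))\<^sup>2
     + (\<Sum>k\<in>B. (cmod (\<gamma> k + of_real (s k) * \<alpha> k))\<^sup>2 - (cmod (of_real (s k) * \<alpha> k))\<^sup>2)
     + (\<Sum>l\<le>n. (cmod (\<alpha> l))\<^sup>2 * zexp B (\<lambda>k. (s k)\<^sup>2) $ l)"

lemma chaos_energy_insert:
  assumes "finite B" "k \<notin> B" "k > 0" "0 \<notin> B" and \<alpha>: "\<And>l. l > n \<Longrightarrow> \<alpha> l = 0"
  shows "chaos_energy n (insert k B) s \<rho> \<alpha> \<gamma> =
    (\<Sum>j\<le>Suc n. fact j * chaos_energy n B s (if j = 0 then \<rho> else if j = 1 then \<gamma> k else 0)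
       (\<lambda>l. of_real (s k ^ j / fact j) * \<alpha> (l + k * j)) (\<lambda>i. if j = 0 then \<gamma> i else 0))"
proof -
  define U where "U j = (cmod ((if j = 0 then \<rho> else if j = 1 then \<gamma> k else 0) + of_real (s k ^ j / fact j) * \<alpha> (0 + k * j)))\<^sup>2
      - (cmod (of_real (s k ^ j / fact j) * \<alpha> (0 + k * j)))\<^sup>2
      + (\<Sum>i\<in>B. (cmod ((if j = 0 then \<gamma> i else 0) + of_real (s i) * (of_real (s k ^ j / fact j) * \<alpha> (i + k * j))))\<^sup>2
          - (cmod (of_real (s i) * (of_real (s k ^ j / fact j) * \<alpha> (i + k * j))))\<^sup>2)" for j :: nat
  define E where "E j = (\<Sum>l\<le>n. (cmod (of_real (s k ^ j / fact j) * \<alpha> (l + k * j)))\<^sup>2 * zexp B (\<lambda>k. (s k)\<^sup>2) $ l)" for j :: nat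
  have "(\<Sum>j\<le>Suc n. fact j * U j) = (\<Sum>j\<in>{0,1}. fact j * U j)"
    by (rule sum.mono_neutral_right) (auto simp: U_def)
  also have "\<dots> = (cmod (\<rho> + \<alpha> 0))\<^sup>2 - (cmod (\<alpha> 0))\<^sup>2
     + (\<Sum>k\<in>insert k B. (cmod (\<gamma> k + of_real (s k) * \<alpha> k))\<^sup>2 - (cmod (of_real (s k) * \<alpha> k))\<^sup>2)"
    using assms(1,2) by (simp add: U_def)
  finally have U: "(\<Sum>j\<le>Suc n. fact j * U j) = \<dots>" .
  have "(\<Sum>j\<le>Suc n. fact j * E j) =
      (\<Sum>j\<le>Suc n. ((s k)\<^sup>2) ^ j / fact j * (\<Sum>l\<le>n. (cmod (\<alpha> (l + k * j)))\<^sup>2 * zexp B (\<lambda>k. (s k)\<^sup>2) $ l))"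
  proof (rule sum.cong[OF refl])
    fix j assume "j \<in> {..Suc n}"
    have "fact j * (cmod (of_real (s k ^ j / fact j) * z))\<^sup>2 = ((s k)\<^sup>2) ^ j / fact j * (cmod z)\<^sup>2" for z
      by (simp add: norm_mult norm_divide power_mult_distrib power_divide norm_power power2_eq_square[of "fact j"]
          power_mult[symmetric] mult.commute[of 2] power_even_abs)
    then show "fact j * E j = ((s k)\<^sup>2) ^ j / fact j * (\<Sum>l\<le>n. (cmod (\<alpha> (l + k * j)))\<^sup>2 * zexp B (\<lambda>k. (s k)\<^sup>2) $ l)"
      by (simp only: E_def sum_distrib_left mult.assoc[symmetric])
  qed
  also have "\<dots> = (\<Sum>l\<le>n. (cmod (\<alpha> l))\<^sup>2 * zexp (insert k B) (\<lambda>k. (s k)\<^sup>2) $ l)"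
    by (rule sum_zexp_insert[symmetric]) (use assms in auto)
  finally have E: "(\<Sum>j\<le>Suc n. fact j * E j) = \<dots>" .
  have "chaos_energy n B s (if j = 0 then \<rho> else if j = 1 then \<gamma> k else 0)
       (\<lambda>l. of_real (s k ^ j / fact j) * \<alpha> (l + k * j)) (\<lambda>i. if j = 0 then \<gamma> i else 0) = U j + E j" for j
    by (simp add: chaos_energy_def U_def E_def)
  then show ?thesis
    by (simp only: distrib_left sum.distrib U E) (simp add: chaos_energy_def)
qed

text \<open>
Integrating out one variable $y_k$ turns the form into a polynomial in $y_k$, orthogonal by
\<open>cgauss_L2\<close>; each of its coefficients is again a form of the same kind in the remaining variables.
\<close>

lemma chaos_L2:
  assumes "finite B" "0 \<notin> B" "\<And>l. l > n \<Longrightarrow> \<alpha> l = 0"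
  shows "chaos_energy n B s \<rho> \<alpha> \<gamma> \<ge> 0 \<and>
    (\<integral>\<^sup>+y. ennreal ((cmod (\<rho> + (\<Sum>l\<le>n. \<alpha> l * zexp B (\<lambda>k. of_real (s k) * y k) $ l) + (\<Sum>k\<in>B. \<gamma> k * y k)))\<^sup>2) \<partial>gprod B)
      = ennreal (chaos_energy n B s \<rho> \<alpha> \<gamma>)"
  using assms
proof (induction B arbitrary: \<rho> \<alpha> \<gamma> rule: finite_induct)
  case empty
  have "chaos_energy n {} s \<rho> \<alpha> \<gamma> = (cmod (\<rho> + \<alpha> 0))\<^sup>2"
    using sum_mult_one_nth[of "\<lambda>l. (cmod (\<alpha> l))\<^sup>2" n] by (simp add: chaos_energy_def)
  then show ?case using sum_mult_one_nth[of \<alpha> n]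
    by (simp add: prob_space.emeasure_space_1[OF prob_space_gprod])
next
  case (insert k B)
  have k: "k > 0" using insert.prems by (cases k) auto
  have B0: "0 \<notin> B" using insert.prems by auto
  define \<rho>' where "\<rho>' j = (if j = 0 then \<rho> else if j = 1 then \<gamma> k else 0)" for j :: nat
  define \<alpha>' where "\<alpha>' j l = of_real (s k ^ j / fact j) * \<alpha> (l + k * j)" for j l
  define \<gamma>' where "\<gamma>' j i = (if j = 0 then \<gamma> i else 0)" for j i :: nat
  \<comment> \<open>The coefficient of $y_k^j$, a form in the variables of \<open>B\<close> only.\<close>
  define \<beta> where "\<beta> j x = \<rho>' j + (\<Sum>l\<le>n. \<alpha>' j l * zexp B (\<lambda>k. of_real (s k) * x k) $ l) + (\<Sum>i\<in>B. \<gamma>' j i * x i)" for j x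
  have IH: "chaos_energy n B s (\<rho>' j) (\<alpha>' j) (\<gamma>' j) \<ge> 0"
    "(\<integral>\<^sup>+x. ennreal ((cmod (\<beta> j x))\<^sup>2) \<partial>gprod B) = ennreal (chaos_energy n B s (\<rho>' j) (\<alpha>' j) (\<gamma>' j))" for j
  proof -
    have "\<alpha>' j l = 0" if "l > n" for l using insert.prems(2) that by (simp add: \<alpha>'_def)
    then show "chaos_energy n B s (\<rho>' j) (\<alpha>' j) (\<gamma>' j) \<ge> 0"
      "(\<integral>\<^sup>+x. ennreal ((cmod (\<beta> j x))\<^sup>2) \<partial>gprod B) = ennreal (chaos_energy n B s (\<rho>' j) (\<alpha>' j) (\<gamma>' j))"
      unfolding \<beta>_def using insert.IH[of "\<alpha>' j" "\<rho>' j" "\<gamma>' j"] B0 by auto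
  qed
  have T: "chaos_energy n (insert k B) s \<rho> \<alpha> \<gamma> = (\<Sum>j\<le>Suc n. fact j * chaos_energy n B s (\<rho>' j) (\<alpha>' j) (\<gamma>' j))"
    unfolding \<rho>'_def \<alpha>'_def \<gamma>'_def using insert k B0 by (intro chaos_energy_insert) auto
  have expand: "\<rho> + (\<Sum>l\<le>n. \<alpha> l * zexp (insert k B) (\<lambda>i. of_real (s i) * (x(k := y)) i) $ l) + (\<Sum>i\<in>insert k B. \<gamma> i * (x(k := y)) i)
      = (\<Sum>j\<le>Suc n. \<beta> j x * y ^ j)" for x y
  proof -
    have z: "zexp B (\<lambda>i. of_real (s i) * (x(k := y)) i) = zexp B (\<lambda>i. of_real (s i) * x i)"
      using insert.hyps by (intro zexp_cong) auto
    have "(\<Sum>j\<le>Suc n. \<rho>' j * y ^ j) = (\<Sum>j\<in>{0,1}. \<rho>' j * y ^ j)"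
      by (rule sum.mono_neutral_right) (auto simp: \<rho>'_def)
    then have r: "(\<Sum>j\<le>Suc n. \<rho>' j * y ^ j) = \<rho> + \<gamma> k * y" by (simp add: \<rho>'_def)
    have "(\<Sum>j\<le>Suc n. (\<Sum>i\<in>B. \<gamma>' j i * x i) * y ^ j) = (\<Sum>j\<in>{0}. (\<Sum>i\<in>B. \<gamma>' j i * x i) * y ^ j)"
      by (rule sum.mono_neutral_right) (auto simp: \<gamma>'_def)
    then have g: "(\<Sum>j\<le>Suc n. (\<Sum>i\<in>B. \<gamma>' j i * x i) * y ^ j) = (\<Sum>i\<in>B. \<gamma> i * x i)" by (simp add: \<gamma>'_def)
    have "(\<Sum>l\<le>n. \<alpha> l * zexp (insert k B) (\<lambda>i. of_real (s i) * (x(k := y)) i) $ l) =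
        (\<Sum>j\<le>Suc n. (of_real (s k) * y) ^ j / fact j * (\<Sum>l\<le>n. \<alpha> (l + k * j) * zexp B (\<lambda>i. of_real (s i) * x i) $ l))"
      using sum_zexp_insert[of k B n \<alpha> "\<lambda>i. of_real (s i) * (x(k := y)) i"] insert.hyps insert.prems k B0
      unfolding z fun_upd_same by blast
    also have "\<dots> = (\<Sum>j\<le>Suc n. (\<Sum>l\<le>n. \<alpha>' j l * zexp B (\<lambda>k. of_real (s k) * x k) $ l) * y ^ j)"
      by (rule sum.cong[OF refl]) (simp add: \<alpha>'_def sum_distrib_left sum_distrib_right power_mult_distrib mult_ac)
    finally have a: "(\<Sum>l\<le>n. \<alpha> l * zexp (insert k B) (\<lambda>i. of_real (s i) * (x(k := y)) i) $ l) = \<dots>" .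
    have "(\<Sum>i\<in>B. \<gamma> i * (x(k := y)) i) = (\<Sum>i\<in>B. \<gamma> i * x i)" using insert.hyps by (intro sum.cong) auto
    then have c: "(\<Sum>i\<in>insert k B. \<gamma> i * (x(k := y)) i) = \<gamma> k * y + (\<Sum>i\<in>B. \<gamma> i * x i)"
      using insert.hyps by simp
    show ?thesis unfolding \<beta>_def distrib_right sum.distrib r g a c by (simp only: ac_simps)
  qed
  have [measurable]: "(\<lambda>y. zexp B (\<lambda>i. of_real (s i) * y i) $ l) \<in> borel_measurable (gprod B)" for l B
    by (rule measurable_zexp_nth) measurable
  have [measurable]: "\<beta> j \<in> borel_measurable (gprod B)" for j
    unfolding \<beta>_def by measurable
  have "(\<integral>\<^sup>+y. ennreal ((cmod (\<rho> + (\<Sum>l\<le>n. \<alpha> l * zexp (insert k B) (\<lambda>k. of_real (s k) * y k) $ l) + (\<Sum>k\<in>insert k B. \<gamma> k * y k)))\<^sup>2) \<partial>gprod (insert k B))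
      = (\<integral>\<^sup>+x. \<integral>\<^sup>+y. ennreal ((cmod (\<Sum>j\<le>Suc n. \<beta> j x * y ^ j))\<^sup>2) \<partial>cgauss \<partial>gprod B)"
    unfolding expand[symmetric]
    by (rule gp.product_nn_integral_insert[OF insert.hyps]) measurable
  also have "\<dots> = (\<integral>\<^sup>+x. (\<Sum>j\<le>Suc n. ennreal (fact j) * ennreal ((cmod (\<beta> j x))\<^sup>2)) \<partial>gprod B)"
    unfolding cgauss_L2 by (simp add: sum_ennreal[symmetric] ennreal_mult del: sum.atMost_Suc)
  also have "\<dots> = (\<Sum>j\<le>Suc n. ennreal (fact j) * ennreal (chaos_energy n B s (\<rho>' j) (\<alpha>' j) (\<gamma>' j)))"
    unfolding IH(2)[symmetric]
    by (subst nn_integral_sum, measurable) (intro sum.cong refl nn_integral_cmult, measurable)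
  also have "\<dots> = ennreal (chaos_energy n (insert k B) s \<rho> \<alpha> \<gamma>)"
    unfolding T using IH(1) by (simp add: sum_ennreal[symmetric] ennreal_mult del: sum.atMost_Suc)
  finally show ?case using IH(1) unfolding T by (auto intro!: sum_nonneg simp del: sum.atMost_Suc)
qed

lemma gaussian_exp_coeff_L2:
  assumes "finite B" "0 \<notin> B"
  shows "(\<integral>\<^sup>+y. ennreal ((cmod ((a * zexp B (\<lambda>k. of_real (s k) * y k)) $ m))\<^sup>2) \<partial>gprod B)
    = ennreal (\<Sum>l\<le>m. (cmod (a $ (m - l)))\<^sup>2 * zexp B (\<lambda>k. (s k)\<^sup>2) $ l)"
proof -
  define \<alpha> where "\<alpha> l = (if l \<le> m then a $ (m - l) else 0)" for l
  have "(a * zexp B b) $ m = (\<Sum>l\<le>m. \<alpha> l * zexp B b $ l)" for b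
    by (simp add: fps_mult_nth_rev \<alpha>_def)
  then show ?thesis
    using chaos_L2[of B m \<alpha> s 0 "\<lambda>_. 0"] assms by (simp add: \<alpha>_def chaos_energy_def)
qed

text \<open>
Removing the constant and the linear part of the exponential leaves a centred remainder: its second
moment adds to $|r|^2$ without a cross term, and it is quadratically small in the variance $x$.
\<close>

lemma gaussian_exp_remainder_L2:
  assumes B: "finite B" "0 \<notin> B" and b: "\<And>k. k \<in> B \<Longrightarrow> b k \<ge> 0" "\<And>k. k \<in> B \<Longrightarrow> (s k)\<^sup>2 = x * b k" "0 \<le> x" "x \<le> 1"
  shows "(\<integral>\<^sup>+y. ennreal ((cmod (r + ((a * (zexp B (\<lambda>k. of_real (s k) * y k) - 1)) $ m
       - (\<Sum>k\<in>B. (if k \<le> m then a $ (m - k) else 0) * (of_real (s k) * y k)))))\<^sup>2) \<partial>gprod B)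
    \<le> ennreal ((cmod r)\<^sup>2 + x\<^sup>2 * (\<Sum>l\<le>m. (cmod (a $ (m - l)))\<^sup>2 * zexp B b $ l))"
proof -
  define \<alpha> where "\<alpha> l = (if l \<le> m then a $ (m - l) else 0)" for l
  define e where "e = zexp B (\<lambda>k. (s k)\<^sup>2)"
  have e: "e = zexp B (\<lambda>k. x * b k)" unfolding e_def using b(2) by (intro zexp_cong) auto
  have mult: "(a * (zexp B b - 1)) $ m = (\<Sum>l\<le>m. \<alpha> l * zexp B b $ l) - a $ m" for b
  proof -
    have "(a * zexp B b) $ m = (\<Sum>l\<le>m. \<alpha> l * zexp B b $ l)"
      by (simp add: fps_mult_nth_rev \<alpha>_def)
    then show ?thesis by (simp add: right_diff_distrib)
  qed
  have eq: "r + ((a * (zexp B (\<lambda>k. of_real (s k) * y k) - 1)) $ m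
       - (\<Sum>k\<in>B. (if k \<le> m then a $ (m - k) else 0) * (of_real (s k) * y k)))
     = (r - a $ m) + (\<Sum>l\<le>m. \<alpha> l * zexp B (\<lambda>k. of_real (s k) * y k) $ l) + (\<Sum>k\<in>B. (- of_real (s k) * \<alpha> k) * y k)" for y
    unfolding mult by (simp add: \<alpha>_def sum_negf[symmetric] mult_ac)
  have "chaos_energy m B s (r - a $ m) \<alpha> (\<lambda>k. - of_real (s k) * \<alpha> k)
     = (cmod r)\<^sup>2 - (cmod (\<alpha> 0))\<^sup>2 - (\<Sum>k\<in>B. (cmod (of_real (s k) * \<alpha> k))\<^sup>2) + (\<Sum>l\<le>m. (cmod (\<alpha> l))\<^sup>2 * e $ l)"
    by (simp add: chaos_energy_def \<alpha>_def sum_negf[symmetric] e_def)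
  also have "(\<Sum>l\<le>m. (cmod (\<alpha> l))\<^sup>2 * e $ l) \<le> (\<Sum>l\<le>m. (cmod (\<alpha> l))\<^sup>2 * ((if l = 0 then 1 else 0) + (if l \<in> B then x * b l else 0) + x\<^sup>2 * zexp B b $ l))"
    unfolding e using B b by (intro sum_mono mult_left_mono zexp_scale_remainder) auto
  also have "\<dots> = (cmod (\<alpha> 0))\<^sup>2 + (\<Sum>l\<in>{..m} \<inter> B. (cmod (of_real (s l) * \<alpha> l))\<^sup>2) + x\<^sup>2 * (\<Sum>l\<le>m. (cmod (\<alpha> l))\<^sup>2 * zexp B b $ l)"
  proof -
    have 1: "(\<Sum>l\<le>m. (cmod (\<alpha> l))\<^sup>2 * (if l = 0 then 1 else 0)) = (cmod (\<alpha> 0))\<^sup>2"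
      by (simp add: if_distrib cong: if_cong)
    have 2: "(\<Sum>l\<le>m. (cmod (\<alpha> l))\<^sup>2 * (if l \<in> B then x * b l else 0)) = (\<Sum>l\<in>{..m} \<inter> B. (cmod (of_real (s l) * \<alpha> l))\<^sup>2)"
      by (subst sum.inter_restrict) (auto simp: norm_mult power_mult_distrib b(2) intro!: sum.cong)
    show ?thesis by (simp only: distrib_left sum.distrib 1 2) (simp add: sum_distrib_left mult_ac)
  qed
  also have "(\<Sum>l\<in>{..m} \<inter> B. (cmod (of_real (s l) * \<alpha> l))\<^sup>2) = (\<Sum>k\<in>B. (cmod (of_real (s k) * \<alpha> k))\<^sup>2)"
    using B by (intro sum.mono_neutral_left) (auto simp: \<alpha>_def)
  finally have "chaos_energy m B s (r - a $ m) \<alpha> (\<lambda>k. - of_real (s k) * \<alpha> k)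
     \<le> (cmod r)\<^sup>2 + x\<^sup>2 * (\<Sum>l\<le>m. (cmod (\<alpha> l))\<^sup>2 * zexp B b $ l)" by simp
  also have "(\<Sum>l\<le>m. (cmod (\<alpha> l))\<^sup>2 * zexp B b $ l) = (\<Sum>l\<le>m. (cmod (a $ (m - l)))\<^sup>2 * zexp B b $ l)"
    by (simp add: \<alpha>_def)
  finally have "chaos_energy m B s (r - a $ m) \<alpha> (\<lambda>k. - of_real (s k) * \<alpha> k)
     \<le> (cmod r)\<^sup>2 + x\<^sup>2 * (\<Sum>l\<le>m. (cmod (a $ (m - l)))\<^sup>2 * zexp B b $ l)" .
  moreover have az: "\<alpha> l = 0" if "l > m" for l using that by (simp add: \<alpha>_def)
  ultimately show ?thesis unfolding eq
    using chaos_L2[of B m \<alpha> s "r - a $ m" "\<lambda>k. - of_real (s k) * \<alpha> k"] B az by (simp add: ennreal_leI)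
qed

lemma gprod_exp:
  assumes "finite B"
  shows "(\<integral>\<^sup>+y. ennreal (exp (Re (\<Sum>k\<in>B. c k * y k))) \<partial>gprod B) = ennreal (exp ((\<Sum>k\<in>B. (cmod (c k))\<^sup>2) / 4))"
proof -
  have "(\<integral>\<^sup>+y. ennreal (exp (Re (\<Sum>k\<in>B. c k * y k))) \<partial>gprod B) =
      (\<integral>\<^sup>+y. (\<Prod>k\<in>B. ennreal (exp (Re (c k * y k)))) \<partial>gprod B)"
    using assms by (simp add: exp_sum prod_ennreal)
  also have "\<dots> = (\<Prod>k\<in>B. \<integral>\<^sup>+z. ennreal (exp (Re (c k * z))) \<partial>cgauss)"
    by (rule gp.product_nn_integral_prod[OF assms]) measurable
  also have "\<dots> = ennreal (exp ((\<Sum>k\<in>B. (cmod (c k))\<^sup>2) / 4))"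
    unfolding cgauss_exp using assms by (simp add: prod_ennreal exp_sum[symmetric] sum_divide_distrib)
  finally show ?thesis .
qed

text \<open>
The heat semigroup property. It is enough to compare the two laws on boxes, where the
integrals factor into one-dimensional ones.
\<close>

lemma gprod_convolution:
  assumes "finite B" and f: "f \<in> borel_measurable (PiM B (\<lambda>_. borel))" and c: "c > 0" "c' \<ge> 0"
  shows "(\<integral>\<^sup>+y. \<integral>\<^sup>+y'. f (\<lambda>k\<in>B. of_real c * y k + of_real c' * y' k) \<partial>gprod B \<partial>gprod B)
    = (\<integral>\<^sup>+y. f (\<lambda>k\<in>B. of_real (sqrt (c\<^sup>2 + c'\<^sup>2)) * y k) \<partial>gprod B)"
proof -
  let ?N = "PiM B (\<lambda>_. borel :: complex measure)"
  let ?s = "sqrt (c\<^sup>2 + c'\<^sup>2)"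
  interpret P: pair_prob_space "gprod B" "gprod B"
    by (simp add: pair_prob_space_def pair_sigma_finite_def prob_space_gprod prob_space_imp_sigma_finite)
  \<comment> \<open>Both laws are the product of the law of a scaled standard Gaussian.\<close>
  define \<nu> where "\<nu> = distr cgauss borel (\<lambda>z. of_real ?s * z)"
  interpret nu: prob_space \<nu> unfolding \<nu>_def by (rule cg.prob_space_distr) measurable
  interpret pn: product_sigma_finite "\<lambda>_::nat. \<nu>"
    by (simp add: product_sigma_finite_def nu.sigma_finite_measure_axioms)
  have sN: "sets (PiM B (\<lambda>_. \<nu>)) = sets ?N" by (rule sets_PiM_cong) (auto simp: \<nu>_def)
  have m1 [measurable]: "(\<lambda>(y, y'). \<lambda>k\<in>B. of_real c * y k + of_real c' * y' k) \<in> gprod B \<Otimes>\<^sub>M gprod B \<rightarrow>\<^sub>M ?N"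
    unfolding case_prod_unfold by (rule measurable_restrict) measurable
  have m2 [measurable]: "(\<lambda>y. \<lambda>k\<in>B. of_real ?s * y k) \<in> gprod B \<rightarrow>\<^sub>M ?N"
    by (rule measurable_restrict) measurable
  let ?D1 = "distr (gprod B \<Otimes>\<^sub>M gprod B) ?N (\<lambda>(y, y'). \<lambda>k\<in>B. of_real c * y k + of_real c' * y' k)"
  let ?D2 = "distr (gprod B) ?N (\<lambda>y. \<lambda>k\<in>B. of_real ?s * y k)"
  have ind: "indicator (Pi\<^sub>E B A) (\<lambda>k\<in>B. g k) = (\<Prod>k\<in>B. indicator (A k) (g k) :: ennreal)" for A and g :: "nat \<Rightarrow> complex"
  proof (cases "\<forall>k\<in>B. g k \<in> A k")
    case False
    then have "(\<Prod>k\<in>B. indicator (A k) (g k) :: ennreal) = 0"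
      using assms(1) by (intro prod_zero) (auto simp: indicator_def)
    then show ?thesis using False by (auto simp: indicator_def PiE_def Pi_def)
  qed (auto simp: indicator_def)
  have "?D1 = PiM B (\<lambda>_. \<nu>)"
  proof (rule pn.PiM_eqI[OF assms(1)])
    fix A :: "nat \<Rightarrow> complex set" assume "\<And>i. i \<in> B \<Longrightarrow> A i \<in> sets \<nu>"
    then have A [measurable]: "\<And>i. i \<in> B \<Longrightarrow> A i \<in> sets borel" by (simp add: \<nu>_def)
    have PA [measurable]: "Pi\<^sub>E B A \<in> sets ?N" using assms(1) A by (intro sets_PiM_I_finite) auto
    have "emeasure ?D1 (Pi\<^sub>E B A) = (\<integral>\<^sup>+w. indicator (Pi\<^sub>E B A) w \<partial>?D1)" by simp
    also have "\<dots> = (\<integral>\<^sup>+p. (case p of (y, y') \<Rightarrow> indicator (Pi\<^sub>E B A) (\<lambda>k\<in>B. of_real c * y k + of_real c' * y' k)) \<partial>(gprod B \<Otimes>\<^sub>M gprod B))"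
      by (subst nn_integral_distr) (auto simp: case_prod_unfold)
    also have "\<dots> = (\<integral>\<^sup>+p. (case p of (y, y') \<Rightarrow> (\<Prod>k\<in>B. indicator (A k) (of_real c * y k + of_real c' * y' k))) \<partial>(gprod B \<Otimes>\<^sub>M gprod B))"
      by (simp only: ind)
    also have "\<dots> = (\<integral>\<^sup>+y. \<integral>\<^sup>+y'. (\<Prod>k\<in>B. indicator (A k) (of_real c * y k + of_real c' * y' k)) \<partial>gprod B \<partial>gprod B)"
      by (subst sigma_finite_measure.nn_integral_fst[OF prob_space_imp_sigma_finite[OF prob_space_gprod], symmetric]) (simp_all add: case_prod_unfold, measurable)
    also have "\<dots> = (\<integral>\<^sup>+y. (\<Prod>k\<in>B. \<integral>\<^sup>+z'. indicator (A k) (of_real c * y k + of_real c' * z') \<partial>cgauss) \<partial>gprod B)"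
      by (intro nn_integral_cong gp.product_nn_integral_prod[OF assms(1)]) measurable
    also have "\<dots> = (\<Prod>k\<in>B. \<integral>\<^sup>+z. \<integral>\<^sup>+z'. indicator (A k) (of_real c * z + of_real c' * z') \<partial>cgauss \<partial>cgauss)"
      by (rule gp.product_nn_integral_prod[OF assms(1)]) measurable
    also have "\<dots> = (\<Prod>k\<in>B. \<integral>\<^sup>+z. indicator (A k) (of_real ?s * z) \<partial>cgauss)"
      using c by (intro prod.cong refl cgauss_convolution) auto
    also have "\<dots> = (\<Prod>k\<in>B. emeasure \<nu> (A k))"
    proof (intro prod.cong refl)
      fix k assume k: "k \<in> B"
      have "emeasure \<nu> (A k) = (\<integral>\<^sup>+w. indicator (A k) w \<partial>\<nu>)" using A[OF k] by (simp add: \<nu>_def)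
      also have "\<dots> = (\<integral>\<^sup>+z. indicator (A k) (of_real ?s * z) \<partial>cgauss)"
        unfolding \<nu>_def using A[OF k] by (subst nn_integral_distr) auto
      finally show "(\<integral>\<^sup>+z. indicator (A k) (of_real ?s * z) \<partial>cgauss) = emeasure \<nu> (A k)" by simp
    qed
    finally show "emeasure ?D1 (Pi\<^sub>E B A) = (\<Prod>i\<in>B. emeasure \<nu> (A i))" .
  qed (simp add: sN)
  moreover have "?D2 = PiM B (\<lambda>_. \<nu>)"
  proof (rule pn.PiM_eqI[OF assms(1)])
    fix A :: "nat \<Rightarrow> complex set" assume "\<And>i. i \<in> B \<Longrightarrow> A i \<in> sets \<nu>"
    then have A [measurable]: "\<And>i. i \<in> B \<Longrightarrow> A i \<in> sets borel" by (simp add: \<nu>_def)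
    have PA [measurable]: "Pi\<^sub>E B A \<in> sets ?N" using assms(1) A by (intro sets_PiM_I_finite) auto
    have "emeasure ?D2 (Pi\<^sub>E B A) = (\<integral>\<^sup>+w. indicator (Pi\<^sub>E B A) w \<partial>?D2)" by simp
    also have "\<dots> = (\<integral>\<^sup>+y. (\<Prod>k\<in>B. indicator (A k) (of_real ?s * y k)) \<partial>gprod B)"
      by (subst nn_integral_distr) (auto simp only: ind m2, auto)
    also have "\<dots> = (\<Prod>k\<in>B. \<integral>\<^sup>+z. indicator (A k) (of_real ?s * z) \<partial>cgauss)"
      by (rule gp.product_nn_integral_prod[OF assms(1)]) measurable
    also have "\<dots> = (\<Prod>k\<in>B. emeasure \<nu> (A k))"
    proof (intro prod.cong refl)
      fix k assume k: "k \<in> B"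
      have "emeasure \<nu> (A k) = (\<integral>\<^sup>+w. indicator (A k) w \<partial>\<nu>)" using A[OF k] by (simp add: \<nu>_def)
      also have "\<dots> = (\<integral>\<^sup>+z. indicator (A k) (of_real ?s * z) \<partial>cgauss)"
        unfolding \<nu>_def using A[OF k] by (subst nn_integral_distr) auto
      finally show "(\<integral>\<^sup>+z. indicator (A k) (of_real ?s * z) \<partial>cgauss) = emeasure \<nu> (A k)" by simp
    qed
    finally show "emeasure ?D2 (Pi\<^sub>E B A) = (\<Prod>i\<in>B. emeasure \<nu> (A i))" .
  qed (simp add: sN)
  ultimately have eq: "?D1 = ?D2" by simp
  have "(\<integral>\<^sup>+y. \<integral>\<^sup>+y'. f (\<lambda>k\<in>B. of_real c * y k + of_real c' * y' k) \<partial>gprod B \<partial>gprod B) = (\<integral>\<^sup>+w. f w \<partial>?D1)"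
    using f by (subst nn_integral_distr) (auto simp: case_prod_unfold sigma_finite_measure.nn_integral_fst[OF prob_space_imp_sigma_finite[OF prob_space_gprod], symmetric])
  also have "\<dots> = (\<integral>\<^sup>+y. f (\<lambda>k\<in>B. of_real ?s * y k) \<partial>gprod B)"
    unfolding eq using f by (subst nn_integral_distr) auto
  finally show ?thesis .
qed

section \<open>Block dynamics and its potential\<close>

type_synonym state = "(nat \<Rightarrow> complex) \<times> (nat \<Rightarrow> complex)"

abbreviation state_space :: "state measure" where
  "state_space \<equiv> PiM UNIV (\<lambda>_. borel) \<Otimes>\<^sub>M PiM UNIV (\<lambda>_. borel)"

abbreviation gexp :: "nat set \<Rightarrow> (nat \<Rightarrow> complex) \<Rightarrow> complex fps" where
  "gexp B y \<equiv> zexp B (\<lambda>k. of_real (1 / sqrt (real k)) * y k)"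

text \<open>
A state $(a, d)$ holds the coefficients $a$ of the current power series and, for each $n$, the
increments $d(n)$ that $a(n)$ has received while $n$ was active. Multiplying by the exponential of the
Gaussian polynomial with values $y$ on $B$ moves the state; \<open>S\<close> is the set of active $n$.
\<close>

definition reveal :: "nat set \<Rightarrow> nat set \<Rightarrow> (nat \<Rightarrow> complex) \<Rightarrow> state \<Rightarrow> state" where
  "reveal B S y s =
     ((\<lambda>n. (Abs_fps (fst s) * gexp B y) $ n),
      (\<lambda>n. snd s n + (if n \<in> S then (Abs_fps (fst s) * (gexp B y - 1)) $ n else 0)))"

lemma Abs_fps_nth_eta [simp]: "Abs_fps (\<lambda>n. f $ n) = f"
  by (simp add: fps_eq_iff)

lemma reveal_add:
  assumes "0 \<notin> B"
  shows "reveal B S y' (reveal B S y s) = reveal B S (\<lambda>k. y k + y' k) s"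
  unfolding reveal_def using assms
  by (auto simp: distrib_left zexp_add fun_eq_iff right_diff_distrib mult.assoc)

lemma reveal_cong: "(\<And>k. k \<in> B \<Longrightarrow> y k = y' k) \<Longrightarrow> reveal B S y s = reveal B S y' s"
  unfolding reveal_def by (auto cong: zexp_cong intro!: arg_cong[where f = "\<lambda>q. (Abs_fps (fst s) * q) $ _"] zexp_cong)

lemma zexp_0: "zexp B (\<lambda>k. 0) = 1"
proof -
  have "Abs_fps (\<lambda>k. if k \<in> B then 0 else 0) = (0 :: 'a::field_char_0 fps)" by (simp add: fps_eq_iff)
  then show ?thesis by (simp add: zexp_def)
qed

lemma reveal_0: "reveal B S (\<lambda>k. 0) s = s"
  by (cases s) (simp add: reveal_def zexp_0 fun_eq_iff)

lemma measurable_reveal: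
  assumes Y: "\<And>k. k \<in> B \<Longrightarrow> (\<lambda>x. Y x k) \<in> borel_measurable M" and s: "s \<in> M \<rightarrow>\<^sub>M state_space"
  shows "(\<lambda>x. reveal B S (Y x) (s x)) \<in> M \<rightarrow>\<^sub>M state_space"
proof -
  have Q: "(\<lambda>x. gexp B (Y x) $ n) \<in> borel_measurable M" for n
    by (rule measurable_zexp_nth) (use Y in measurable)
  have c: "(\<lambda>x. fst (s x) n) \<in> borel_measurable M" "(\<lambda>x. snd (s x) n) \<in> borel_measurable M" for n
    using s by measurable
  show ?thesis
    unfolding reveal_def
  proof (intro measurable_Pair measurable_abs_UNIV)
    fix n
    show "(\<lambda>x. (Abs_fps (fst (s x)) * gexp B (Y x)) $ n) \<in> borel_measurable M"
      unfolding fps_mult_nth by (intro borel_measurable_sum borel_measurable_times Q) (simp add: c)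
    have "(\<lambda>x. (Abs_fps (fst (s x)) * (gexp B (Y x) - 1)) $ n) \<in> borel_measurable M"
      unfolding fps_mult_nth fps_sub_nth
      by (intro borel_measurable_sum borel_measurable_times borel_measurable_diff Q) (simp_all add: c)
    then show "(\<lambda>x. snd (s x) n + (if n \<in> S then (Abs_fps (fst (s x)) * (gexp B (Y x) - 1)) $ n else 0)) \<in> borel_measurable M"
      using c(2)[of n] by (cases "n \<in> S") (auto intro: borel_measurable_add)
  qed
qed

text \<open>
Truncation keeps the sum finite. It respects the growth bound, since a coefficient receives
contributions from itself and lower ones only.
\<close>

definition mass :: "nat \<Rightarrow> (nat \<Rightarrow> complex) \<Rightarrow> real" where
  "mass N a = (\<Sum>m\<le>N. (cmod (a m))\<^sup>2)"

text \<open>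
Four directions suffice to dominate an exponential of the modulus, see \<open>exp4_ge\<close> below, while each
summand is the exponential of a real linear form and so has an explicit Gaussian mean.
\<close>

definition exp4 :: "real \<Rightarrow> complex \<Rightarrow> real" where
  "exp4 \<theta> z = (\<Sum>\<zeta>\<in>{1, -1, \<i>, -\<i>}. exp (Re (of_real \<theta> * \<zeta> * z)))"

text \<open>
The superharmonic majorant of the failure probability. The accumulated increment is split as
$d = l + r$ into the linear parts $l$ of all small steps and the remainders $r$. The coefficient
$\kappa$ is the reciprocal of the largest tolerated mass.
\<close>

definition potential :: "nat \<Rightarrow> nat set \<Rightarrow> real \<Rightarrow> real \<Rightarrow> (nat \<Rightarrow> real) \<Rightarrow> real \<Rightarrow> (nat \<Rightarrow> complex) \<Rightarrow> (nat \<Rightarrow> complex) \<Rightarrow> (nat \<Rightarrow> complex) \<Rightarrow> real" where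
  "potential N R \<theta> \<kappa> w u a l r =
     \<kappa> * mass N a + (\<Sum>n\<in>R. w n * exp4 \<theta> (l n)) + u * (\<Sum>n\<in>R. (cmod (r n))\<^sup>2)"

lemma mass_nonneg [simp]: "mass N a \<ge> 0" by (simp add: mass_def sum_nonneg)

lemma exp4_nonneg [simp]: "exp4 \<theta> z \<ge> 0" by (simp add: exp4_def sum_nonneg)

lemma sum_convolution_le:
  fixes f g :: "nat \<Rightarrow> real"
  assumes "\<And>i. f i \<ge> 0" "\<And>i. g i \<ge> 0"
  shows "(\<Sum>m\<le>N. \<Sum>l\<le>m. f (m - l) * g l) \<le> (\<Sum>m\<le>N. f m) * (\<Sum>l\<le>N. g l)"
proof -
  have "(\<Sum>m\<le>N. \<Sum>l\<le>m. f (m - l) * g l) = (\<Sum>(m,l)\<in>(SIGMA m:{..N}. {..m}). f (m - l) * g l)"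
    by (simp add: sum.Sigma)
  also have "\<dots> = (\<Sum>(i,l)\<in>{(i,l). i + l \<le> N}. f i * g l)"
    by (rule sum.reindex_bij_witness[of _ "\<lambda>(i,l). (i+l,l)" "\<lambda>(m,l). (m-l,l)"]) auto
  also have "\<dots> \<le> (\<Sum>(i,l)\<in>{..N} \<times> {..N}. f i * g l)"
    using assms by (intro sum_mono2) auto
  also have "\<dots> = (\<Sum>m\<le>N. f m) * (\<Sum>l\<le>N. g l)"
    by (simp add: sum_product sum.cartesian_product)
  finally show ?thesis .
qed

text \<open>
One small step of variance $x$. The three parts of the potential are averaged separately. The mass
grows by $\exp(x h)$. The linear part at $n$ is Gaussian, and its variance
$x \sum_k |a(n-k)|^2 / k \le x/(\kappa K)$ is paid for by the factor $\exp(v x)$. The remainder part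
grows by $O(x^2)$. The bounds for the last two come from the mass being at most $1/\kappa$.
The constant $e$ carries along the errors of other steps.
\<close>

lemma potential_step:
  fixes a l r :: "nat \<Rightarrow> complex"
  assumes B: "finite B" "0 \<notin> B" "\<And>k. k \<in> B \<Longrightarrow> K \<le> real k" "K > 0"
    and R: "finite R" "R \<subseteq> {..N}"
    and pars: "\<kappa> > 0" "u \<ge> 0" "\<And>n. n \<in> R \<Longrightarrow> w n \<ge> 0" "\<theta>\<^sup>2 / (4 * \<kappa> * K) \<le> v"
    and x: "0 < x" "x \<le> 1" and e: "e \<ge> 0" and small: "\<kappa> * mass N a \<le> 1"
  defines "h \<equiv> \<Sum>k\<in>B. 1 / real k"
    and "Q \<equiv> \<lambda>y. zexp B (\<lambda>k. of_real (sqrt x / sqrt (real k)) * y k)"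
    and "lin \<equiv> \<lambda>y n. \<Sum>k\<in>B. (if k \<le> n then a (n - k) else 0) * (of_real (sqrt x / sqrt (real k)) * y k)"
  shows "(\<integral>\<^sup>+y. ennreal (potential N R \<theta> \<kappa> w u (\<lambda>n. (Abs_fps a * Q y) $ n)
           (\<lambda>n. l n + (if n \<in> S then lin y n else 0))
           (\<lambda>n. r n + (if n \<in> S then (Abs_fps a * (Q y - 1)) $ n - lin y n else 0)) + e) \<partial>gprod B)
     \<le> ennreal (potential N R \<theta> (\<kappa> * exp (x * h)) (\<lambda>n. w n * exp (v * x * of_bool (n \<in> S))) u a l r
          + x\<^sup>2 * (u * card R * exp h / \<kappa>) + e)"
proof -
  let ?s = "\<lambda>k. sqrt x / sqrt (real k)"
  have s2: "(?s k)\<^sup>2 = x * (1 / real k)" for k using x by (simp add: power_divide)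
  have Qm [measurable]: "(\<lambda>y. Q y $ n) \<in> borel_measurable (gprod B)" for n
    unfolding Q_def by (rule measurable_zexp_nth) measurable
  have Pm [measurable]: "(\<lambda>y. (Abs_fps a * Q y) $ n) \<in> borel_measurable (gprod B)" 
     "(\<lambda>y. (Abs_fps a * (Q y - 1)) $ n) \<in> borel_measurable (gprod B)" for n
    unfolding fps_mult_nth fps_sub_nth by measurable
  have lm [measurable]: "(\<lambda>y. lin y n) \<in> borel_measurable (gprod B)" for n
    unfolding lin_def by measurable
  \<comment> \<open>State after the step, with the increment split into linear part and remainder.\<close>
  define a' where "a' y = (\<lambda>n. (Abs_fps a * Q y) $ n)" for y
  define l' where "l' y n = l n + (if n \<in> S then lin y n else 0)" for y n
  define r' where "r' y n = r n + (if n \<in> S then (Abs_fps a * (Q y - 1)) $ n - lin y n else 0)" for y n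
  have [measurable]: "(\<lambda>y. a' y n) \<in> borel_measurable (gprod B)" "(\<lambda>y. l' y n) \<in> borel_measurable (gprod B)"
      "(\<lambda>y. r' y n) \<in> borel_measurable (gprod B)" for n
    unfolding a'_def l'_def r'_def by measurable
  have Z: "(\<Sum>l\<le>N. zexp B (\<lambda>k. (?s k)\<^sup>2) $ l) \<le> exp (x * h)" "(\<Sum>l\<le>N. zexp B (\<lambda>k. 1 / real k) $ l) \<le> exp h"
    using sum_zexp_le_exp[of B "\<lambda>k. (?s k)\<^sup>2" 1 N] sum_zexp_le_exp[of B "\<lambda>k. 1 / real k" 1 N] B x
    by (simp_all add: s2 h_def sum_distrib_left del: power_divide)
  have znn: "zexp B (\<lambda>k. (?s k)\<^sup>2) $ l \<ge> 0" "zexp B (\<lambda>k. 1 / real k) $ l \<ge> 0" for l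
    by (rule zexp_nonneg; simp)+

  have I1: "(\<integral>\<^sup>+y. ennreal (mass N (a' y)) \<partial>gprod B) \<le> ennreal (mass N a * exp (x * h))"
  proof -
    have "(\<integral>\<^sup>+y. ennreal (mass N (a' y)) \<partial>gprod B) = (\<Sum>m\<le>N. \<integral>\<^sup>+y. ennreal ((cmod (a' y m))\<^sup>2) \<partial>gprod B)"
      unfolding mass_def by (subst nn_integral_sum[symmetric]) (auto simp: sum_ennreal)
    also have "\<dots> = (\<Sum>m\<le>N. ennreal (\<Sum>l\<le>m. (cmod (a (m - l)))\<^sup>2 * zexp B (\<lambda>k. (?s k)\<^sup>2) $ l))"
      unfolding a'_def Q_def by (subst gaussian_exp_coeff_L2) (use B in auto)
    also have "\<dots> = ennreal (\<Sum>m\<le>N. \<Sum>l\<le>m. (cmod (a (m - l)))\<^sup>2 * zexp B (\<lambda>k. (?s k)\<^sup>2) $ l)"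
      by (rule sum_ennreal) (auto intro!: sum_nonneg mult_nonneg_nonneg znn)
    also have "\<dots> \<le> ennreal (mass N a * (\<Sum>l\<le>N. zexp B (\<lambda>k. (?s k)\<^sup>2) $ l))"
      unfolding mass_def by (intro ennreal_leI sum_convolution_le znn) auto
    also have "\<dots> \<le> ennreal (mass N a * exp (x * h))"
      by (intro ennreal_leI mult_left_mono Z) simp
    finally show ?thesis .
  qed

  have I2: "(\<integral>\<^sup>+y. ennreal (exp4 \<theta> (l' y n)) \<partial>gprod B) \<le> ennreal (exp (v * x * of_bool (n \<in> S)) * exp4 \<theta> (l n))"
    if n: "n \<in> R" for n
  proof -
    have one: "(\<integral>\<^sup>+y. ennreal (exp (Re (of_real \<theta> * \<zeta> * l' y n))) \<partial>gprod B)
        \<le> ennreal (exp (v * x * of_bool (n \<in> S)) * exp (Re (of_real \<theta> * \<zeta> * l n)))" if \<zeta>: "cmod \<zeta> = 1" for \<zeta>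
    proof (cases "n \<in> S")
      case False
      then show ?thesis by (simp add: l'_def prob_space.emeasure_space_1[OF prob_space_gprod])
    next
      case True
      define c where "c k = of_real \<theta> * \<zeta> * ((if k \<le> n then a (n - k) else 0) * of_real (?s k))" for k
      have "(\<integral>\<^sup>+y. ennreal (exp (Re (of_real \<theta> * \<zeta> * l' y n))) \<partial>gprod B)
          = (\<integral>\<^sup>+y. ennreal (exp (Re (of_real \<theta> * \<zeta> * l n))) * ennreal (exp (Re (\<Sum>k\<in>B. c k * y k))) \<partial>gprod B)"
      proof (rule nn_integral_cong)
        fix y
        have "of_real \<theta> * \<zeta> * l' y n = of_real \<theta> * \<zeta> * l n + (\<Sum>k\<in>B. c k * y k)"
          using True by (simp only: l'_def lin_def if_True distrib_left sum_distrib_left c_def mult.assoc)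
        then show "ennreal (exp (Re (of_real \<theta> * \<zeta> * l' y n))) = ennreal (exp (Re (of_real \<theta> * \<zeta> * l n))) * ennreal (exp (Re (\<Sum>k\<in>B. c k * y k)))"
          by (simp only: plus_complex.sel exp_add ennreal_mult exp_ge_zero)
      qed
      also have "\<dots> = ennreal (exp (Re (of_real \<theta> * \<zeta> * l n))) * ennreal (exp ((\<Sum>k\<in>B. (cmod (c k))\<^sup>2) / 4))"
        by (subst nn_integral_cmult, measurable, simp only: gprod_exp[OF B(1)])
      also have "\<dots> \<le> ennreal (exp (Re (of_real \<theta> * \<zeta> * l n))) * ennreal (exp (v * x))"
      proof (intro mult_left_mono ennreal_leI)
        have "(\<Sum>k\<in>B. (cmod (c k))\<^sup>2) = (\<Sum>k\<in>B \<inter> {..n}. \<theta>\<^sup>2 * x * ((cmod (a (n - k)))\<^sup>2 / real k))"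
          using B(1) \<zeta> x by (subst sum.inter_restrict)
            (auto simp: c_def norm_mult norm_divide power_mult_distrib power_divide intro!: sum.cong)
        also have "\<dots> \<le> (\<Sum>k\<in>B \<inter> {..n}. \<theta>\<^sup>2 * x * ((cmod (a (n - k)))\<^sup>2 / K))"
          using B x by (intro sum_mono mult_left_mono divide_left_mono) (auto, smt (verit) mult_pos_pos)
        also have "\<dots> = \<theta>\<^sup>2 * x / K * (\<Sum>k\<in>B \<inter> {..n}. (cmod (a (n - k)))\<^sup>2)"
          by (simp add: sum_distrib_left)
        also have "\<dots> \<le> \<theta>\<^sup>2 * x / K * (1 / \<kappa>)"
        proof (rule mult_left_mono)
          have "(\<Sum>k\<in>B \<inter> {..n}. (cmod (a (n - k)))\<^sup>2) = (\<Sum>m\<in>(\<lambda>k. n - k) ` (B \<inter> {..n}). (cmod (a m))\<^sup>2)"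
            by (subst sum.reindex) (auto simp: inj_on_def)
          also have "\<dots> \<le> mass N a"
            unfolding mass_def using n R by (intro sum_mono2) auto
          also have "\<dots> \<le> 1 / \<kappa>" using small pars(1) by (simp add: field_simps)
          finally show "(\<Sum>k\<in>B \<inter> {..n}. (cmod (a (n - k)))\<^sup>2) \<le> 1 / \<kappa>" .
        qed (use x B(4) in simp)
        also have "\<dots> = 4 * x * (\<theta>\<^sup>2 / (4 * \<kappa> * K))" by (simp add: mult_ac)
        also have "\<dots> \<le> 4 * x * v" using x pars(4) by (intro mult_left_mono) auto
        finally show "exp ((\<Sum>k\<in>B. (cmod (c k))\<^sup>2) / 4) \<le> exp (v * x)" by (simp add: mult_ac)
      qed simp
      finally show ?thesis using True by (simp add: ennreal_mult mult.commute)
    qed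
    have "(\<integral>\<^sup>+y. ennreal (exp4 \<theta> (l' y n)) \<partial>gprod B) = (\<Sum>\<zeta>\<in>{1, -1, \<i>, -\<i>}. \<integral>\<^sup>+y. ennreal (exp (Re (of_real \<theta> * \<zeta> * l' y n))) \<partial>gprod B)"
      unfolding exp4_def by (subst nn_integral_sum[symmetric], simp, simp)
    also have "\<dots> \<le> (\<Sum>\<zeta>\<in>{1, -1, \<i>, -\<i>}. ennreal (exp (v * x * of_bool (n \<in> S)) * exp (Re (of_real \<theta> * \<zeta> * l n))))"
      by (intro sum_mono one) auto
    also have "\<dots> = ennreal (exp (v * x * of_bool (n \<in> S)) * exp4 \<theta> (l n))"
      unfolding exp4_def sum_distrib_left by (rule sum_ennreal) simp
    finally show ?thesis .
  qed

  have I3: "(\<integral>\<^sup>+y. ennreal ((cmod (r' y n))\<^sup>2) \<partial>gprod B) \<le> ennreal ((cmod (r n))\<^sup>2 + x\<^sup>2 * (exp h / \<kappa>))"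
    if n: "n \<in> R" for n
  proof (cases "n \<in> S")
    case False
    then show ?thesis using pars(1)
      by (simp add: r'_def prob_space.emeasure_space_1[OF prob_space_gprod] ennreal_leI)
  next
    case True
    have "(\<integral>\<^sup>+y. ennreal ((cmod (r' y n))\<^sup>2) \<partial>gprod B) \<le>
       ennreal ((cmod (r n))\<^sup>2 + x\<^sup>2 * (\<Sum>l\<le>n. (cmod (a (n - l)))\<^sup>2 * zexp B (\<lambda>k. 1 / real k) $ l))"
      using gaussian_exp_remainder_L2[OF B(1,2), of "\<lambda>k. 1 / real k" ?s x "r n" "Abs_fps a" n] x s2 True
      unfolding r'_def Q_def lin_def by (simp add: add_diff_eq cong: if_cong)
    also have "\<dots> \<le> ennreal ((cmod (r n))\<^sup>2 + x\<^sup>2 * (exp h / \<kappa>))"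
    proof (intro ennreal_leI add_left_mono mult_left_mono)
      have "(\<Sum>l\<le>n. (cmod (a (n - l)))\<^sup>2 * zexp B (\<lambda>k. 1 / real k) $ l)
         \<le> (\<Sum>m\<le>N. \<Sum>l\<le>m. (cmod (a (m - l)))\<^sup>2 * zexp B (\<lambda>k. 1 / real k) $ l)"
        using n R by (intro member_le_sum) (auto intro!: sum_nonneg mult_nonneg_nonneg znn)
      also have "\<dots> \<le> mass N a * (\<Sum>l\<le>N. zexp B (\<lambda>k. 1 / real k) $ l)"
        unfolding mass_def by (intro sum_convolution_le znn) auto
      also have "\<dots> \<le> (1 / \<kappa>) * exp h"
        using small pars(1) Z by (intro mult_mono) (auto simp: field_simps intro!: sum_nonneg znn)
      finally show "(\<Sum>l\<le>n. (cmod (a (n - l)))\<^sup>2 * zexp B (\<lambda>k. 1 / real k) $ l) \<le> exp h / \<kappa>" by simp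
    qed simp
    finally show ?thesis .
  qed

  have mm: "(\<lambda>y. ennreal (mass N (a' y))) \<in> borel_measurable (gprod B)" unfolding mass_def by measurable
  have em: "(\<lambda>y. ennreal (exp4 \<theta> (l' y n))) \<in> borel_measurable (gprod B)" for n unfolding exp4_def by measurable
  note [measurable] = mm em
  have "(\<integral>\<^sup>+y. ennreal (potential N R \<theta> \<kappa> w u (a' y) (l' y) (r' y) + e) \<partial>gprod B) =
      (\<integral>\<^sup>+y. ennreal \<kappa> * ennreal (mass N (a' y)) + (\<Sum>n\<in>R. ennreal (w n) * ennreal (exp4 \<theta> (l' y n)))
         + ennreal u * (\<Sum>n\<in>R. ennreal ((cmod (r' y n))\<^sup>2)) + ennreal e \<partial>gprod B)"
    unfolding potential_def using pars e
    by (intro nn_integral_cong)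
       (simp add: ennreal_plus sum_nonneg ennreal_mult[symmetric] sum_ennreal)
  also have "\<dots> = ennreal \<kappa> * (\<integral>\<^sup>+y. ennreal (mass N (a' y)) \<partial>gprod B)
      + (\<Sum>n\<in>R. ennreal (w n) * (\<integral>\<^sup>+y. ennreal (exp4 \<theta> (l' y n)) \<partial>gprod B))
      + ennreal u * (\<Sum>n\<in>R. \<integral>\<^sup>+y. ennreal ((cmod (r' y n))\<^sup>2) \<partial>gprod B) + ennreal e"
    by (simp add: nn_integral_add nn_integral_sum nn_integral_cmult mm em del: sum_ennreal add: prob_space.emeasure_space_1[OF prob_space_gprod])
  also have "\<dots> \<le> ennreal \<kappa> * ennreal (mass N a * exp (x * h))
      + (\<Sum>n\<in>R. ennreal (w n) * ennreal (exp (v * x * of_bool (n \<in> S)) * exp4 \<theta> (l n)))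
      + ennreal u * (\<Sum>n\<in>R. ennreal ((cmod (r n))\<^sup>2 + x\<^sup>2 * (exp h / \<kappa>))) + ennreal e"
    by (intro add_mono mult_left_mono sum_mono I1 I2 I3) auto
  also have "\<dots> = ennreal (\<kappa> * (mass N a * exp (x * h))
      + (\<Sum>n\<in>R. w n * (exp (v * x * of_bool (n \<in> S)) * exp4 \<theta> (l n)))
      + u * (\<Sum>n\<in>R. (cmod (r n))\<^sup>2 + x\<^sup>2 * (exp h / \<kappa>)) + e)"
    using pars e by (simp add: sum_nonneg ennreal_mult[symmetric] sum_ennreal flip: ennreal_plus)
  also have "\<dots> = ennreal (potential N R \<theta> (\<kappa> * exp (x * h)) (\<lambda>n. w n * exp (v * x * of_bool (n \<in> S))) u a l r
          + x\<^sup>2 * (u * card R * exp h / \<kappa>) + e)"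
    by (simp add: potential_def sum.distrib algebra_simps)
  finally show ?thesis unfolding a'_def l'_def r'_def .
qed

section \<open>Heat flow within one block\<close>

lemma potential_nonneg:
  assumes "\<kappa> \<ge> 0" "u \<ge> 0" "\<And>n. n \<in> R \<Longrightarrow> w n \<ge> 0"
  shows "potential N R \<theta> \<kappa> w u a l r \<ge> 0" "\<kappa> * mass N a \<le> potential N R \<theta> \<kappa> w u a l r"
  using assms by (auto simp: potential_def intro!: add_nonneg_nonneg sum_nonneg mult_nonneg_nonneg)

text \<open>
Passing from small steps to a whole block. For $\sigma \in [0,1]$ let $V_\sigma$ be the average of
$V$ after multiplying by the block exponential with variance $\sigma$; by \<open>gprod_convolution\<close> these
averages form a semigroup, so $V_1$ is reached in $T$ steps of variance $1/T$. The accumulated error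
$T \cdot O(T^{-2})$ disappears in the limit. The hypothesis on $V$ quantifies over all splittings
$l + r$ of the increment, because the splitting is produced by the small steps and is not visible in
the state.
\<close>

lemma block_step:
  fixes V :: "state \<Rightarrow> ennreal"
  assumes V: "V \<in> borel_measurable state_space" "\<And>s. V s \<le> 1"
    and B: "finite B" "0 \<notin> B" "\<And>k. k \<in> B \<Longrightarrow> K \<le> real k" "K > 0"
    and R: "finite R" "R \<subseteq> {..N}"
    and pars: "\<kappa> > 0" "u \<ge> 0" "\<And>n. n \<in> R \<Longrightarrow> w n \<ge> 0" "\<theta>\<^sup>2 / (4 * \<kappa> * K) \<le> v"
    and bound: "\<And>a l r. V (a, \<lambda>n. l n + r n) \<le> ennreal (potential N R \<theta> \<kappa> w u a l r)"
  shows "(\<integral>\<^sup>+y. V (reveal B S y (a, \<lambda>n. l n + r n)) \<partial>gprod B)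
     \<le> ennreal (potential N R \<theta> (\<kappa> * exp (\<Sum>k\<in>B. 1 / real k)) (\<lambda>n. w n * exp (v * of_bool (n \<in> S))) u a l r)"
proof -
  define h where "h = (\<Sum>k\<in>B. 1 / real k)"
  define C where "C = u * card R * exp h / \<kappa>"
  have h0: "h \<ge> 0" by (simp add: h_def sum_nonneg)
  have C0: "C \<ge> 0" using pars by (simp add: C_def)
  define Vs where "Vs \<sigma> s = (\<integral>\<^sup>+y. V (reveal B S (\<lambda>k. of_real (sqrt \<sigma>) * y k) s) \<partial>gprod B)" for \<sigma> s
  have Vs1: "Vs \<sigma> s \<le> 1" for \<sigma> s
  proof -
    have "Vs \<sigma> s \<le> (\<integral>\<^sup>+y. 1 \<partial>gprod B)" unfolding Vs_def by (intro nn_integral_mono V)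
    then show ?thesis by (simp add: prob_space.emeasure_space_1[OF prob_space_gprod])
  qed
  have Vs0: "Vs 0 s = V s" for s
    by (simp add: Vs_def reveal_0 prob_space.emeasure_space_1[OF prob_space_gprod])
  have semi: "Vs (\<sigma> + x) s = (\<integral>\<^sup>+y. Vs \<sigma> (reveal B S (\<lambda>k. of_real (sqrt x) * y k) s) \<partial>gprod B)"
    if "x > 0" "\<sigma> \<ge> 0" for \<sigma> x s
  proof -
    define f where "f w = V (reveal B S w s)" for w
    have fm: "f \<in> borel_measurable (PiM B (\<lambda>_. borel))"
      unfolding f_def
      by (rule measurable_compose[OF measurable_reveal V(1)]) (auto simp: space_pair_measure space_PiM)
    have fr: "f (\<lambda>k\<in>B. g k) = f g" for g unfolding f_def by (simp cong: reveal_cong)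
    have "(\<integral>\<^sup>+y. Vs \<sigma> (reveal B S (\<lambda>k. of_real (sqrt x) * y k) s) \<partial>gprod B) =
       (\<integral>\<^sup>+y. \<integral>\<^sup>+y'. f (\<lambda>k\<in>B. of_real (sqrt x) * y k + of_real (sqrt \<sigma>) * y' k) \<partial>gprod B \<partial>gprod B)"
      unfolding Vs_def reveal_add[OF B(2)] fr unfolding f_def ..
    also have "\<dots> = (\<integral>\<^sup>+y. f (\<lambda>k\<in>B. of_real (sqrt ((sqrt x)\<^sup>2 + (sqrt \<sigma>)\<^sup>2)) * y k) \<partial>gprod B)"
      by (rule gprod_convolution[OF B(1) fm]) (use that in auto)
    also have "\<dots> = Vs (\<sigma> + x) s"
      using that unfolding fr by (simp add: Vs_def f_def add.commute)
    finally show ?thesis by simp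
  qed
  have key: "Vs (\<tau> * x) (a, \<lambda>n. l n + r n) \<le>
      ennreal (potential N R \<theta> (\<kappa> * exp (\<tau> * x * h)) (\<lambda>n. w n * exp (v * (\<tau> * x) * of_bool (n \<in> S))) u a l r + \<tau> * (x\<^sup>2 * C))"
    if x: "0 < x" "x \<le> 1" for x :: real and a l r and \<tau> :: nat
  proof (induction \<tau> arbitrary: a l r)
    case 0
    then show ?case using bound by (simp add: Vs0)
  next
    case (Suc \<tau>)
    \<comment> \<open>The weights of the potential with variance $\tau x$ still to come.\<close>
    define \<kappa>' where "\<kappa>' = \<kappa> * exp (\<tau> * x * h)"
    define w' where "w' n = w n * exp (v * (\<tau> * x) * of_bool (n \<in> S))" for n
    have \<kappa>': "\<kappa> \<le> \<kappa>'" "\<kappa>' > 0" using pars(1) x h0 by (auto simp: \<kappa>'_def)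
    have ex: "\<kappa> * exp (Suc \<tau> * x * h) = \<kappa>' * exp (x * h)"
      by (simp add: \<kappa>'_def exp_add[symmetric] algebra_simps)
    have ew: "w n * exp (v * (Suc \<tau> * x) * of_bool (n \<in> S)) = w' n * exp (v * x * of_bool (n \<in> S))" for n
      by (simp add: w'_def exp_add[symmetric] algebra_simps)
    show ?case
    proof (cases "\<kappa>' * mass N a \<le> 1")
      \<comment> \<open>If the mass is too large, the mass term of the potential exceeds the trivial bound $1$; this replaces stopping.\<close>
      case False
      have "\<kappa>' * mass N a \<le> \<kappa>' * exp (x * h) * mass N a"
        using \<kappa>' x h0 by (intro mult_right_mono) auto
      also have "\<dots> \<le> potential N R \<theta> (\<kappa>' * exp (x * h)) (\<lambda>n. w' n * exp (v * x * of_bool (n \<in> S))) u a l r"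
        using pars \<kappa>' by (intro potential_nonneg) (auto simp: w'_def)
      finally have "1 \<le> potential N R \<theta> (\<kappa>' * exp (x * h)) (\<lambda>n. w' n * exp (v * x * of_bool (n \<in> S))) u a l r + Suc \<tau> * (x\<^sup>2 * C)"
        using False C0 by (auto intro!: add_increasing2)
      from ennreal_leI[OF this] show ?thesis unfolding ex ew
        by (rule order_trans[rotated]) (simp add: Vs1)
    next
      case True
      let ?Q = "\<lambda>y. zexp B (\<lambda>k. of_real (sqrt x / sqrt (real k)) * y k)"
      let ?lin = "\<lambda>y n. \<Sum>k\<in>B. (if k \<le> n then a (n - k) else 0) * (of_real (sqrt x / sqrt (real k)) * y k)"
      let ?a = "\<lambda>y n. (Abs_fps a * ?Q y) $ n"
      let ?l = "\<lambda>y n. l n + (if n \<in> S then ?lin y n else 0)"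
      let ?r = "\<lambda>y n. r n + (if n \<in> S then (Abs_fps a * (?Q y - 1)) $ n - ?lin y n else 0)"
      have u: "reveal B S (\<lambda>k. of_real (sqrt x) * y k) (a, \<lambda>n. l n + r n) = (?a y, \<lambda>n. ?l y n + ?r y n)" for y
      proof -
        have "gexp B (\<lambda>k. of_real (sqrt x) * y k) = ?Q y" by (simp add: mult.commute)
        then show ?thesis by (auto simp: reveal_def fun_eq_iff)
      qed
      have "Vs (Suc \<tau> * x) (a, \<lambda>n. l n + r n) = Vs (\<tau> * x + x) (a, \<lambda>n. l n + r n)"
        by (simp add: algebra_simps)
      also have "\<dots> = (\<integral>\<^sup>+y. Vs (\<tau> * x) (?a y, \<lambda>n. ?l y n + ?r y n) \<partial>gprod B)"
        using x by (subst semi) (simp_all add: u)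
      also have "\<dots> \<le> (\<integral>\<^sup>+y. ennreal (potential N R \<theta> \<kappa>' w' u (?a y) (?l y) (?r y) + \<tau> * (x\<^sup>2 * C)) \<partial>gprod B)"
        unfolding \<kappa>'_def w'_def by (intro nn_integral_mono Suc)
      also have "\<dots> \<le> ennreal (potential N R \<theta> (\<kappa>' * exp (x * h)) (\<lambda>n. w' n * exp (v * x * of_bool (n \<in> S))) u a l r
          + x\<^sup>2 * (u * card R * exp h / \<kappa>') + \<tau> * (x\<^sup>2 * C))"
        unfolding h_def
      proof (rule potential_step[OF B R \<kappa>'(2) pars(2) _ _ x _ True])
        show "\<theta>\<^sup>2 / (4 * \<kappa>' * K) \<le> v"
        proof (rule order_trans[OF _ pars(4)])
          show "\<theta>\<^sup>2 / (4 * \<kappa>' * K) \<le> \<theta>\<^sup>2 / (4 * \<kappa> * K)"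
            using \<kappa>' pars(1) B(4) by (intro divide_left_mono) auto
        qed
      qed (use pars(3) C0 in \<open>auto simp: w'_def\<close>)
      also have "\<dots> \<le> ennreal (potential N R \<theta> (\<kappa>' * exp (x * h)) (\<lambda>n. w' n * exp (v * x * of_bool (n \<in> S))) u a l r + Suc \<tau> * (x\<^sup>2 * C))"
      proof (rule ennreal_leI)
        have "u * card R * exp h / \<kappa>' \<le> C"
          unfolding C_def using \<kappa>' pars by (intro divide_left_mono) auto
        then have "x\<^sup>2 * (u * card R * exp h / \<kappa>') \<le> x\<^sup>2 * C" by (intro mult_left_mono) auto
        then show "potential N R \<theta> (\<kappa>' * exp (x * h)) (\<lambda>n. w' n * exp (v * x * of_bool (n \<in> S))) u a l r
          + x\<^sup>2 * (u * card R * exp h / \<kappa>') + \<tau> * (x\<^sup>2 * C) \<le>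
          potential N R \<theta> (\<kappa>' * exp (x * h)) (\<lambda>n. w' n * exp (v * x * of_bool (n \<in> S))) u a l r + Suc \<tau> * (x\<^sup>2 * C)"
          by (simp add: algebra_simps)
      qed
      finally show ?thesis unfolding ex ew .
    qed
  qed
  let ?P = "potential N R \<theta> (\<kappa> * exp h) (\<lambda>n. w n * exp (v * of_bool (n \<in> S))) u a l r"
  have P0: "?P \<ge> 0" using pars by (intro potential_nonneg) auto
  have "Vs 1 (a, \<lambda>n. l n + r n) \<le> ennreal ?P"
  proof (rule ennreal_le_epsilon)
    fix e :: real assume e: "e > 0"
    obtain T :: nat where T: "C / e < real T" "T > 0"
    proof -
      obtain n :: nat where "C / e < real n" using reals_Archimedean2 by blast
      then have "C / e < real (Suc n)" by simp
      then show ?thesis using that[of "Suc n"] by blast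
    qed
    have "Vs (real T * (1 / T)) (a, \<lambda>n. l n + r n) \<le> ennreal (potential N R \<theta> (\<kappa> * exp (real T * (1 / T) * h)) (\<lambda>n. w n * exp (v * (real T * (1 / T)) * of_bool (n \<in> S))) u a l r + T * ((1 / T)\<^sup>2 * C))"
      using T by (intro key) auto
    also have "real T * (1 / T) = 1" using T by simp
    also have "T * ((1 / T)\<^sup>2 * C) = C / T" using T by (simp add: power2_eq_square)
    finally have "Vs 1 (a, \<lambda>n. l n + r n) \<le> ennreal (?P + C / T)" by simp
    also have "\<dots> \<le> ennreal (?P + e)" using T e by (intro ennreal_leI) (simp add: field_simps)
    finally show "Vs 1 (a, \<lambda>n. l n + r n) \<le> ennreal ?P + ennreal e" using P0 e by simp
  qed
  then show ?thesis by (simp add: Vs_def h_def)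
qed



section \<open>Iteration over dyadic blocks\<close>

abbreviation block :: "nat \<Rightarrow> nat set" where
  "block i \<equiv> {2 ^ i..<2 ^ Suc i}"

text \<open>
The mean of the terminal payoff \<open>\<phi>\<close> when \<open>m\<close> blocks, from block \<open>i\<close> on, remain to be revealed.
\<close>

primrec bellman :: "(state \<Rightarrow> ennreal) \<Rightarrow> (nat \<Rightarrow> nat set) \<Rightarrow> nat \<Rightarrow> nat \<Rightarrow> state \<Rightarrow> ennreal" where
  "bellman \<phi> S 0 i s = \<phi> s"
| "bellman \<phi> S (Suc m) i s = (\<integral>\<^sup>+y. bellman \<phi> S m (Suc i) (reveal (block i) (S i) y s) \<partial>gprod (block i))"

text \<open>
The same dynamics along a fixed sample $x$ of all variables.
\<close>

primrec evolve :: "(nat \<Rightarrow> nat set) \<Rightarrow> nat \<Rightarrow> nat \<Rightarrow> (nat \<Rightarrow> complex) \<Rightarrow> state \<Rightarrow> state" where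
  "evolve S 0 i x s = s"
| "evolve S (Suc m) i x s = evolve S m (Suc i) x (reveal (block i) (S i) x s)"

lemma measurable_bellman:
  assumes "\<phi> \<in> borel_measurable state_space"
  shows "bellman \<phi> S m i \<in> borel_measurable state_space"
proof (induction m arbitrary: i)
  case 0 then show ?case using assms by simp
next
  case (Suc m)
  interpret prob_space "gprod (block i)" by (rule prob_space_gprod)
  have "(\<lambda>p. reveal (block i) (S i) (snd p) (fst p)) \<in> state_space \<Otimes>\<^sub>M gprod (block i) \<rightarrow>\<^sub>M state_space"
    by (rule measurable_reveal) measurable
  from measurable_compose[OF this Suc]
  have "(\<lambda>(s, y). bellman \<phi> S m (Suc i) (reveal (block i) (S i) y s)) \<in> borel_measurable (state_space \<Otimes>\<^sub>M gprod (block i))"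
    by (simp add: case_prod_unfold)
  from borel_measurable_nn_integral[OF this]
  have "(\<lambda>s. \<integral>\<^sup>+y. bellman \<phi> S m (Suc i) (reveal (block i) (S i) y s) \<partial>gprod (block i)) \<in> borel_measurable state_space" .
  moreover have "bellman \<phi> S (Suc m) i = (\<lambda>s. \<integral>\<^sup>+y. bellman \<phi> S m (Suc i) (reveal (block i) (S i) y s) \<partial>gprod (block i))"
    by (rule ext) (rule bellman.simps)
  ultimately show ?case by simp
qed

lemma bellman_le_1:
  assumes "\<And>s. \<phi> s \<le> 1"
  shows "bellman \<phi> S m i s \<le> 1"
proof (induction m arbitrary: i s)
  case (Suc m)
  have "bellman \<phi> S (Suc m) i s \<le> (\<integral>\<^sup>+y. 1 \<partial>gprod (block i))" unfolding bellman.simps by (intro nn_integral_mono Suc)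
  then show ?case by (simp add: prob_space.emeasure_space_1[OF prob_space_gprod])
qed (use assms in simp)

lemma measurable_evolve:
  assumes "\<And>k. 2 ^ i \<le> k \<Longrightarrow> k < 2 ^ (i + m) \<Longrightarrow> (\<lambda>x. Y x k) \<in> borel_measurable M" "s \<in> M \<rightarrow>\<^sub>M state_space"
  shows "(\<lambda>x. evolve S m i (Y x) (s x)) \<in> M \<rightarrow>\<^sub>M state_space"
  using assms
proof (induction m arbitrary: i s)
  case (Suc m)
  have le: "k < 2 * 2 ^ (i + m)" if "k < 2 * 2 ^ i" for k :: nat
    by (rule less_le_trans[OF that]) simp
  show ?case unfolding evolve.simps
  proof (rule Suc.IH)
    show "(\<lambda>x. reveal (block i) (S i) (Y x) (s x)) \<in> M \<rightarrow>\<^sub>M state_space"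
      by (rule measurable_reveal) (auto intro!: Suc.prems le)
  qed (use Suc.prems in auto)
qed simp

lemma evolve_cong:
  assumes "\<And>k. 2 ^ i \<le> k \<Longrightarrow> k < 2 ^ (i + m) \<Longrightarrow> x k = y k"
  shows "evolve S m i x s = evolve S m i y s"
  using assms
proof (induction m arbitrary: i s)
  case (Suc m)
  have le: "k < 2 * 2 ^ (i + m)" if "k < 2 * 2 ^ i" for k :: nat
    by (rule less_le_trans[OF that]) simp
  have "reveal (block i) (S i) x s = reveal (block i) (S i) y s"
    by (intro reveal_cong) (auto intro!: Suc.prems le)
  then show ?case using Suc.IH[of "Suc i"] Suc.prems by simp
qed simp

lemma bellman_eq_evolve:
  assumes \<phi>: "\<phi> \<in> borel_measurable state_space"
  shows "bellman \<phi> S m i s = (\<integral>\<^sup>+x. \<phi> (evolve S m i x s) \<partial>gprod {2 ^ i..<2 ^ (i + m)})"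
proof (induction m arbitrary: i s)
  case 0
  then show ?case by (simp add: prob_space.emeasure_space_1[OF prob_space_gprod])
next
  case (Suc m)
  let ?J = "{2 ^ Suc i..<2 ^ (Suc i + m)} :: nat set"
  have le: "k < 2 * 2 ^ (i + m)" if "k < 2 * 2 ^ i" for k :: nat
    by (rule less_le_trans[OF that]) simp
  have un: "{2 ^ i..<2 ^ (i + Suc m)} = block i \<union> ?J" by (auto intro: le)
  have disj: "block i \<inter> ?J = {}" by auto
  have m: "(\<lambda>x. \<phi> (evolve S (Suc m) i x s)) \<in> borel_measurable (gprod {2 ^ i..<2 ^ (i + Suc m)})"
    by (rule measurable_compose[OF measurable_evolve \<phi>]) (auto simp: space_pair_measure space_PiM)
  have "bellman \<phi> S (Suc m) i s =
      (\<integral>\<^sup>+y. \<integral>\<^sup>+x. \<phi> (evolve S m (Suc i) x (reveal (block i) (S i) y s)) \<partial>gprod ?J \<partial>gprod (block i))"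
    by (simp add: Suc)
  also have "\<dots> = (\<integral>\<^sup>+y. \<integral>\<^sup>+x. \<phi> (evolve S (Suc m) i (merge (block i) ?J (y, x)) s) \<partial>gprod ?J \<partial>gprod (block i))"
  proof (intro nn_integral_cong)
    fix y x
    have "reveal (block i) (S i) (merge (block i) ?J (y, x)) s = reveal (block i) (S i) y s"
      by (rule reveal_cong) auto
    moreover have "evolve S m (Suc i) (merge (block i) ?J (y, x)) s' = evolve S m (Suc i) x s'" for s'
      using disj by (intro evolve_cong) (auto simp: merge_def)
    ultimately show "\<phi> (evolve S m (Suc i) x (reveal (block i) (S i) y s)) = \<phi> (evolve S (Suc m) i (merge (block i) ?J (y, x)) s)"
      by simp
  qed
  also have "\<dots> = (\<integral>\<^sup>+x. \<phi> (evolve S (Suc m) i x s) \<partial>gprod (block i \<union> ?J))"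
    using m unfolding un by (subst gp.product_nn_integral_fold[OF disj]) auto
  finally show ?case unfolding un .
qed

lemma evolve_value:
  "evolve S m i x (a, d) =
     ((\<lambda>n. (Abs_fps a * gexp {2 ^ i..<2 ^ (i + m)} x) $ n),
      (\<lambda>n. d n + (\<Sum>j\<in>{i..<i + m}. if n \<in> S j
          then (Abs_fps a * gexp {2 ^ i..<2 ^ Suc j} x) $ n - (Abs_fps a * gexp {2 ^ i..<2 ^ j} x) $ n else 0)))"
proof (induction m arbitrary: i a d)
  case (Suc m)
  have split: "gexp {2 ^ i..<2 ^ Suc i} x * gexp {2 ^ Suc i..<2 ^ j} x = gexp {2 ^ i..<2 ^ j} x" if "j \<ge> Suc i" for j
  proof -
    have "(2::nat) ^ Suc i \<le> 2 ^ j" using that by (rule power_increasing) auto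
    then have "{2 ^ i..<2 ^ j} = {2 ^ i..<2 ^ Suc i} \<union> {2 ^ Suc i..<2 ^ j :: nat}" by auto
    then show ?thesis by (simp only:) (rule zexp_Un[symmetric], auto)
  qed
  have ar: "{i..<i + Suc m} = insert i {Suc i..<Suc i + m}" by auto
  have st: "evolve S (Suc m) i x (a, d) = evolve S m (Suc i) x
     (\<lambda>n. (Abs_fps a * gexp (block i) x) $ n, \<lambda>n. d n + (if n \<in> S i then (Abs_fps a * (gexp (block i) x - 1)) $ n else 0))"
    unfolding evolve.simps reveal_def fst_conv snd_conv ..
  show ?case unfolding st Suc.IH
  proof (intro arg_cong2[where f = Pair] ext)
    fix n
    show "(Abs_fps (\<lambda>n. (Abs_fps a * gexp (block i) x) $ n) * gexp {2 ^ Suc i..<2 ^ (Suc i + m)} x) $ n =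
        (Abs_fps a * gexp {2 ^ i..<2 ^ (i + Suc m)} x) $ n"
      using split[of "Suc i + m"] by (simp add: mult.assoc)
    have "(\<Sum>j\<in>{Suc i..<Suc i + m}. if n \<in> S j
          then (Abs_fps (\<lambda>n. (Abs_fps a * gexp (block i) x) $ n) * gexp {2 ^ Suc i..<2 ^ Suc j} x) $ n
             - (Abs_fps (\<lambda>n. (Abs_fps a * gexp (block i) x) $ n) * gexp {2 ^ Suc i..<2 ^ j} x) $ n else 0) =
        (\<Sum>j\<in>{Suc i..<Suc i + m}. if n \<in> S j
          then (Abs_fps a * gexp {2 ^ i..<2 ^ Suc j} x) $ n - (Abs_fps a * gexp {2 ^ i..<2 ^ j} x) $ n else 0)"
    proof (intro sum.cong refl if_cong)
      fix j assume j: "j \<in> {Suc i..<Suc i + m}"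
      show "(Abs_fps (\<lambda>n. (Abs_fps a * gexp (block i) x) $ n) * gexp {2 ^ Suc i..<2 ^ Suc j} x) $ n
             - (Abs_fps (\<lambda>n. (Abs_fps a * gexp (block i) x) $ n) * gexp {2 ^ Suc i..<2 ^ j} x) $ n =
          (Abs_fps a * gexp {2 ^ i..<2 ^ Suc j} x) $ n - (Abs_fps a * gexp {2 ^ i..<2 ^ j} x) $ n"
        using split[of j] split[of "Suc j"] j by (simp only: Abs_fps_nth_eta mult.assoc) simp
    qed
    then show "d n + (if n \<in> S i then (Abs_fps a * (gexp (block i) x - 1)) $ n else 0) +
        (\<Sum>j\<in>{Suc i..<Suc i + m}. if n \<in> S j
          then (Abs_fps (\<lambda>n. (Abs_fps a * gexp (block i) x) $ n) * gexp {2 ^ Suc i..<2 ^ Suc j} x) $ n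
             - (Abs_fps (\<lambda>n. (Abs_fps a * gexp (block i) x) $ n) * gexp {2 ^ Suc i..<2 ^ j} x) $ n else 0) =
       d n + (\<Sum>j\<in>{i..<i + Suc m}. if n \<in> S j
          then (Abs_fps a * gexp {2 ^ i..<2 ^ Suc j} x) $ n - (Abs_fps a * gexp {2 ^ i..<2 ^ j} x) $ n else 0)"
      unfolding ar by (simp add: right_diff_distrib)
  qed
qed (auto simp: fun_eq_iff)

text \<open>
Each block costs a factor $\exp(\sum 1/k)$ in front of the mass, and a factor $\exp v$ for
those $n$ that are active in it. The condition on $v$ at block $j$ involves the tolerance
$1/\kappa_{j+1}$, which grows like $2^j$ and so compensates the lower end $2^j$ of the block.
\<close>

lemma bellman_bound:
  assumes \<phi>: "\<phi> \<in> borel_measurable state_space" "\<And>s. \<phi> s \<le> 1"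
    and R: "finite R" "R \<subseteq> {..N}"
    and \<kappa>: "\<And>j. \<kappa> j > 0" "\<And>j. j < J \<Longrightarrow> \<kappa> j = \<kappa> (Suc j) * exp (\<Sum>k\<in>block j. 1 / real k)"
      "\<And>j. j < J \<Longrightarrow> \<theta>\<^sup>2 / (4 * \<kappa> (Suc j) * 2 ^ j) \<le> v"
    and pars: "u \<ge> 0" "w \<ge> 0"
    and bound: "\<And>a l r. \<phi> (a, \<lambda>n. l n + r n) \<le> ennreal (potential N R \<theta> (\<kappa> J) (\<lambda>_. w) u a l r)"
    and "i + m = J"
  shows "bellman \<phi> S m i (a, \<lambda>n. l n + r n)
    \<le> ennreal (potential N R \<theta> (\<kappa> i) (\<lambda>n. w * exp (v * card {j\<in>{i..<J}. n \<in> S j})) u a l r)"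
  using \<open>i + m = J\<close>
proof (induction m arbitrary: i a l r)
  case 0
  then show ?case using bound by simp
next
  case (Suc m)
  then have i: "i < J" "Suc i + m = J" by auto
  have cd: "real (card {j\<in>{i..<J}. n \<in> S j}) = real (card {j\<in>{Suc i..<J}. n \<in> S j}) + of_bool (n \<in> S i)" for n
  proof (cases "n \<in> S i")
    case True
    then have "{j\<in>{i..<J}. n \<in> S j} = insert i {j\<in>{Suc i..<J}. n \<in> S j}" using i by auto
    then show ?thesis using True by simp
  next
    case False
    then have "{j\<in>{i..<J}. n \<in> S j} = {j\<in>{Suc i..<J}. n \<in> S j}" by (auto simp: Suc_le_eq) (metis le_neq_implies_less)
    then show ?thesis using False by simp
  qed
  have "bellman \<phi> S (Suc m) i (a, \<lambda>n. l n + r n)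
    \<le> ennreal (potential N R \<theta> (\<kappa> (Suc i) * exp (\<Sum>k\<in>block i. 1 / real k))
       (\<lambda>n. w * exp (v * card {j\<in>{Suc i..<J}. n \<in> S j}) * exp (v * of_bool (n \<in> S i))) u a l r)"
    unfolding bellman.simps
  proof (rule block_step[where K = "2 ^ i"])
    show "bellman \<phi> S m (Suc i) \<in> borel_measurable state_space" by (rule measurable_bellman[OF \<phi>(1)])
    show "bellman \<phi> S m (Suc i) s \<le> 1" for s by (rule bellman_le_1[OF \<phi>(2)])
    show "bellman \<phi> S m (Suc i) (a, \<lambda>n. l n + r n)
       \<le> ennreal (potential N R \<theta> (\<kappa> (Suc i)) (\<lambda>n. w * exp (v * card {j\<in>{Suc i..<J}. n \<in> S j})) u a l r)" for a l r
      using i by (intro Suc.IH)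
    show "\<theta>\<^sup>2 / (4 * \<kappa> (Suc i) * 2 ^ i) \<le> v" using \<kappa>(3) i by simp
  qed (use R \<kappa> pars in \<open>auto simp flip: of_nat_power simp del: power_Suc of_nat_power\<close>)
  also have "(\<lambda>n. w * exp (v * card {j\<in>{Suc i..<J}. n \<in> S j}) * exp (v * of_bool (n \<in> S i))) = (\<lambda>n. w * exp (v * card {j\<in>{i..<J}. n \<in> S j}))"
    by (simp only: cd distrib_left exp_add mult.assoc)
  finally show ?case using \<kappa>(2)[OF i(1)] by simp
qed

section \<open>Tail bound over a range of scales\<close>

lemma harmonic_sum_le:
  assumes "n > 0"
  shows "(\<Sum>k\<in>{1..<n}. 1 / real k) \<le> 1 + ln (real n)"
proof -
  obtain m where n: "n = Suc m" using assms by (cases n) auto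
  have "(\<Sum>k\<in>{1..<n}. 1 / real k) \<le> (\<Sum>k\<in>{1..n}. 1 / real k)"
    by (rule sum_mono2) auto
  also have "\<dots> \<le> 1 + ln (real n)"
    using decseqD[OF decseq_harm_diff_ln, of 0 m] by (simp add: n harm_def inverse_eq_divide)
  finally show ?thesis .
qed

lemma exp_harmonic_sum_le:
  assumes "n > 0"
  shows "exp (\<Sum>k\<in>{1..<n}. 1 / real k) \<le> exp 1 * real n"
proof -
  have "exp (\<Sum>k\<in>{1..<n}. 1 / real k) \<le> exp (1 + ln (real n))"
    using harmonic_sum_le[OF assms] by simp
  then show ?thesis using assms by (simp add: exp_add)
qed

text \<open>
Rankin's trick with the radius $r = \exp(1/K)$: the indices below $K$ hardly feel this radius,
while $r^{-n}$ is tiny when $n$ is much larger than $K$. The left side is the second moment of the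
$n$-th coefficient when only $X(k)$ with $k < K$ are revealed.
\<close>

lemma smooth_coefficient_le:
  assumes "K > 0"
  shows "zexp {1..<K} (\<lambda>k. 1 / real k) $ n \<le> exp 3 * real K * exp (- (real n / real K))"
proof -
  define r where "r = exp (1 / real K)"
  have "r ^ n * zexp {1..<K} (\<lambda>k. 1 / real k) $ n \<le> (\<Sum>l\<le>n. r ^ l * zexp {1..<K} (\<lambda>k. 1 / real k) $ l)"
    by (rule member_le_sum) (auto intro!: mult_nonneg_nonneg zexp_nonneg simp: r_def)
  also have "\<dots> \<le> exp (\<Sum>k\<in>{1..<K}. 1 / real k * r ^ k)"
    by (rule sum_zexp_le_exp) (auto simp: r_def)
  also have "(\<Sum>k\<in>{1..<K}. 1 / real k * r ^ k) \<le> (\<Sum>k\<in>{1..<K}. 1 / real k + 2 / real K)"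
  proof (rule sum_mono)
    fix k assume k: "k \<in> {1..<K}"
    let ?x = "real k / real K"
    have x: "0 \<le> ?x" "?x \<le> 1" using k by auto
    have "r ^ k = exp ?x" by (simp add: r_def exp_of_nat_mult[symmetric])
    also have "\<dots> \<le> 1 + ?x + ?x\<^sup>2" using x by (rule exp_bound)
    also have "?x\<^sup>2 \<le> ?x" using mult_left_mono[OF x(2) x(1)] by (simp only: power2_eq_square mult_1_right)
    finally have "r ^ k \<le> 1 + 2 * ?x" by simp
    then have "1 / real k * r ^ k \<le> 1 / real k * (1 + 2 * ?x)" by (intro mult_left_mono) auto
    also have "\<dots> = 1 / real k + 2 / real K" using k by (simp add: field_simps)
    finally show "1 / real k * r ^ k \<le> 1 / real k + 2 / real K" .
  qed
  also have "\<dots> = (\<Sum>k\<in>{1..<K}. 1 / real k) + real (K - 1) * (2 / real K)"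
    by (simp add: sum.distrib)
  also have "\<dots> \<le> (1 + ln (real K)) + 2"
  proof (rule add_mono[OF harmonic_sum_le[OF assms]])
    have "real (K - 1) * (2 / real K) \<le> real K * (2 / real K)" by (intro mult_right_mono) auto
    then show "real (K - 1) * (2 / real K) \<le> 2" using assms by simp
  qed
  also have "exp (1 + ln (real K) + 2) = exp 3 * real K"
    using assms by (simp add: exp_add[symmetric] add.commute add.left_commute) (simp add: exp_add)
  finally have "r ^ n * zexp {1..<K} (\<lambda>k. 1 / real k) $ n \<le> exp 3 * real K" by simp
  moreover have "r ^ n = exp (real n / real K)" by (simp add: r_def exp_of_nat_mult[symmetric])
  ultimately show ?thesis by (simp add: exp_minus field_simps)
qed

text \<open>
The larger of the real and imaginary parts of $z$ is at least $|z|/2$ in absolute value.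
\<close>

lemma exp4_ge:
  assumes "\<theta> > 0"
  shows "exp (\<theta> * cmod z / 2) \<le> exp4 \<theta> z"
proof -
  have "cmod z \<le> \<bar>Re z\<bar> + \<bar>Im z\<bar>" by (rule cmod_le)
  then have "cmod z / 2 \<le> \<bar>Re z\<bar> \<or> cmod z / 2 \<le> \<bar>Im z\<bar>" by linarith
  then have "\<exists>\<zeta>\<in>{1, -1, \<i>, -\<i>}. cmod z / 2 \<le> Re (\<zeta> * z)" by auto
  then obtain \<zeta> where \<zeta>: "\<zeta> \<in> {1, -1, \<i>, -\<i>}" "cmod z / 2 \<le> Re (\<zeta> * z)" by blast
  have "\<theta> * (cmod z / 2) \<le> \<theta> * Re (\<zeta> * z)" using \<zeta>(2) assms by (intro mult_left_mono) auto
  also have "\<dots> = Re (of_real \<theta> * \<zeta> * z)" by (simp add: algebra_simps)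
  finally have "exp (\<theta> * cmod z / 2) \<le> exp (Re (of_real \<theta> * \<zeta> * z))" by simp
  also have "\<dots> \<le> exp4 \<theta> z" unfolding exp4_def using \<zeta>(1) by (intro member_le_sum) auto
  finally show ?thesis .
qed

text \<open>
If $|l(n) + r(n)| > t$, then either $|l(n)|$ or $|r(n)|$ is at least $t/2$; the weights are chosen
so that the corresponding term of the potential is then at least $1$.
\<close>

lemma terminal_bound:
  assumes "finite R" "n \<in> R" "cmod (l n + r n) > t" "t > 0" "\<theta> > 0" "\<kappa> \<ge> 0"
  shows "1 \<le> potential N R \<theta> \<kappa> (\<lambda>_. exp (- (\<theta> * t / 4))) (4 / t\<^sup>2) a l r"
proof -
  have "t < cmod (l n) + cmod (r n)" using assms(3) norm_triangle_ineq[of "l n" "r n"] by linarith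
  then consider "cmod (l n) \<ge> t / 2" | "cmod (r n) \<ge> t / 2" by linarith
  then have "1 \<le> (\<Sum>n\<in>R. exp (- (\<theta> * t / 4)) * exp4 \<theta> (l n)) + 4 / t\<^sup>2 * (\<Sum>n\<in>R. (cmod (r n))\<^sup>2)"
  proof cases
    case 1
    have "\<theta> * (t / 2) \<le> \<theta> * cmod (l n)" using 1 assms by (intro mult_left_mono) auto
    then have "1 \<le> exp (- (\<theta> * t / 4)) * exp (\<theta> * cmod (l n) / 2)" by (simp add: exp_add[symmetric])
    also have "\<dots> \<le> exp (- (\<theta> * t / 4)) * exp4 \<theta> (l n)" using exp4_ge assms by (intro mult_left_mono) auto
    also have "\<dots> \<le> (\<Sum>n\<in>R. exp (- (\<theta> * t / 4)) * exp4 \<theta> (l n))" using assms by (intro member_le_sum) auto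
    finally show ?thesis by (intro add_increasing2) (auto intro!: sum_nonneg mult_nonneg_nonneg divide_nonneg_nonneg)
  next
    case 2
    have "(t / 2)\<^sup>2 \<le> (cmod (r n))\<^sup>2" using 2 assms by (intro power_mono) auto
    also have "\<dots> \<le> (\<Sum>n\<in>R. (cmod (r n))\<^sup>2)" using assms by (intro member_le_sum) auto
    finally have "4 / t\<^sup>2 * (t / 2)\<^sup>2 \<le> 4 / t\<^sup>2 * (\<Sum>n\<in>R. (cmod (r n))\<^sup>2)" by (intro mult_left_mono) auto
    moreover have "4 / t\<^sup>2 * (t / 2)\<^sup>2 = 1" using assms by (simp add: power2_eq_square)
    ultimately show ?thesis by (auto intro!: add_increasing sum_nonneg)
  qed
  then show ?thesis using assms(6) unfolding potential_def by (simp add: add.assoc add_increasing)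
qed

lemma block_unique:
  assumes "n \<in> block m" "n \<in> block m'"
  shows "m = m'"
proof (rule ccontr)
  assume "m \<noteq> m'"
  then have "Suc m \<le> m' \<or> Suc m' \<le> m" by linarith
  then have "(2::nat) ^ Suc m \<le> 2 ^ m' \<or> (2::nat) ^ Suc m' \<le> 2 ^ m" by (meson power_increasing one_le_numeral)
  then show False using assms by auto
qed

text \<open>
An index $n$ in block $m$ is active in the blocks $m - q, \dots, m$ only, so that its accumulated
increment is the difference of the coefficients at the ends of this range. The tolerated mass at
block $j$ is $L \exp(\sum_{k < 2^j} 1/k)$, of order $L\, 2^j$; the initial mass is $1$, which gives the
term $1/L$.
\<close>

lemma increment_tail:
  assumes q: "q \<le> I" and pos: "\<theta> > 0" "t > 0" "L > 0"
  shows "(\<integral>\<^sup>+x. indicator {x. \<exists>m\<in>{I..<J}. \<exists>n\<in>block m.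
        t < cmod (gexp {1..<2 ^ Suc m} x $ n - gexp {1..<2 ^ (m - q)} x $ n)} x \<partial>gprod {1..<2 ^ J})
     \<le> ennreal (1 / L + 4 * 2 ^ J * exp (2 * \<theta>\<^sup>2 * L * real (q + 1) - \<theta> * t / 4))"
proof -
  define R where "R = (\<Union>m\<in>{I..<J}. block m)"
  \<comment> \<open>The indices $n$ in block $m$ are active in the blocks $m-q, \dots, m$.\<close>
  define S where "S i = {n. \<exists>m\<in>{I..<J}. n \<in> block m \<and> m - q \<le> i \<and> i \<le> m}" for i
  define v where "v = 2 * \<theta>\<^sup>2 * L"
  define w where "w = exp (- (\<theta> * t / 4))"
  define \<phi> :: "state \<Rightarrow> ennreal" where "\<phi> s = indicator {s. \<exists>n\<in>R. t < cmod (snd s n)} s" for s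
  define \<kappa> where "\<kappa> j = 1 / L * exp (- (\<Sum>k\<in>{1..<2 ^ j}. 1 / real k))" for j
  define a0 :: "nat \<Rightarrow> complex" where "a0 n = 1 $ n" for n
  have RJ: "n < 2 ^ J" if "n \<in> R" for n
  proof -
    obtain m where m: "m < J" "n < 2 ^ Suc m" using \<open>n \<in> R\<close> by (auto simp: R_def)
    have "(2::nat) ^ Suc m \<le> 2 ^ J" using m by (intro power_increasing) auto
    then show ?thesis using m by linarith
  qed
  have Rfin: "finite R" by (simp add: R_def)
  have cR: "card R \<le> 2 ^ J"
    using card_mono[of "{..<2 ^ J}" R] RJ by auto
  \<comment> \<open>Hence each $n$ pays for $q + 1$ blocks at most.\<close>
  have Sn: "{j\<in>{0..<J}. n \<in> S j} = {m - q..m}" if "m \<in> {I..<J}" "n \<in> block m" for m n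
  proof -
    have iff: "n \<in> S j \<longleftrightarrow> m - q \<le> j \<and> j \<le> m" for j
    proof
      assume "n \<in> S j"
      then obtain m' where "n \<in> block m'" "m' - q \<le> j \<and> j \<le> m'" unfolding S_def by blast
      then show "m - q \<le> j \<and> j \<le> m" using block_unique[OF that(2), of m'] by simp
    next
      assume "m - q \<le> j \<and> j \<le> m"
      then show "n \<in> S j" unfolding S_def mem_Collect_eq
        by (intro bexI[OF _ that(1)] conjI that(2)) simp_all
    qed
    have mJ: "m < J" using that(1) by simp
    show ?thesis
      unfolding iff set_eq_iff mem_Collect_eq atLeastAtMost_iff atLeastLessThan_iff using mJ by auto
  qed
  have "\<phi> \<in> borel_measurable state_space"
  proof -
    have "{s \<in> space state_space. \<exists>n\<in>R. t < cmod (snd s n)} \<in> sets state_space"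
      using Rfin by measurable
    then show ?thesis unfolding \<phi>_def by (intro borel_measurable_indicator) (simp add: space_pair_measure space_PiM)
  qed
  note \<phi>m = this
  have "bellman \<phi> S J 0 (a0, \<lambda>n. (\<lambda>_. 0) n + (\<lambda>_. 0) n)
    \<le> ennreal (potential (2 ^ J) R \<theta> (\<kappa> 0) (\<lambda>n. w * exp (v * card {j\<in>{0..<J}. n \<in> S j})) (4 / t\<^sup>2) a0 (\<lambda>_. 0) (\<lambda>_. 0))"
  proof (rule bellman_bound[OF \<phi>m _ Rfin])
    show "\<phi> s \<le> 1" for s by (simp add: \<phi>_def indicator_def)
    show "R \<subseteq> {..2 ^ J}" using RJ by (auto intro: less_imp_le)
    show "\<kappa> j > 0" for j using pos by (simp add: \<kappa>_def)
    show "\<kappa> j = \<kappa> (Suc j) * exp (\<Sum>k\<in>block j. 1 / real k)" for j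
    proof -
      have "{1..<2 ^ Suc j} = {1..<2 ^ j} \<union> (block j :: nat set)" using ivl_disj_un_two(3)[of 1 "2 ^ j" "2 ^ Suc j :: nat"] by simp
      then have "(\<Sum>k\<in>{1..<2 ^ Suc j}. 1 / real k) = (\<Sum>k\<in>{1..<2 ^ j}. 1 / real k) + (\<Sum>k\<in>block j. 1 / real k)"
        by (simp only:) (rule sum.union_disjoint, auto)
      then show ?thesis unfolding \<kappa>_def by (simp only: mult.assoc exp_add[symmetric]) simp
    qed
    show "\<theta>\<^sup>2 / (4 * \<kappa> (Suc j) * 2 ^ j) \<le> v" for j
    proof -
      have "exp (\<Sum>k\<in>{1..<2 ^ Suc j}. 1 / real k) \<le> exp 1 * real (2 ^ Suc j)"
        by (rule exp_harmonic_sum_le) simp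
      also have "\<dots> \<le> 3 * real (2 ^ Suc j)" by (intro mult_right_mono exp_le) simp
      also have "\<dots> \<le> 8 * 2 ^ j" by simp
      finally have e: "exp (\<Sum>k\<in>{1..<2 ^ Suc j}. 1 / real k) \<le> 8 * 2 ^ j" .
      have "\<theta>\<^sup>2 / (4 * \<kappa> (Suc j) * 2 ^ j) = \<theta>\<^sup>2 * L / (4 * 2 ^ j) * exp (\<Sum>k\<in>{1..<2 ^ Suc j}. 1 / real k)"
        unfolding \<kappa>_def using pos by (simp add: exp_minus field_simps)
      also have "\<dots> \<le> \<theta>\<^sup>2 * L / (4 * 2 ^ j) * (8 * 2 ^ j)" using e pos by (intro mult_left_mono) auto
      also have "\<dots> = v" by (simp add: v_def)
      finally show ?thesis .
    qed
    show "\<phi> (a, \<lambda>n. l n + r n) \<le> ennreal (potential (2 ^ J) R \<theta> (\<kappa> J) (\<lambda>_. w) (4 / t\<^sup>2) a l r)" for a l r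
    proof (cases "\<exists>n\<in>R. t < cmod (l n + r n)")
      case True
      then obtain n where n: "n \<in> R" "t < cmod (l n + r n)" by blast
      have "1 \<le> potential (2 ^ J) R \<theta> (\<kappa> J) (\<lambda>_. w) (4 / t\<^sup>2) a l r"
        unfolding w_def using pos by (intro terminal_bound[OF Rfin n(1)]) (auto simp: n \<kappa>_def)
      then show ?thesis using True by (simp add: \<phi>_def)
    qed (simp add: \<phi>_def)
  qed (auto simp: w_def)
  also have "potential (2 ^ J) R \<theta> (\<kappa> 0) (\<lambda>n. w * exp (v * card {j\<in>{0..<J}. n \<in> S j})) (4 / t\<^sup>2) a0 (\<lambda>_. 0) (\<lambda>_. 0)
    = 1 / L + (\<Sum>n\<in>R. w * exp (v * card {j\<in>{0..<J}. n \<in> S j}) * 4)"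
  proof -
    have "mass (2 ^ J) a0 = (\<Sum>m\<in>{0}. (cmod (a0 m))\<^sup>2)"
      unfolding mass_def by (rule sum.mono_neutral_right) (auto simp: a0_def)
    then have "mass (2 ^ J) a0 = 1" by (simp add: a0_def)
    moreover have "exp4 \<theta> 0 = 4"
      unfolding exp4_def by (simp add: complex_eq_iff)
    ultimately show ?thesis by (simp add: potential_def \<kappa>_def)
  qed
  also have "\<dots> \<le> 1 / L + (\<Sum>n\<in>R. w * exp (v * real (q + 1)) * 4)"
  proof (intro add_left_mono sum_mono mult_right_mono mult_left_mono)
    fix n assume "n \<in> R"
    then obtain m where m: "m \<in> {I..<J}" "n \<in> block m" by (auto simp: R_def)
    have "card {j\<in>{0..<J}. n \<in> S j} \<le> q + 1" unfolding Sn[OF m] by simp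
    then show "exp (v * card {j\<in>{0..<J}. n \<in> S j}) \<le> exp (v * real (q + 1))"
      using pos by (auto simp: v_def intro!: mult_left_mono simp flip: of_nat_Suc)
  qed (auto simp: w_def)
  also have "\<dots> \<le> 1 / L + 2 ^ J * (w * exp (v * real (q + 1)) * 4)"
    using of_nat_mono[OF cR, where ?'a = real] by (auto simp: w_def intro!: mult_right_mono)
  also have "\<dots> = 1 / L + 4 * 2 ^ J * exp (2 * \<theta>\<^sup>2 * L * real (q + 1) - \<theta> * t / 4)"
  proof -
    have "w * exp (v * real (q + 1)) = exp (2 * \<theta>\<^sup>2 * L * real (q + 1) - \<theta> * t / 4)"
      by (simp add: w_def v_def exp_add[symmetric] add.commute)
    then show ?thesis by simp
  qed
  finally have main: "bellman \<phi> S J 0 (a0, \<lambda>n. 0) \<le> ennreal (1 / L + 4 * 2 ^ J * exp (2 * \<theta>\<^sup>2 * L * real (q + 1) - \<theta> * t / 4))"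
    by (simp add: ennreal_leI)
  have ev: "snd (evolve S J 0 x (a0, \<lambda>n. 0)) n = gexp {1..<2 ^ Suc m} x $ n - gexp {1..<2 ^ (m - q)} x $ n"
    if m: "m \<in> {I..<J}" "n \<in> block m" for x m n
  proof -
    have a: "Abs_fps a0 = 1" by (simp add: fps_eq_iff a0_def)
    let ?G = "\<lambda>j. gexp {1..<2 ^ j} x $ n"
    have "snd (evolve S J 0 x (a0, \<lambda>n. 0)) n = (\<Sum>j\<in>{0..<J}. if n \<in> S j then ?G (Suc j) - ?G j else 0)"
      unfolding evolve_value by (simp add: a cong: if_cong)
    also have "\<dots> = (\<Sum>j\<in>{j\<in>{0..<J}. n \<in> S j}. ?G (Suc j) - ?G j)"
      by (rule sum.inter_filter[symmetric]) simp
    also have "\<dots> = (\<Sum>j\<in>{m - q..m}. ?G (Suc j) - ?G j)" unfolding Sn[OF m] ..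
    also have "\<dots> = ?G (Suc m) - ?G (m - q)" by (rule sum_Suc_diff) simp
    finally show ?thesis .
  qed
  have "(\<integral>\<^sup>+x. indicator {x. \<exists>m\<in>{I..<J}. \<exists>n\<in>block m.
        t < cmod (gexp {1..<2 ^ Suc m} x $ n - gexp {1..<2 ^ (m - q)} x $ n)} x \<partial>gprod {1..<2 ^ J}) =
      (\<integral>\<^sup>+x. \<phi> (evolve S J 0 x (a0, \<lambda>n. 0)) \<partial>gprod {2 ^ 0..<2 ^ (0 + J)})"
  proof -
    have "indicator {x. \<exists>m\<in>{I..<J}. \<exists>n\<in>block m.
        t < cmod (gexp {1..<2 ^ Suc m} x $ n - gexp {1..<2 ^ (m - q)} x $ n)} x = \<phi> (evolve S J 0 x (a0, \<lambda>n. 0))" for x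
    proof -
      have "(\<exists>n\<in>R. t < cmod (snd (evolve S J 0 x (a0, \<lambda>n. 0)) n)) \<longleftrightarrow>
          (\<exists>m\<in>{I..<J}. \<exists>n\<in>block m. t < cmod (gexp {1..<2 ^ Suc m} x $ n - gexp {1..<2 ^ (m - q)} x $ n))"
        unfolding R_def using ev by (auto simp del: atLeastLessThan_iff power_Suc)
      then show ?thesis unfolding \<phi>_def indicator_def by (simp del: atLeastLessThan_iff power_Suc)
    qed
    then show ?thesis by simp
  qed
  also have "\<dots> = bellman \<phi> S J 0 (a0, \<lambda>n. 0)" by (rule bellman_eq_evolve[OF \<phi>m, symmetric])
  finally show ?thesis using main by (simp only:)
qed

lemma sqrt_weighted_fps_exp_nth:
  assumes "n < K"
  shows "(fps_exp 1 oo sqrt_weighted_fps x) $ n = gexp {1..<K} x $ n"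
proof -
  have "sqrt_weighted_fps x = Abs_fps (\<lambda>k. if k \<in> {1..} then of_real (1 / sqrt (real k)) * x k else 0)"
    by (auto simp: sqrt_weighted_fps_def fps_eq_iff)
  then have "fps_exp 1 oo sqrt_weighted_fps x = gexp {1..} x" by (simp only: zexp_def)
  moreover have "gexp {1..} x $ n = gexp {1..<K} x $ n"
    using assms by (intro zexp_nth_cong_le) auto
  ultimately show ?thesis by simp
qed

lemma nn_integral_gaussian_sequence:
  assumes M: "prob_space M" and ind: "prob_space.indep_vars M (\<lambda>_. borel) X {1..}"
    and X: "\<And>k. k \<ge> 1 \<Longrightarrow> std_complex_gaussian M (X k)"
    and f: "f \<in> borel_measurable (PiM B (\<lambda>_. borel))" and B: "B \<subseteq> {1::nat..}"
  shows "(\<integral>\<^sup>+\<omega>. f (\<lambda>k\<in>B. X k \<omega>) \<partial>M) = (\<integral>\<^sup>+x. f x \<partial>gprod B)"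
proof -
  interpret prob_space M by fact
  have Xm: "X k \<in> borel_measurable M" "distr M borel (X k) = cgauss" if "k \<in> B" for k
    using distr_std_complex_gaussian[OF M X] B that by auto
  show ?thesis
  proof (cases "B = {}")
    case True
    then show ?thesis
      by (simp add: emeasure_space_1 PiM_empty nn_integral_count_space_finite restrict_def)
  next
    case False
    have "distr M (PiM B (\<lambda>_. borel)) (\<lambda>\<omega>. \<lambda>k\<in>B. X k \<omega>) = PiM B (\<lambda>k. distr M borel (X k))"
      using indep_vars_iff_distr_eq_PiM'[OF False, where M' = "\<lambda>_. borel" and X = X] Xm(1) indep_vars_subset[OF ind B] by auto
    also have "\<dots> = gprod B" by (intro PiM_cong) (auto simp: Xm(2))
    finally have law: "distr M (PiM B (\<lambda>_. borel)) (\<lambda>\<omega>. \<lambda>k\<in>B. X k \<omega>) = gprod B" .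
    have m: "(\<lambda>\<omega>. \<lambda>k\<in>B. X k \<omega>) \<in> M \<rightarrow>\<^sub>M PiM B (\<lambda>_. borel)" by (rule measurable_restrict) (rule Xm(1))
    show ?thesis unfolding law[symmetric] by (rule nn_integral_distr[OF m, symmetric]) (simp add: f)
  qed
qed

lemma measurable_gexp_PiM:
  assumes "B \<subseteq> C"
  shows "(\<lambda>x. gexp B x $ n) \<in> borel_measurable (PiM C (\<lambda>_. borel))"
proof (rule measurable_zexp_nth)
  fix k assume "k \<in> B"
  then have "k \<in> C" using assms by auto
  then show "(\<lambda>x. complex_of_real (1 / sqrt (real k)) * x k) \<in> borel_measurable (PiM C (\<lambda>_. borel))" by measurable
qed

lemma gexp_restrict: "B \<subseteq> C \<Longrightarrow> gexp B (\<lambda>k\<in>C. x k) = gexp B x"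
  by (rule zexp_cong) auto

lemma borel_measurable_indicator_Collect:
  assumes "{x \<in> space M. P x} \<in> sets M"
  shows "(indicator {x. P x} :: _ \<Rightarrow> ennreal) \<in> borel_measurable M"
proof -
  have "{x. P x} \<inter> space M = {x \<in> space M. P x}" by auto
  then show ?thesis using assms by (simp add: borel_measurable_indicator_iff)
qed

text \<open>
The coefficient at $n$ is its value before the $q + 1$ active blocks, handled by Chebyshev and
\<open>smooth_coefficient_le\<close> since $n/2^{m-q} \ge 2^q$, plus the increment handled by
\<open>increment_tail\<close>.
\<close>

lemma scale_tail:
  fixes X :: "nat \<Rightarrow> 'a \<Rightarrow> complex"
  assumes M: "prob_space M" and ind: "prob_space.indep_vars M (\<lambda>_. borel) X {1..}"
    and X: "\<And>k. k \<ge> 1 \<Longrightarrow> std_complex_gaussian M (X k)"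
    and q: "q \<le> I" and pos: "\<theta> > 0" "t > 0" "L > 0"
  shows "(\<integral>\<^sup>+\<omega>. indicator {\<omega>. \<exists>m\<in>{I..<J}. \<exists>n\<in>block m. 2 * t < cmod (gexp {1..<2 ^ Suc m} (\<lambda>k. X k \<omega>) $ n)} \<omega> \<partial>M)
     \<le> ennreal (1 / L + 4 * 2 ^ J * exp (2 * \<theta>\<^sup>2 * L * real (q + 1) - \<theta> * t / 4)
          + 2 ^ J * (exp 3 * 2 ^ J * exp (- (2 ^ q)) / t\<^sup>2))"
proof -
  note law = nn_integral_gaussian_sequence[OF M ind X]
  have Xm [measurable]: "X k \<in> borel_measurable M" if "k \<ge> 1" for k
    using distr_std_complex_gaussian[OF M X] that by auto
  have gm [measurable]: "(\<lambda>\<omega>. gexp {1..<K} (\<lambda>k. X k \<omega>) $ n) \<in> borel_measurable M" for K n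
    by (rule measurable_zexp_nth) (use Xm in measurable)
  define R where "R = (\<Union>m\<in>{I..<J}. block m)"
  have RJ: "n < 2 ^ J" if "n \<in> R" for n
  proof -
    obtain m where m: "m < J" "n < 2 ^ Suc m" using \<open>n \<in> R\<close> by (auto simp: R_def)
    have "(2::nat) ^ Suc m \<le> 2 ^ J" using m by (intro power_increasing) auto
    then show ?thesis using m by linarith
  qed
  have cR: "card R \<le> 2 ^ J" "finite R"
  proof -
    show "finite R" by (simp add: R_def)
    have "R \<subseteq> {..<2 ^ J}" using RJ by auto
    then show "card R \<le> 2 ^ J" using card_mono[of "{..<2 ^ J}" R] by simp
  qed
  define mu where "mu n = (THE m. n \<in> block m)" for n :: nat
  have mu: "mu n = m" if "n \<in> block m" for n m
    unfolding mu_def using that by (intro the_equality block_unique)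
  let ?inc = "{x. \<exists>m\<in>{I..<J}. \<exists>n\<in>block m. t < cmod (gexp {1..<2 ^ Suc m} x $ n - gexp {1..<2 ^ (m - q)} x $ n)}"
  let ?st = "\<lambda>n \<omega>. gexp {1..<2 ^ (mu n - q)} (\<lambda>k. X k \<omega>) $ n"
  have inc: "(\<integral>\<^sup>+\<omega>. indicator ?inc (\<lambda>k. X k \<omega>) \<partial>M) \<le> ennreal (1 / L + 4 * 2 ^ J * exp (2 * \<theta>\<^sup>2 * L * real (q + 1) - \<theta> * t / 4))"
  proof -
    have sub: "{1..<2 ^ Suc m} \<subseteq> {1..<2 ^ J :: nat}" "{1..<2 ^ (m - q)} \<subseteq> {1..<2 ^ J :: nat}" if "m \<in> {I..<J}" for m
    proof -
      have "(2::nat) ^ Suc m \<le> 2 ^ J" "(2::nat) ^ (m - q) \<le> 2 ^ J" using that by (auto intro!: power_increasing simp del: power_Suc)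
      then show "{1..<2 ^ Suc m} \<subseteq> {1..<2 ^ J :: nat}" "{1..<2 ^ (m - q)} \<subseteq> {1..<2 ^ J :: nat}" by (auto simp del: power_Suc)
    qed
    let ?N = "PiM {1..<2 ^ J} (\<lambda>_. borel :: complex measure)"
    have [measurable]: "(\<lambda>x. gexp {1..<2 ^ Suc m} x $ n) \<in> borel_measurable ?N" "(\<lambda>x. gexp {1..<2 ^ (m - q)} x $ n) \<in> borel_measurable ?N"
      if "m \<in> {I..<J}" for m n
      by (rule measurable_gexp_PiM[OF sub(1)[OF that]], rule measurable_gexp_PiM[OF sub(2)[OF that]])
    have "{x \<in> space ?N. \<exists>m\<in>{I..<J}. \<exists>n\<in>block m. t < cmod (gexp {1..<2 ^ Suc m} x $ n - gexp {1..<2 ^ (m - q)} x $ n)} \<in> sets ?N"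
      by measurable
    then have im: "(indicator ?inc :: _ \<Rightarrow> ennreal) \<in> borel_measurable ?N"
      by (rule borel_measurable_indicator_Collect)
    have "(\<integral>\<^sup>+\<omega>. indicator ?inc (\<lambda>k\<in>{1..<2 ^ J}. X k \<omega>) \<partial>M) = (\<integral>\<^sup>+x. indicator ?inc x \<partial>gprod {1..<2 ^ J})"
      by (rule nn_integral_gaussian_sequence[OF M ind X im]) auto
    moreover have "indicator ?inc (\<lambda>k\<in>{1..<2 ^ J}. X k \<omega>) = (indicator ?inc (\<lambda>k. X k \<omega>) :: ennreal)" for \<omega>
    proof -
      have "gexp {1..<2 ^ Suc m} (\<lambda>k\<in>{1..<2 ^ J}. X k \<omega>) = gexp {1..<2 ^ Suc m} (\<lambda>k. X k \<omega>)"
        "gexp {1..<2 ^ (m - q)} (\<lambda>k\<in>{1..<2 ^ J}. X k \<omega>) = gexp {1..<2 ^ (m - q)} (\<lambda>k. X k \<omega>)"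
        if "m \<in> {I..<J}" for m
        by (rule gexp_restrict[OF sub(1)[OF that]], rule gexp_restrict[OF sub(2)[OF that]])
      then have "(\<lambda>k\<in>{1..<2 ^ J}. X k \<omega>) \<in> ?inc \<longleftrightarrow> (\<lambda>k. X k \<omega>) \<in> ?inc"
        unfolding mem_Collect_eq by (intro bex_cong refl) (simp only:)
      then show ?thesis unfolding indicator_def by (simp only:)
    qed
    ultimately show ?thesis using increment_tail[OF q pos, of J] by simp
  qed
  have st: "(\<integral>\<^sup>+\<omega>. indicator {\<omega>. t < cmod (?st n \<omega>)} \<omega> \<partial>M) \<le> ennreal (exp 3 * 2 ^ J * exp (- (2 ^ q)) / t\<^sup>2)"
    if n: "n \<in> R" for n
  proof -
    obtain m where m: "m \<in> {I..<J}" "n \<in> block m" using n by (auto simp: R_def)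
    let ?K = "2 ^ (m - q) :: nat"
    have stn: "?st n \<omega> = gexp {1..<?K} (\<lambda>k. X k \<omega>) $ n" for \<omega> unfolding mu[OF m(2)] ..
    have "(\<integral>\<^sup>+\<omega>. indicator {\<omega>. t < cmod (?st n \<omega>)} \<omega> \<partial>M) \<le> (\<integral>\<^sup>+\<omega>. ennreal (1 / t\<^sup>2) * ennreal ((cmod (gexp {1..<?K} (\<lambda>k. X k \<omega>) $ n))\<^sup>2) \<partial>M)"
    proof (rule nn_integral_mono)
      fix \<omega>
      have "t < cmod (gexp {1..<?K} (\<lambda>k. X k \<omega>) $ n) \<Longrightarrow> 1 \<le> 1 / t\<^sup>2 * (cmod (gexp {1..<?K} (\<lambda>k. X k \<omega>) $ n))\<^sup>2"
        using pos power_mono[of t "cmod (gexp {1..<?K} (\<lambda>k. X k \<omega>) $ n)" 2] by simp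
      then show "indicator {\<omega>. t < cmod (?st n \<omega>)} \<omega> \<le> ennreal (1 / t\<^sup>2) * ennreal ((cmod (gexp {1..<?K} (\<lambda>k. X k \<omega>) $ n))\<^sup>2)"
        unfolding stn by (auto simp: indicator_def ennreal_mult[symmetric] simp del: ennreal_1 simp flip: ennreal_1 intro!: ennreal_leI)
    qed
    also have "\<dots> = ennreal (1 / t\<^sup>2) * (\<integral>\<^sup>+\<omega>. ennreal ((cmod (gexp {1..<?K} (\<lambda>k. X k \<omega>) $ n))\<^sup>2) \<partial>M)"
      by (rule nn_integral_cmult) measurable
    also have "(\<integral>\<^sup>+\<omega>. ennreal ((cmod (gexp {1..<?K} (\<lambda>k. X k \<omega>) $ n))\<^sup>2) \<partial>M)
        = (\<integral>\<^sup>+\<omega>. ennreal ((cmod (gexp {1..<?K} (\<lambda>k\<in>{1..<?K}. X k \<omega>) $ n))\<^sup>2) \<partial>M)"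
      by (simp only: gexp_restrict[OF subset_refl])
    also have "\<dots> = (\<integral>\<^sup>+x. ennreal ((cmod (gexp {1..<?K} x $ n))\<^sup>2) \<partial>gprod {1..<?K})"
    proof (rule law)
      have [measurable]: "(\<lambda>x. gexp {1..<?K} x $ n) \<in> borel_measurable (PiM {1..<?K} (\<lambda>_. borel))"
        by (rule measurable_gexp_PiM) simp
      show "(\<lambda>x. ennreal ((cmod (gexp {1..<?K} x $ n))\<^sup>2)) \<in> borel_measurable (PiM {1..<?K} (\<lambda>_. borel))"
        by measurable
    qed auto
    also have "\<dots> = ennreal (zexp {1..<?K} (\<lambda>k. 1 / real k) $ n)"
    proof -
      have "(\<Sum>l\<le>n. (cmod ((1 :: complex fps) $ (n - l)))\<^sup>2 * f l) = (\<Sum>l\<in>{n}. (cmod ((1 :: complex fps) $ (n - l)))\<^sup>2 * f l)" for f :: "nat \<Rightarrow> real"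
        by (rule sum.mono_neutral_right) auto
      then show ?thesis
        using gaussian_exp_coeff_L2[of "{1..<?K}" 1 "\<lambda>k. 1 / sqrt (real k)" n] by (simp add: power_divide)
    qed
    also have "\<dots> \<le> ennreal (exp 3 * 2 ^ J * exp (- (2 ^ q)))"
    proof (rule ennreal_leI)
      have "zexp {1..<?K} (\<lambda>k. 1 / real k) $ n \<le> exp 3 * real ?K * exp (- (real n / real ?K))"
        by (rule smooth_coefficient_le) simp
      also have "\<dots> \<le> exp 3 * 2 ^ J * exp (- (2 ^ q))"
      proof (intro mult_mono)
        have "?K \<le> 2 ^ J" using m by (intro power_increasing) auto
        then have "real ?K \<le> real (2 ^ J)" by (rule of_nat_mono)
        then show "real ?K \<le> 2 ^ J" by simp
        have "real (2 ^ q * ?K) \<le> real n"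
          unfolding power_add[symmetric] using m q by (intro of_nat_mono) auto
        then have "2 ^ q \<le> real n / real ?K" by (simp add: field_simps)
        then show "exp (- (real n / real ?K)) \<le> exp (- (2 ^ q))" by simp
      qed auto
      finally show "zexp {1..<?K} (\<lambda>k. 1 / real k) $ n \<le> exp 3 * 2 ^ J * exp (- (2 ^ q))" .
    qed
    finally show ?thesis by (simp add: mult_left_mono ennreal_mult[symmetric])
  qed
  have "(\<integral>\<^sup>+\<omega>. indicator {\<omega>. \<exists>m\<in>{I..<J}. \<exists>n\<in>block m. 2 * t < cmod (gexp {1..<2 ^ Suc m} (\<lambda>k. X k \<omega>) $ n)} \<omega> \<partial>M)
     \<le> (\<integral>\<^sup>+\<omega>. indicator ?inc (\<lambda>k. X k \<omega>) + (\<Sum>n\<in>R. indicator {\<omega>. t < cmod (?st n \<omega>)} \<omega>) \<partial>M)"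
  proof (rule nn_integral_mono)
    fix \<omega>
    show "indicator {\<omega>. \<exists>m\<in>{I..<J}. \<exists>n\<in>block m. 2 * t < cmod (gexp {1..<2 ^ Suc m} (\<lambda>k. X k \<omega>) $ n)} \<omega>
      \<le> indicator ?inc (\<lambda>k. X k \<omega>) + (\<Sum>n\<in>R. indicator {\<omega>. t < cmod (?st n \<omega>)} \<omega> :: ennreal)"
    proof (cases "\<exists>m\<in>{I..<J}. \<exists>n\<in>block m. 2 * t < cmod (gexp {1..<2 ^ Suc m} (\<lambda>k. X k \<omega>) $ n)")
      case True
      then obtain m n where m: "m \<in> {I..<J}" "n \<in> block m" "2 * t < cmod (gexp {1..<2 ^ Suc m} (\<lambda>k. X k \<omega>) $ n)" by blast
      let ?d = "gexp {1..<2 ^ Suc m} (\<lambda>k. X k \<omega>) $ n - gexp {1..<2 ^ (m - q)} (\<lambda>k. X k \<omega>) $ n"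
      show ?thesis
      proof (cases "t < cmod ?d")
        case True
        then have "(\<lambda>k. X k \<omega>) \<in> ?inc" using m by blast
        then show ?thesis by (intro add_increasing2) (auto simp: indicator_def)
      next
        case False
        have "cmod (gexp {1..<2 ^ Suc m} (\<lambda>k. X k \<omega>) $ n) \<le> cmod ?d + cmod (gexp {1..<2 ^ (m - q)} (\<lambda>k. X k \<omega>) $ n)"
          using norm_triangle_ineq[of ?d "gexp {1..<2 ^ (m - q)} (\<lambda>k. X k \<omega>) $ n"] by simp
        then have "t < cmod (?st n \<omega>)" unfolding mu[OF m(2)] using False m(3) by linarith
        moreover have "n \<in> R" unfolding R_def using m by blast
        ultimately have "(1::ennreal) \<le> (\<Sum>n\<in>R. indicator {\<omega>. t < cmod (?st n \<omega>)} \<omega>)"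
          using member_le_sum[of n R "\<lambda>n. indicator {\<omega>. t < cmod (?st n \<omega>)} \<omega> :: ennreal"] cR(2)
          by (simp add: indicator_def)
        then show ?thesis by (intro add_increasing) (auto simp: indicator_def)
      qed
    qed (simp add: indicator_def)
  qed
  also have "\<dots> = (\<integral>\<^sup>+\<omega>. indicator ?inc (\<lambda>k. X k \<omega>) \<partial>M) + (\<Sum>n\<in>R. \<integral>\<^sup>+\<omega>. indicator {\<omega>. t < cmod (?st n \<omega>)} \<omega> \<partial>M)"
  proof -
    have 1: "(indicator {\<omega>. t < cmod (?st n \<omega>)} :: 'a \<Rightarrow> ennreal) \<in> borel_measurable M" for n
    proof -
      have "{\<omega> \<in> space M. t < cmod (?st n \<omega>)} \<in> sets M" by measurable
      then show ?thesis by (rule borel_measurable_indicator_Collect)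
    qed
    have 2: "(\<lambda>\<omega>. indicator ?inc (\<lambda>k. X k \<omega>) :: ennreal) \<in> borel_measurable M"
    proof -
      have "{\<omega> \<in> space M. (\<lambda>k. X k \<omega>) \<in> ?inc} \<in> sets M" unfolding mem_Collect_eq by measurable
      moreover have "(\<lambda>\<omega>. indicator ?inc (\<lambda>k. X k \<omega>) :: ennreal) = indicator {\<omega>. (\<lambda>k. X k \<omega>) \<in> ?inc}"
        by (simp add: indicator_def fun_eq_iff)
      ultimately show ?thesis
        by (simp only:) (rule borel_measurable_indicator_Collect, simp only: mem_Collect_eq)
    qed
    show ?thesis using 1 2 by (simp add: nn_integral_add nn_integral_sum)
  qed
  also have "\<dots> \<le> ennreal (1 / L + 4 * 2 ^ J * exp (2 * \<theta>\<^sup>2 * L * real (q + 1) - \<theta> * t / 4))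
      + (\<Sum>n\<in>R. ennreal (exp 3 * 2 ^ J * exp (- (2 ^ q)) / t\<^sup>2))"
    by (intro add_mono sum_mono inc st)
  also have "\<dots> \<le> ennreal (1 / L + 4 * 2 ^ J * exp (2 * \<theta>\<^sup>2 * L * real (q + 1) - \<theta> * t / 4)
          + 2 ^ J * (exp 3 * 2 ^ J * exp (- (2 ^ q)) / t\<^sup>2))"
  proof -
    have "real (card R) \<le> 2 ^ J" using of_nat_mono[OF cR(1), where ?'a = real] by simp
    then have "ennreal (real (card R) * (exp 3 * 2 ^ J * exp (- (2 ^ q)) / t\<^sup>2)) \<le> ennreal (2 ^ J * (exp 3 * 2 ^ J * exp (- (2 ^ q)) / t\<^sup>2))"
      by (intro ennreal_leI mult_right_mono) auto
    moreover have "(\<Sum>n\<in>R. ennreal (exp 3 * 2 ^ J * exp (- (2 ^ q)) / t\<^sup>2)) = ennreal (real (card R) * (exp 3 * 2 ^ J * exp (- (2 ^ q)) / t\<^sup>2))"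
      by (subst sum_ennreal) auto
    ultimately show ?thesis using pos by (subst ennreal_plus) (auto intro!: add_left_mono)
  qed
  finally show ?thesis .
qed

section \<open>The almost sure bound\<close>

text \<open>
The range $16^p \le \log_2 n < 16^{p+1}$ is treated with $I = 16^p$, $J = 16^{p+1}$, $L = 2^p$,
$t = 8^p$ (that is $I^{3/4}$), $q = 4p+6$ (so $2^q = 64 I$) and $\theta = 64 \cdot 2^p$. Then
$\theta t/4 = 16 I$ and $2^q$ beat the number $2^{J} = 2^{16 I} \le e^{12 I}$ of indices, while the
variance cost $2 \theta^2 L (q+1)$ is only of order $8^p p = o(I)$. Every term is eventually dominated
by a summable geometric sequence.
\<close>

lemma tail_parameters:
  "\<forall>\<^sub>F p :: nat in sequentially.
     1 / 2 ^ p + 4 * 2 ^ (16 ^ Suc p) * exp (2 * (64 * 2 ^ p)\<^sup>2 * 2 ^ p * real (4 * p + 6 + 1) - 64 * 2 ^ p * 8 ^ p / 4)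
      + 2 ^ (16 ^ Suc p) * (exp 3 * 2 ^ (16 ^ Suc p) * exp (- (2 ^ (4 * p + 6))) / (8 ^ p)\<^sup>2)
     \<le> (1 / 2) ^ p + 4 * exp (- 1) ^ p + exp 3 * exp (- 1 :: real) ^ p"
proof -
  have ev: "\<forall>\<^sub>F p :: nat in sequentially. 8192 * 8 ^ p * (4 * real p + 7) - 4 * 16 ^ p \<le> - real p"
    by real_asymp
  have two: "(2::real) ^ (16 ^ Suc p) \<le> exp (12 * 16 ^ p)" for p :: nat
  proof -
    \<comment> \<open>The base $e^{3/4}$ makes the exponents integers: $16 \cdot 3/4 = 12$.\<close>
    have "2 \<le> exp (3 / 4 :: real)" using exp_lower_Taylor_quadratic[of "3/4 :: real"] by (simp add: power2_eq_square)
    then have "(2::real) ^ (16 ^ Suc p) \<le> exp (3 / 4) ^ (16 ^ Suc p)" by (intro power_mono) auto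
    also have "\<dots> = exp (12 * 16 ^ p)" by (simp add: exp_of_nat_mult[symmetric])
    finally show ?thesis .
  qed
  show ?thesis
    using ev
  proof eventually_elim
    case (elim p)
    have "2 * (64 * 2 ^ p)\<^sup>2 * 2 ^ p * real (4 * p + 6 + 1) - 64 * 2 ^ p * 8 ^ p / 4
        = 8192 * 8 ^ p * (4 * real p + 7) - 16 * (16 ^ p :: real)"
    proof -
      have "(2 ^ p)\<^sup>2 * 2 ^ p = (8 ^ p :: real)" "2 ^ p * 8 ^ p = (16 ^ p :: real)"
        by (simp_all add: power2_eq_square power_mult_distrib[symmetric])
      moreover have "2 * (64 * 2 ^ p)\<^sup>2 * 2 ^ p * real (4 * p + 6 + 1) - 64 * 2 ^ p * 8 ^ p / 4
        = 8192 * ((2 ^ p)\<^sup>2 * 2 ^ p) * (4 * real p + 7) - 16 * (2 ^ p * 8 ^ p :: real)"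
        by (simp add: power2_eq_square)
      ultimately show ?thesis by simp
    qed
    then have "4 * 2 ^ (16 ^ Suc p) * exp (2 * (64 * 2 ^ p)\<^sup>2 * 2 ^ p * real (4 * p + 6 + 1) - 64 * 2 ^ p * 8 ^ p / 4)
       \<le> 4 * exp (12 * 16 ^ p) * exp (8192 * 8 ^ p * (4 * real p + 7) - 16 * 16 ^ p)"
      using two[of p] by (simp del: power_Suc)
    also have "\<dots> = 4 * exp (8192 * 8 ^ p * (4 * real p + 7) - 4 * 16 ^ p)"
      by (simp add: exp_add[symmetric] del: exp_add_commuting)
    also have "\<dots> \<le> 4 * exp (- real p)" using elim by simp
    finally have 1: "4 * 2 ^ (16 ^ Suc p) * exp (2 * (64 * 2 ^ p)\<^sup>2 * 2 ^ p * real (4 * p + 6 + 1) - 64 * 2 ^ p * 8 ^ p / 4)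
       \<le> 4 * exp (- 1) ^ p" by (simp add: exp_of_nat_mult[symmetric])
    have q: "(2::real) ^ (4 * p + 6) = 64 * 16 ^ p" by (simp add: power_add power_mult)
    have "(2::real) ^ (16 ^ Suc p) * (exp 3 * 2 ^ (16 ^ Suc p) * exp (- (2 ^ (4 * p + 6))) / (8 ^ p)\<^sup>2)
       \<le> exp (12 * 16 ^ p) * (exp 3 * exp (12 * 16 ^ p) * exp (- (64 * 16 ^ p)) / 1)"
      unfolding q using two[of p]
      by (intro mult_mono frac_le mult_nonneg_nonneg divide_nonneg_nonneg) (auto simp: one_le_power simp del: power_Suc)
    also have "\<dots> = exp 3 * exp (- (40 * 16 ^ p))"
      by (simp add: exp_add[symmetric])
    also have "\<dots> \<le> exp 3 * exp (- real p)"
    proof -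
      have "real p < 2 ^ p" by (rule of_nat_less_two_power)
      also have "\<dots> \<le> (16::real) ^ p" by (rule power_mono) auto
      finally have "real p < 16 ^ p" .
      moreover have "(0::real) \<le> 16 ^ p" by simp
      ultimately have "- (40 * 16 ^ p) \<le> - real p" by linarith
      then show ?thesis by (simp only: mult_le_cancel_left_pos exp_gt_zero exp_le_cancel_iff)
    qed
    also have "\<dots> = exp 3 * exp (- 1) ^ p" by (simp add: exp_of_nat_mult[symmetric])
    finally show ?case using 1 by (simp only: power_one_over)
  qed
qed

lemma scale_exists:
  fixes n p0 :: nat
  assumes "2 ^ (16 ^ p0) \<le> n"
  obtains p where "p \<ge> p0" "2 ^ (16 ^ p) \<le> n" "n < 2 ^ (16 ^ Suc p)"
proof -
  define P where "P p \<longleftrightarrow> p \<ge> p0 \<and> n < 2 ^ (16 ^ Suc p)" for p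
  have grow: "n < 2 ^ (16 ^ Suc (max p0 n))"
  proof -
    have "max p0 n < 2 ^ max p0 n" by (rule less_exp)
    also have "\<dots> \<le> 16 ^ max p0 n" by (rule power_mono) auto
    also have "\<dots> \<le> 16 ^ Suc (max p0 n)" by simp
    also have "\<dots> < 2 ^ (16 ^ Suc (max p0 n))" by (rule less_exp)
    finally show ?thesis by linarith
  qed
  then have "P (max p0 n)" by (simp add: P_def del: power_Suc)
  then have "P (LEAST p. P p)" by (rule LeastI)
  then obtain p where p: "p = (LEAST p. P p)" "P p" by blast
  have "2 ^ (16 ^ p) \<le> n"
  proof (cases "p = p0")
    case False
    then have "p0 \<le> p - 1" "Suc (p - 1) = p" using p(2) by (auto simp: P_def)
    moreover have "\<not> P (p - 1)" using p(1) False p(2) by (metis P_def diff_less le_zero_eq neq0_conv not_less_Least zero_less_one)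
    ultimately show ?thesis by (simp add: P_def not_less del: power_Suc)
  qed (use assms in simp)
  then show ?thesis using that p(2) by (auto simp: P_def)
qed

lemma nat_block_exists:
  fixes n :: nat
  assumes "2 ^ I \<le> n" "n < 2 ^ J"
  obtains m where "m \<in> {I..<J}" "n \<in> block m"
proof -
  have "\<exists>m. 2 ^ m \<le> n \<and> n < 2 ^ (m + 1)"
  proof (rule ex_power_ivl1)
    have "1 \<le> (2::nat) ^ I" by simp
    then show "1 \<le> n" using assms(1) by (rule order_trans)
  qed simp
  then obtain m where m: "2 ^ m \<le> n" "n < 2 ^ (m + 1)" by blast
  have "(2::nat) ^ I < 2 ^ (m + 1)" "(2::nat) ^ m < 2 ^ J" using m assms by linarith+
  then have "I < m + 1" "m < J" 
    using power_less_imp_less_exp[of "2::nat" I "m + 1"] power_less_imp_less_exp[of "2::nat" m J] by simp_all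
  then show ?thesis using that[of m] m by simp
qed

theorem secular_coefficients_bound:
  fixes M :: "'a measure" and X :: "nat \<Rightarrow> 'a \<Rightarrow> complex" and A :: "nat \<Rightarrow> 'a \<Rightarrow> complex"
  assumes M: "prob_space M" and ind: "prob_space.indep_vars M (\<lambda>_. borel) X {1..}"
    and X: "\<And>k. k \<ge> 1 \<Longrightarrow> std_complex_gaussian M (X k)"
    and A: "\<And>\<omega>. \<omega> \<in> space M \<Longrightarrow> fps_exp 1 oo sqrt_weighted_fps (\<lambda>k. X k \<omega>) = Abs_fps (\<lambda>n. A n \<omega>)"
  shows "AE \<omega> in M. \<exists>N. \<forall>n\<ge>N. cmod (A n \<omega>) \<le> 4 * ln (real n) powr (3 / 4)"
proof -
  interpret prob_space M by fact
  have Xm [measurable]: "X k \<in> borel_measurable M" if "k \<ge> 1" for k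
    using distr_std_complex_gaussian[OF M X] that by auto
  have gm [measurable]: "(\<lambda>\<omega>. gexp {1..<K} (\<lambda>k. X k \<omega>) $ n) \<in> borel_measurable M" for K n
    by (rule measurable_zexp_nth) (use Xm in measurable)
  have An: "A n \<omega> = gexp {1..<K} (\<lambda>k. X k \<omega>) $ n" if "\<omega> \<in> space M" "n < K" for n \<omega> K
    using sqrt_weighted_fps_exp_nth[OF that(2), of "\<lambda>k. X k \<omega>"] A[OF that(1)] by simp
  define G where "G p = {\<omega>. \<exists>m\<in>{16 ^ p..<16 ^ Suc p}. \<exists>n\<in>block m. 2 * 8 ^ p < cmod (gexp {1..<2 ^ Suc m} (\<lambda>k. X k \<omega>) $ n)}" for p :: nat
  define E where "E p = {\<omega> \<in> space M. \<exists>m\<in>{16 ^ p..<16 ^ Suc p}. \<exists>n\<in>block m. 2 * 8 ^ p < cmod (gexp {1..<2 ^ Suc m} (\<lambda>k. X k \<omega>) $ n)}" for p :: nat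
  define b where "b p = (1 / 2) ^ p + 4 * exp (- 1) ^ p + exp 3 * exp (- 1 :: real) ^ p" for p :: nat
  have Em [measurable]: "E p \<in> sets M" for p unfolding E_def by measurable
  have bound: "\<forall>\<^sub>F p in sequentially. prob (E p) \<le> b p"
    using tail_parameters eventually_gt_at_top[of 0]
  proof eventually_elim
    case (elim p)
    have q: "4 * p + 6 \<le> 16 ^ p"
    proof -
      have "4 * p + 6 \<le> 16 ^ p" using elim(2)
        by (induction p rule: nat_induct_non_zero) auto
      then show ?thesis .
    qed
    have "emeasure M (E p) = (\<integral>\<^sup>+\<omega>. indicator (E p) \<omega> \<partial>M)" by simp
    also have "\<dots> = (\<integral>\<^sup>+\<omega>. indicator (G p) \<omega> \<partial>M)"
      by (rule nn_integral_cong) (simp add: indicator_def E_def G_def)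
    also have "\<dots> \<le> ennreal (1 / 2 ^ p + 4 * 2 ^ (16 ^ Suc p) * exp (2 * (64 * 2 ^ p)\<^sup>2 * 2 ^ p * real (4 * p + 6 + 1) - 64 * 2 ^ p * 8 ^ p / 4)
      + 2 ^ (16 ^ Suc p) * (exp 3 * 2 ^ (16 ^ Suc p) * exp (- (2 ^ (4 * p + 6))) / (8 ^ p)\<^sup>2))"
      unfolding G_def by (rule scale_tail[OF M ind X q]) auto
    also have "\<dots> \<le> ennreal (b p)" unfolding b_def by (rule ennreal_leI[OF elim(1)])
    finally have "ennreal (prob (E p)) \<le> ennreal (b p)" by (simp only: emeasure_eq_measure)
    moreover have "b p \<ge> 0" by (simp add: b_def)
    ultimately show ?case using ennreal_le_iff by blast
  qed
  have "summable (\<lambda>p. prob (E p))"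
  proof (rule summable_comparison_test_ev)
    show "\<forall>\<^sub>F p in sequentially. norm (prob (E p)) \<le> b p" using bound by simp
    show "summable b" unfolding b_def by (intro summable_add summable_mult summable_geometric) auto
  qed
  then have "AE \<omega> in M. \<forall>\<^sub>F p in sequentially. \<omega> \<in> space M - E p"
    by (intro borel_cantelli_AE1) (auto simp: emeasure_eq_measure)
  then show ?thesis
  proof (rule AE_mp, intro AE_I2 impI)
    fix \<omega> assume \<omega>: "\<omega> \<in> space M" and "\<forall>\<^sub>F p in sequentially. \<omega> \<in> space M - E p"
    then obtain p0 where p0: "\<And>p. p \<ge> p0 \<Longrightarrow> \<omega> \<notin> E p" by (auto simp: eventually_sequentially)
    show "\<exists>N. \<forall>n\<ge>N. cmod (A n \<omega>) \<le> 4 * ln (real n) powr (3 / 4)"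
    proof (intro exI allI impI)
      fix n :: nat assume "n \<ge> 2 ^ (16 ^ p0)"
      then obtain p where p: "p \<ge> p0" "2 ^ (16 ^ p) \<le> n" "n < 2 ^ (16 ^ Suc p)" by (rule scale_exists)
      obtain m where m: "m \<in> {16 ^ p..<16 ^ Suc p}" "n \<in> block m" using p(2,3) by (rule nat_block_exists)
      have "cmod (gexp {1..<2 ^ Suc m} (\<lambda>k. X k \<omega>) $ n) \<le> 2 * 8 ^ p"
        using p0[OF p(1)] \<omega> m unfolding E_def by (simp only: mem_Collect_eq not_less[symmetric]) blast
      moreover have "A n \<omega> = gexp {1..<2 ^ Suc m} (\<lambda>k. X k \<omega>) $ n" by (rule An[OF \<omega>]) (use m in simp)
      ultimately have "cmod (A n \<omega>) \<le> 2 * 8 ^ p" by simp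
      also have "(8::real) ^ p = (16 ^ p) powr (3 / 4)"
      proof -
        have "(16::real) powr (3 / 4) = (2 powr 4) powr (3 / 4)" by simp
        also have "\<dots> = 2 powr 3" by (simp only: powr_powr) simp
        finally have "(16::real) powr (3 / 4) = 8" by simp
        then have "(8::real) ^ p = (16 powr (3 / 4)) powr real p" by (simp only: powr_realpow zero_less_numeral)
        also have "\<dots> = (16 powr real p) powr (3 / 4)" by (simp only: powr_powr mult.commute)
        finally show ?thesis by (simp add: powr_realpow)
      qed
      also have "2 * (16 ^ p) powr (3 / 4 :: real) \<le> 2 * (2 * ln (real n)) powr (3 / 4)"
      proof (intro mult_left_mono powr_mono2)
        have "real (2 ^ (16 ^ p)) \<le> real n" using p(2) by (rule of_nat_mono)
        then have "ln (2 ^ (16 ^ p)) \<le> ln (real n)" by (subst ln_le_cancel_iff) (auto intro: less_le_trans[of 0 "2 ^ (16 ^ p)"])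
        then have "16 ^ p * ln 2 \<le> ln (real n)" by (simp add: ln_realpow)
        moreover have "16 ^ p * (1 / 2) \<le> 16 ^ p * ln (2::real)" using ln2_ge_two_thirds by (intro mult_left_mono) auto
        ultimately show "16 ^ p \<le> 2 * ln (real n)" by linarith
      qed auto
      also have "\<dots> \<le> 4 * ln (real n) powr (3 / 4)"
      proof -
        have "(2::real) powr (3 / 4) \<le> 2 powr 1" by (intro powr_mono) auto
        moreover have "real n \<ge> 1" using p(2) by (metis one_le_numeral one_le_power order_trans of_nat_1 of_nat_mono)
        ultimately show ?thesis by (simp add: powr_mult mult_right_mono)
      qed
      finally show "cmod (A n \<omega>) \<le> 4 * ln (real n) powr (3 / 4)" .
    qed
  qed
qed

theorem theorem1p1:
  fixes M :: "'a measure"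
    and X :: "nat \<Rightarrow> 'a \<Rightarrow> complex"
    and A :: "nat \<Rightarrow> 'a \<Rightarrow> complex"
    and \<epsilon> :: real
  assumes "\<epsilon> > 0"
    and "prob_space M"
    and "prob_space.indep_vars M (\<lambda>_. borel) X {1..}"
    and "\<And>k. k \<ge> 1 \<Longrightarrow> std_complex_gaussian M (X k)"
    and "\<And>\<omega>. \<omega> \<in> space M \<Longrightarrow>
           fps_exp 1 oo sqrt_weighted_fps (\<lambda>k. X k \<omega>) = Abs_fps (\<lambda>n. A n \<omega>)"
  shows "AE \<omega> in M. \<exists>(C::real) (N::nat). \<forall>n\<ge>N.
           cmod (A n \<omega>) \<le> C * ln (real n) powr (3 / 4 + \<epsilon>)"
proof (rule AE_mp[OF secular_coefficients_bound[OF assms(2,3)]], fact assms(4), fact assms(5), intro AE_I2 impI)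
  fix \<omega> assume "\<exists>N. \<forall>n\<ge>N. cmod (A n \<omega>) \<le> 4 * ln (real n) powr (3 / 4)"
  then obtain N where N: "\<And>n. n \<ge> N \<Longrightarrow> cmod (A n \<omega>) \<le> 4 * ln (real n) powr (3 / 4)" by blast
  show "\<exists>(C::real) (N::nat). \<forall>n\<ge>N. cmod (A n \<omega>) \<le> C * ln (real n) powr (3 / 4 + \<epsilon>)"
  proof (intro exI allI impI)
    fix n assume n: "n \<ge> max N 3"
    have "exp 1 \<le> real n" using n exp_le by linarith
    then have "1 \<le> ln (real n)" using n by (subst ln_ge_iff) auto
    then have "ln (real n) powr (3 / 4) \<le> ln (real n) powr (3 / 4 + \<epsilon>)"
      using assms(1) by (intro powr_mono) auto
    then show "cmod (A n \<omega>) \<le> 4 * ln (real n) powr (3 / 4 + \<epsilon>)" using N[of n] n by linarith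
  qed
qed

end
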